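(* Let $k$ be a regular ring, set $R=k[x_1,\ldots,x_n]$ and let $I\subset R$ be a radical ideal with $r=\max\{\operatorname{ht}(P)\mid P\in\operatorname{Min}(I)\}$. Let $A=R/I$, let $J_r(A)$ be the $(n-r)$-th Fitting ideal of $\Omega_{A/k}$, and let $J_r^0(A)$ be some lifting of $J_r(A)$ in $R$. Then $(J_r^0(A)+I)\operatorname{Der}_k(\log I)\subset\operatorname{IDer}_k(\log I)$. As a consequence, $J_r(A)\operatorname{Der}_k(A)\subset\operatorname{IDer}_k(A)$.
   Context: All rings are commutative with unit. $\operatorname{Min}(I)$ is the set of minimal primes of $I$ and $\operatorname{ht}(P)$ is the height of $P$ in $R$. For a $k$-algebra $B$, $\operatorname{Der}_k(B)$ is the $B$-module of $k$-derivations $B\to B$. A Hasse-Schmidt derivation of $B$ over $k$ of length $\infty$ is a sequence $D=(D_0,D_1,\ldots)$ of $k$-linear maps $D_\alpha:B\to B$ with $D_0=\mathrm{Id}_B$ and $D_\alpha(xy)=\sum_{i+j=\alpha}D_i(x)D_j(y)$ for all $x,y\in B$ and all $\alpha$. $\operatorname{IDer}_k(B)$ is the $B$-submodule of $\operatorname{Der}_k(B)$ of $\infty$-integrable derivations, i.e. those $\delta$ for which there is such a $D$ with $D_1=\delta$. For the ideal $I\subset R$: $\operatorname{Der}_k(\log I)=\{\delta\in\operatorname{Der}_k(R)\mid\delta(I)\subset I\}$, and $\operatorname{IDer}_k(\log I)$ is the set of $\delta\in\operatorname{Der}_k(R)$ for which there is a Hasse-Schmidt derivation $D$ of $R$ over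 $k$ of length $\infty$ with $D_1=\delta$ and $D_\alpha(I)\subset I$ for all $\alpha$. The $(n-r)$-th Fitting ideal $J_r(A)$ of $\Omega_{A/k}$ is the ideal of $A$ generated by the classes of the $r\times r$ minors of the Jacobian matrix $(\partial f_i/\partial x_j)$ of a set of generators $f_1,\ldots,f_s$ of $I$ (it is the zero ideal if there are no such minors). A lifting of $J_r(A)$ in $R$ is an ideal of $R$ whose image in $A$ is $J_r(A)$. *)

theory Defs
  imports
    "HOL-Library.Poly_Mapping"
    "HOL-Library.Extended_Nat"
    "Jordan_Normal_Form.Determinant"
    "Jordan_Normal_Form.DL_Submatrix"
    "HOL-Algebra.Ring_Divisibility"
begin

text \<open>Otherwise \<open>mult\<close> would not denote the field of ring records.\<close>

hide_const (open) Multiset.mult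

section \<open>Dimension theory and regular rings\<close>

definition prime_chain :: "('b, 'm) ring_scheme \<Rightarrow> (nat \<Rightarrow> 'b set) \<Rightarrow> nat \<Rightarrow> bool" where
  "prime_chain B C l \<longleftrightarrow> (\<forall>i\<le>l. primeideal (C i) B) \<and> (\<forall>i<l. C i \<subset> C (Suc i))"

definition height :: "('b, 'm) ring_scheme \<Rightarrow> 'b set \<Rightarrow> enat" where
  "height B P = Sup {enat l |l. \<exists>C. prime_chain B C l \<and> C l = P}"

definition krull_dim :: "('b, 'm) ring_scheme \<Rightarrow> enat" where
  "krull_dim B = Sup {enat l |l. \<exists>C. prime_chain B C l}"

definition min_primes :: "('b, 'm) ring_scheme \<Rightarrow> 'b set \<Rightarrow> 'b set set" where
  "min_primes B I =
     {P. primeideal P B \<and> I \<subseteq> P \<and> (\<forall>Q. primeideal Q B \<and> I \<subseteq> Q \<and> Q \<subseteq> P \<longrightarrow> Q = P)}"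

definition radical_ideal :: "'b set \<Rightarrow> ('b, 'm) ring_scheme \<Rightarrow> bool" where
  "radical_ideal I B \<longleftrightarrow>
     ideal I B \<and> (\<forall>x\<in>carrier B. \<forall>m::nat. x [^]\<^bsub>B\<^esub> m \<in> I \<longrightarrow> x \<in> I)"

text \<open>The class of the fraction \<open>a / s\<close>, as a set of pairs. The factor \<open>u\<close> is needed
  because \<open>B\<close> may have zero divisors.\<close>

definition fraction :: "('b, 'm) ring_scheme \<Rightarrow> 'b set \<Rightarrow> 'b \<Rightarrow> 'b \<Rightarrow> ('b \<times> 'b) set" where
  "fraction B S a s =
     {(b, t). b \<in> carrier B \<and> t \<in> S \<and>
        (\<exists>u\<in>S. u \<otimes>\<^bsub>B\<^esub> (a \<otimes>\<^bsub>B\<^esub> t) = u \<otimes>\<^bsub>B\<^esub> (b \<otimes>\<^bsub>B\<^esub> s))}"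

definition localization :: "('b, 'm) ring_scheme \<Rightarrow> 'b set \<Rightarrow> ('b \<times> 'b) set ring" where
  "localization B S =
     \<lparr>carrier = {fraction B S a s |a s. a \<in> carrier B \<and> s \<in> S},
      mult = (\<lambda>U V. \<Union>x\<in>U. \<Union>y\<in>V. fraction B S (fst x \<otimes>\<^bsub>B\<^esub> fst y) (snd x \<otimes>\<^bsub>B\<^esub> snd y)),
      one = fraction B S \<one>\<^bsub>B\<^esub> \<one>\<^bsub>B\<^esub>,
      zero = fraction B S \<zero>\<^bsub>B\<^esub> \<one>\<^bsub>B\<^esub>,
      add = (\<lambda>U V. \<Union>x\<in>U. \<Union>y\<in>V.
        fraction B S ((fst x \<otimes>\<^bsub>B\<^esub> snd y) \<oplus>\<^bsub>B\<^esub> (fst y \<otimes>\<^bsub>B\<^esub> snd x)) (snd x \<otimes>\<^bsub>B\<^esub> snd y))\<rparr>"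

definition regular_local_ring :: "('b, 'm) ring_scheme \<Rightarrow> bool" where
  "regular_local_ring L \<longleftrightarrow> cring L \<and> noetherian_ring L \<and> (\<exists>!M. maximalideal M L) \<and>
     (\<forall>M. maximalideal M L \<longrightarrow>
        (\<exists>G\<subseteq>carrier L. finite G \<and> enat (card G) = krull_dim L \<and> M = Idl\<^bsub>L\<^esub> G))"

definition regular_ring :: "('b, 'm) ring_scheme \<Rightarrow> bool" where
  "regular_ring B \<longleftrightarrow> cring B \<and> noetherian_ring B \<and>
     (\<forall>P. primeideal P B \<longrightarrow> regular_local_ring (localization B (carrier B - P)))"


section \<open>Derivations and Hasse-Schmidt derivations\<close>

text \<open>A \<open>K\<close>-algebra is a ring \<open>B\<close> together with its structure map \<open>\<iota>\<close> from \<open>K\<close> to \<open>B\<close>.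
  As for \<^const>\<open>ring_hom\<close>, maps are only constrained on the carrier, and
  two maps that agree there represent the same derivation.\<close>

definition alg_linear ::
  "('k, 'm) ring_scheme \<Rightarrow> ('b, 'n) ring_scheme \<Rightarrow> ('k \<Rightarrow> 'b) \<Rightarrow> ('b \<Rightarrow> 'b) \<Rightarrow> bool" where
  "alg_linear K B \<iota> f \<longleftrightarrow> f \<in> carrier B \<rightarrow> carrier B \<and>
     (\<forall>x\<in>carrier B. \<forall>y\<in>carrier B. f (x \<oplus>\<^bsub>B\<^esub> y) = f x \<oplus>\<^bsub>B\<^esub> f y) \<and>
     (\<forall>c\<in>carrier K. \<forall>x\<in>carrier B. f (\<iota> c \<otimes>\<^bsub>B\<^esub> x) = \<iota> c \<otimes>\<^bsub>B\<^esub> f x)"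

definition Der ::
  "('k, 'm) ring_scheme \<Rightarrow> ('b, 'n) ring_scheme \<Rightarrow> ('k \<Rightarrow> 'b) \<Rightarrow> ('b \<Rightarrow> 'b) set" where
  "Der K B \<iota> = {\<delta>. alg_linear K B \<iota> \<delta> \<and>
     (\<forall>x\<in>carrier B. \<forall>y\<in>carrier B. \<delta> (x \<otimes>\<^bsub>B\<^esub> y) = (x \<otimes>\<^bsub>B\<^esub> \<delta> y) \<oplus>\<^bsub>B\<^esub> (y \<otimes>\<^bsub>B\<^esub> \<delta> x))}"

definition HS ::
  "('k, 'm) ring_scheme \<Rightarrow> ('b, 'n) ring_scheme \<Rightarrow> ('k \<Rightarrow> 'b) \<Rightarrow> (nat \<Rightarrow> 'b \<Rightarrow> 'b) set" where
  "HS K B \<iota> = {D. (\<forall>\<alpha>. alg_linear K B \<iota> (D \<alpha>)) \<and> (\<forall>x\<in>carrier B. D 0 x = x) \<and>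
     (\<forall>\<alpha>. \<forall>x\<in>carrier B. \<forall>y\<in>carrier B.
        D \<alpha> (x \<otimes>\<^bsub>B\<^esub> y) = (\<Oplus>\<^bsub>B\<^esub>i\<in>{..\<alpha>}. D i x \<otimes>\<^bsub>B\<^esub> D (\<alpha> - i) y))}"

definition IDer ::
  "('k, 'm) ring_scheme \<Rightarrow> ('b, 'n) ring_scheme \<Rightarrow> ('k \<Rightarrow> 'b) \<Rightarrow> ('b \<Rightarrow> 'b) set" where
  "IDer K B \<iota> = {\<delta> \<in> Der K B \<iota>. \<exists>D\<in>HS K B \<iota>. \<forall>x\<in>carrier B. D 1 x = \<delta> x}"

definition Der_log ::
  "('k, 'm) ring_scheme \<Rightarrow> ('b, 'n) ring_scheme \<Rightarrow> ('k \<Rightarrow> 'b) \<Rightarrow> 'b set \<Rightarrow> ('b \<Rightarrow> 'b) set" where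
  "Der_log K B \<iota> I = {\<delta> \<in> Der K B \<iota>. \<delta> ` I \<subseteq> I}"

definition IDer_log ::
  "('k, 'm) ring_scheme \<Rightarrow> ('b, 'n) ring_scheme \<Rightarrow> ('k \<Rightarrow> 'b) \<Rightarrow> 'b set \<Rightarrow> ('b \<Rightarrow> 'b) set" where
  "IDer_log K B \<iota> I =
     {\<delta> \<in> Der K B \<iota>. \<exists>D\<in>HS K B \<iota>. (\<forall>x\<in>carrier B. D 1 x = \<delta> x) \<and> (\<forall>\<alpha>. D \<alpha> ` I \<subseteq> I)}"

text \<open>The product \<open>J M\<close> of an ideal and a module of maps: all finite sums of products \<open>a \<delta>\<close>.\<close>

inductive_set ideal_module_prod ::
  "('b, 'm) ring_scheme \<Rightarrow> 'b set \<Rightarrow> ('b \<Rightarrow> 'b) set \<Rightarrow> ('b \<Rightarrow> 'b) set"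
  for B (structure) and J and M where
    zero: "(\<lambda>x. \<zero>) \<in> ideal_module_prod B J M"
  | add: "\<lbrakk>a \<in> J; \<delta> \<in> M; \<epsilon> \<in> ideal_module_prod B J M\<rbrakk>
      \<Longrightarrow> (\<lambda>x. (a \<otimes> \<delta> x) \<oplus> \<epsilon> x) \<in> ideal_module_prod B J M"


section \<open>Polynomial rings in finitely many variables\<close>

text \<open>Polynomials in the variables \<open>x\<^sub>0, x\<^sub>1, \<dots>\<close> over \<open>'a\<close>: finitely supported maps from
  monomials (finitely supported exponent functions) to coefficients.\<close>

type_synonym 'a mpoly = "(nat \<Rightarrow>\<^sub>0 nat) \<Rightarrow>\<^sub>0 'a"

definition coeff_ring :: "'a::comm_ring_1 ring" where
  "coeff_ring = \<lparr>carrier = UNIV, mult = (*), one = 1, zero = 0, add = (+)\<rparr>"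

text \<open>The polynomial ring in the \<open>n\<close> variables \<open>x\<^sub>0, \<dots>, x\<^bsub>n-1\<^esub>\<close>.\<close>

definition mpoly_ring :: "nat \<Rightarrow> 'a::comm_ring_1 mpoly ring" where
  "mpoly_ring n =
     \<lparr>carrier = {p. \<forall>m\<in>Poly_Mapping.keys p. Poly_Mapping.keys m \<subseteq> {..<n}},
      mult = (*), one = 1, zero = 0, add = (+)\<rparr>"

definition mpoly_const :: "'a::comm_ring_1 \<Rightarrow> 'a mpoly" where
  "mpoly_const c = Poly_Mapping.single 0 c"

definition partial_deriv :: "nat \<Rightarrow> 'a::comm_ring_1 mpoly \<Rightarrow> 'a mpoly" where
  "partial_deriv j p = (\<Sum>m\<in>Poly_Mapping.keys p.
     Poly_Mapping.single (m - Poly_Mapping.single j 1)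
       (of_nat (Poly_Mapping.lookup m j) * Poly_Mapping.lookup p m))"

definition jacobian_mat :: "nat \<Rightarrow> 'a::comm_ring_1 mpoly list \<Rightarrow> 'a mpoly mat" where
  "jacobian_mat n fs = mat (length fs) n (\<lambda>(i, j). partial_deriv j (fs ! i))"

text \<open>For \<open>r = 0\<close> the only minor is the empty one, with value \<open>1\<close>.\<close>

definition minors :: "nat \<Rightarrow> 'c::comm_ring_1 mat \<Rightarrow> 'c set" where
  "minors r M = {det (submatrix M U V) |U V.
     U \<subseteq> {..<dim_row M} \<and> V \<subseteq> {..<dim_col M} \<and> card U = r \<and> card V = r}"

text \<open>The quotient \<open>A = R / I\<close> of the polynomial ring, its structure map, and the ideal \<open>J\<^sub>r(A)\<close>
  of \<open>A\<close>, computed from a list \<open>fs\<close> of generators of \<open>I\<close>.\<close>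

abbreviation quot_alg :: "nat \<Rightarrow> 'a::comm_ring_1 mpoly set \<Rightarrow> 'a mpoly set ring" where
  "quot_alg n I \<equiv> mpoly_ring n Quot I"

definition quot_const :: "nat \<Rightarrow> 'a::comm_ring_1 mpoly set \<Rightarrow> 'a \<Rightarrow> 'a mpoly set" where
  "quot_const n I c = I +>\<^bsub>mpoly_ring n\<^esub> mpoly_const c"

definition fitting_ideal ::
  "nat \<Rightarrow> 'a::comm_ring_1 mpoly set \<Rightarrow> 'a mpoly list \<Rightarrow> nat \<Rightarrow> 'a mpoly set set" where
  "fitting_ideal n I fs r =
     Idl\<^bsub>quot_alg n I\<^esub> ((\<lambda>p. I +>\<^bsub>mpoly_ring n\<^esub> p) ` minors r (jacobian_mat n fs))"

end

theory Submission
  imports Defs "HOL-Computational_Algebra.Formal_Power_Series"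
begin

text \<open>
  Write \<open>R\<close> for the polynomial ring, \<open>x\<^sub>j\<close> for its variables, and let \<open>\<delta>\<close> be a derivation of \<open>R\<close>
  with \<open>\<delta>(I) \<subseteq> I\<close>. A homomorphism \<open>\<phi>\<close> from \<open>R\<close> to \<open>R[[t]]\<close> over \<open>k\<close> that is the identity modulo \<open>t\<close> is
  the same thing as a Hasse-Schmidt derivation of \<open>R\<close> of infinite length, and \<open>\<phi>\<close> may be prescribed
  freely on the variables. So \<open>c \<delta>\<close> is integrable along \<open>I\<close> as soon as there are power
  series \<open>w\<^sub>j = \<delta>(x\<^sub>j) t + \<dots>\<close> such that \<open>x\<^sub>j \<mapsto> x\<^sub>j + c w\<^sub>j\<close> maps \<open>I\<close> into \<open>I[[t]]\<close>.

  Let \<open>c = det J\<close> be an \<open>r \<times> r\<close> minor of the Jacobian matrix, formed from \<open>f\<^sub>1, \<dots>, f\<^sub>r \<in> I\<close>. The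
  series \<open>w\<^sub>j\<close> are found coefficient by coefficient (lemma \<open>shifted_point_lift\<close>), as in Hensel's lemma:
  if they are known below degree \<open>m \<ge> 2\<close>, the coefficient of \<open>t\<^sup>m\<close> in \<open>f\<^sub>i(x + c w)\<close> is \<open>c\<^sup>2 q\<^sub>i\<close> by Taylor
  expansion, and the new terms \<open>y t\<^sup>m\<close> add \<open>c J y\<close> to it. As \<open>J adj(J) = c\<close>, the choice \<open>y = - adj(J) q\<close>
  makes it vanish. In degree one the obstruction is \<open>c \<delta>(f\<^sub>i)\<close>, which lies in \<open>I\<close>.

  This controls the images of the \<open>f\<^sub>i\<close> only. Since \<open>I\<close> is radical, it is the intersection of its
  minimal primes \<open>P\<close>, so it suffices to see that \<open>I\<close> is mapped into \<open>P[[t]]\<close> for each of them. If \<open>c \<in> P\<close>,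
  then \<open>\<phi>\<close> is the identity modulo \<open>P\<close>. If \<open>c \<notin> P\<close>, the \<open>f\<^sub>i\<close> generate \<open>P\<close> locally
  at \<open>P\<close>: for \<open>g \<in> P\<close> there is \<open>s \<notin> P\<close> with \<open>s g \<in> (f\<^sub>1, \<dots>, f\<^sub>r)\<close>. Then \<open>\<phi>(s) \<phi>(g) \<in> P[[t]]\<close>, where
  \<open>\<phi>(s)\<close> has constant term \<open>s \<notin> P\<close>, and \<open>\<phi>(g) \<in> P[[t]]\<close> because \<open>P\<close> is prime.

  That the \<open>f\<^sub>i\<close> generate \<open>P\<close> locally is where regularity of \<open>k\<close> and the height of \<open>P\<close> enter. By
  \<open>generated_by_height_polys\<close> a prime \<open>P\<close> is locally generated by \<open>h\<close> elements for some \<open>h\<close> that is the length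
  of a chain of primes ending in \<open>P\<close>, so by \<open>r\<close> elements \<open>g\<^sub>l\<close> if \<open>P\<close> has height at most \<open>r\<close>.
  Writing \<open>s f\<^sub>i = \<Sum> C\<^sub>i\<^sub>l g\<^sub>l\<close> with \<open>s \<notin> P\<close> and differentiating modulo \<open>P\<close> gives
  \<open>s\<^sup>r c \<equiv> det(C) det(\<partial>g)\<close>. Hence \<open>det C \<notin> P\<close>, and the adjugate of \<open>C\<close>
  expresses the \<open>g\<^sub>l\<close> by the \<open>f\<^sub>i\<close>; this is \<open>saturation_of_jacobian_det_notin\<close>.

  Integrable logarithmic derivations are closed under addition, by composing Hasse-Schmidt
  derivations. Therefore the \<open>c\<close> such that \<open>c \<delta>\<close> is integrable along \<open>I\<close> for all logarithmic \<open>\<delta>\<close> form an ideal of \<open>R\<close>;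
  it contains \<open>I\<close> and the minors, so it contains \<open>J0 + I\<close>. For the quotient,
  every derivation of \<open>R / I\<close> lifts to a logarithmic derivation of \<open>R\<close>, and Hasse-Schmidt derivations that
  preserve \<open>I\<close> descend.
\<close>

hide_const (open) Multiset.mult

section \<open>Ideals and minimal primes\<close>

lemma cring_idealI:
  assumes "cring R" "I \<subseteq> carrier R" "\<zero>\<^bsub>R\<^esub> \<in> I"
    and add: "\<And>x y. x \<in> I \<Longrightarrow> y \<in> I \<Longrightarrow> x \<oplus>\<^bsub>R\<^esub> y \<in> I"
    and mult: "\<And>a x. a \<in> carrier R \<Longrightarrow> x \<in> I \<Longrightarrow> a \<otimes>\<^bsub>R\<^esub> x \<in> I"
  shows "ideal I R"
proof -
  interpret cring R by fact
  show ?thesis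
  proof (rule idealI)
    show "subgroup I (add_monoid R)"
    proof (rule group.subgroupI)
      show "group (add_monoid R)" by (rule a_group)
      fix x assume x: "x \<in> I"
      then have xc: "x \<in> carrier R" using assms(2) by blast
      have "\<ominus>\<^bsub>R\<^esub> \<one>\<^bsub>R\<^esub> \<otimes>\<^bsub>R\<^esub> x \<in> I" using x by (intro mult) simp_all
      then have "\<ominus>\<^bsub>R\<^esub> x \<in> I" using xc by (simp add: l_minus)
      then show "inv\<^bsub>add_monoid R\<^esub> x \<in> I" by (simp add: a_inv_def)
    qed (use assms in auto)
    fix a x assume ax: "a \<in> I" "x \<in> carrier R"
    then have ac: "a \<in> carrier R" using assms(2) by blast
    show "x \<otimes>\<^bsub>R\<^esub> a \<in> I" using ax by (intro mult)
    then show "a \<otimes>\<^bsub>R\<^esub> x \<in> I" using m_comm[OF ac ax(2)] by simp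
  qed (rule ring_axioms)
qed

text \<open>
  The complement of a multiplicative set \<open>W\<close> that contains \<open>x\<close> and is maximal with the property
  of avoiding \<open>I\<close> is the required prime. For \<open>a \<notin> W\<close> the multiplicative set generated by \<open>W\<close> and
  \<open>a\<close> meets \<open>I\<close>, so \<open>w a\<^sup>m \<in> I\<close> for some \<open>w \<in> W\<close>, and then \<open>w a \<in> I\<close> because \<open>I\<close> is radical.
  This description of the complement makes it an ideal, and it lies in every prime \<open>Q\<close> over \<open>I\<close>
  that avoids \<open>W\<close>, which gives minimality.
\<close>

lemma radical_ideal_min_primes:
  fixes R (structure)
  assumes "cring R" "radical_ideal I R" "x \<in> carrier R" "x \<notin> I"
  shows "\<exists>P\<in>min_primes R I. x \<notin> P"
proof -
  interpret cring R by fact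
  interpret ideal I R using assms(2) by (simp add: radical_ideal_def)
  have rad: "\<And>y m. y \<in> carrier R \<Longrightarrow> y [^] (m::nat) \<in> I \<Longrightarrow> y \<in> I"
    using assms(2) unfolding radical_ideal_def by blast
  define MS where "MS = {W. W \<subseteq> carrier R \<and> \<one> \<in> W \<and> x \<in> W \<and>
    (\<forall>a\<in>W. \<forall>b\<in>W. a \<otimes> b \<in> W) \<and> W \<inter> I = {}}"
  define W0 where "W0 = range (\<lambda>m::nat. x [^] m)"
  have "W0 \<in> MS"
  proof -
    have "x = x [^] (1::nat)" using nat_pow_eone[OF assms(3)] by simp
    then have "x \<in> W0" unfolding W0_def by blast
    moreover have "\<one> \<in> W0" unfolding W0_def using nat_pow_0[of x] by (metis rangeI)
    moreover have "a \<otimes> b \<in> W0" if "a \<in> W0" "b \<in> W0" for a b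
    proof -
      obtain m l where "a = x [^] (m::nat)" "b = x [^] (l::nat)" using \<open>a \<in> W0\<close> \<open>b \<in> W0\<close> unfolding W0_def by blast
      then have "a \<otimes> b = x [^] (m + l)" by (simp only: nat_pow_mult[OF assms(3)])
      then show ?thesis unfolding W0_def by blast
    qed
    moreover have "W0 \<inter> I = {}" using rad[OF assms(3)] assms(4) unfolding W0_def by blast
    moreover have "W0 \<subseteq> carrier R" unfolding W0_def using assms(3) by auto
    ultimately show ?thesis unfolding MS_def by blast
  qed
  moreover have "\<Union> C \<in> MS" if C: "C \<noteq> {}" "subset.chain MS C" for C
  proof -
    have CM: "\<And>W. W \<in> C \<Longrightarrow> W \<in> MS" using C(2) by (auto simp: subset_chain_def)
    have "a \<otimes> b \<in> \<Union>C" if "a \<in> \<Union>C" "b \<in> \<Union>C" for a b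
    proof -
      obtain U V where UV: "U \<in> C" "V \<in> C" "a \<in> U" "b \<in> V" using \<open>a \<in> \<Union>C\<close> \<open>b \<in> \<Union>C\<close> by blast
      then have "U \<subseteq> V \<or> V \<subseteq> U" using C(2) by (auto simp: subset_chain_def)
      then show ?thesis using UV CM unfolding MS_def by blast
    qed
    then show ?thesis using CM C(1) unfolding MS_def by blast
  qed
  ultimately obtain W where W: "W \<in> MS" and max: "\<And>V. V \<in> MS \<Longrightarrow> W \<subseteq> V \<Longrightarrow> V = W"
    using subset_Zorn_nonempty[of MS] by blast
  have WR: "\<And>w. w \<in> W \<Longrightarrow> w \<in> carrier R" and W1: "\<one> \<in> W" and Wx: "x \<in> W"
    and Wm: "\<And>a b. a \<in> W \<Longrightarrow> b \<in> W \<Longrightarrow> a \<otimes> b \<in> W" and WI: "\<And>w. w \<in> W \<Longrightarrow> w \<notin> I"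
    using W unfolding MS_def by auto
  have key: "\<exists>w\<in>W. w \<otimes> a \<in> I" if a: "a \<in> carrier R" "a \<notin> W" for a
  proof (rule ccontr)
    assume no: "\<not> ?thesis"
    define V where "V = {w \<otimes> a [^] m |w m. w \<in> W \<and> (m::nat) \<in> UNIV}"
    have VI: "\<And>w m. w \<in> W \<Longrightarrow> w \<otimes> a [^] (m::nat) \<notin> I"
    proof
      fix w and m :: nat assume w: "w \<in> W" and i: "w \<otimes> a [^] m \<in> I"
      have wc: "w \<in> carrier R" using WR w by auto
      have "w [^] m \<otimes> (w \<otimes> a [^] m) \<in> I" using i wc by (metis I_l_closed nat_pow_closed)
      moreover have "w [^] m \<otimes> (w \<otimes> a [^] m) = w \<otimes> (w \<otimes> a) [^] m"
        using wc a by (simp add: nat_pow_distrib m_ac)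
      ultimately have "w \<otimes> (w \<otimes> a) [^] m \<in> I" by simp
      then have "(w \<otimes> (w \<otimes> a) [^] m) \<otimes> a \<in> I" using a(1) by (rule I_r_closed)
      then have "(w \<otimes> a) [^] (Suc m) \<in> I" using wc a by (simp add: m_ac)
      then have "w \<otimes> a \<in> I" by (rule rad[rotated]) (use wc a in auto)
      then show False using no w by blast
    qed
    have "V \<in> MS"
    proof -
      have sub: "W \<subseteq> V"
      proof
        fix w assume "w \<in> W"
        moreover from this have "w = w \<otimes> a [^] (0::nat)" using WR by simp
        ultimately show "w \<in> V" unfolding V_def by blast
      qed
      moreover have "b \<otimes> c \<in> V" if bc: "b \<in> V" "c \<in> V" for b c
      proof -
        obtain w m v l where "w \<in> W" "v \<in> W" "b = w \<otimes> a [^] (m::nat)" "c = v \<otimes> a [^] (l::nat)"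
          using bc unfolding V_def by blast
        moreover from this have "b \<otimes> c = (w \<otimes> v) \<otimes> (a [^] m \<otimes> a [^] l)"
          using a WR by (simp add: m_ac)
        moreover have "a [^] m \<otimes> a [^] l = a [^] (m + l)" using a by (simp add: nat_pow_mult)
        ultimately show ?thesis using Wm unfolding V_def by force
      qed
      moreover have "V \<subseteq> carrier R" unfolding V_def using WR a by auto
      moreover have "V \<inter> I = {}" using VI unfolding V_def by auto
      ultimately show ?thesis using W1 Wx unfolding MS_def by blast
    qed
    moreover have "W \<subseteq> V"
    proof
      fix w assume "w \<in> W"
      moreover from this have "w = w \<otimes> a [^] (0::nat)" using WR by simp
      ultimately show "w \<in> V" unfolding V_def by blast
    qed
    ultimately have "V = W" by (rule max)
    moreover have "a = \<one> \<otimes> a [^] (1::nat)" using nat_pow_eone[OF a(1)] a(1) by simp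
    then have "a \<in> V" unfolding V_def using W1 by blast
    ultimately show False using a by simp
  qed
  have conv: "a \<notin> W" if "a \<in> carrier R" "w \<in> W" "w \<otimes> a \<in> I" for a w
    using that Wm WI by blast
  define P where "P = carrier R - W"
  have "ideal P R"
  proof (rule cring_idealI)
    show "cring R" by (rule cring_axioms)
    show "P \<subseteq> carrier R" unfolding P_def by auto
    show "\<zero> \<in> P" unfolding P_def using WI[of \<zero>] by auto
  next
    fix a b assume ab: "a \<in> P" "b \<in> P"
    then obtain w v where w: "w \<in> W" "w \<otimes> a \<in> I" "v \<in> W" "v \<otimes> b \<in> I"
      using key unfolding P_def by blast
    have c: "a \<in> carrier R" "b \<in> carrier R" "w \<in> carrier R" "v \<in> carrier R"
      using ab w WR unfolding P_def by auto
    have "v \<otimes> (w \<otimes> a) \<oplus> w \<otimes> (v \<otimes> b) \<in> I"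
      using w c I_l_closed by (meson additive_subgroup.a_closed additive_subgroup_axioms)
    moreover have "v \<otimes> (w \<otimes> a) \<oplus> w \<otimes> (v \<otimes> b) = (w \<otimes> v) \<otimes> (a \<oplus> b)"
      using c by (simp add: r_distr m_ac)
    ultimately have "a \<oplus> b \<notin> W" using conv[of "a \<oplus> b" "w \<otimes> v"] w c Wm by auto
    then show "a \<oplus> b \<in> P" using c unfolding P_def by auto
  next
    fix y a assume ay: "y \<in> carrier R" "a \<in> P"
    then obtain w where w: "w \<in> W" "w \<otimes> a \<in> I" using key unfolding P_def by blast
    have c: "a \<in> carrier R" "w \<in> carrier R" using ay w WR unfolding P_def by auto
    have "y \<otimes> (w \<otimes> a) \<in> I" using w(2) ay(1) by (rule I_l_closed)
    then have "w \<otimes> (y \<otimes> a) \<in> I" using c ay by (simp add: m_ac)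
    then show "y \<otimes> a \<in> P" using conv[of "y \<otimes> a" w] w c ay unfolding P_def by auto
  qed
  then have prime: "primeideal P R"
  proof (rule primeidealI)
    show "carrier R \<noteq> P" using W1 unfolding P_def by auto
    show "a \<in> P \<or> b \<in> P" if "a \<in> carrier R" "b \<in> carrier R" "a \<otimes> b \<in> P" for a b
      using that Wm unfolding P_def by auto
  qed (rule cring_axioms)
  have "P \<in> min_primes R I"
    unfolding min_primes_def
  proof (intro CollectI conjI allI impI prime)
    show "I \<subseteq> P" unfolding P_def using a_subset WI by auto
    fix Q assume Q: "primeideal Q R \<and> I \<subseteq> Q \<and> Q \<subseteq> P"
    have "P \<subseteq> Q"
    proof
      fix a assume "a \<in> P"
      then obtain w where "w \<in> W" "w \<otimes> a \<in> I" "a \<in> carrier R" using key unfolding P_def by blast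
      then show "a \<in> Q" using Q primeideal.I_prime[of Q R w a] WR unfolding P_def by blast
    qed
    then show "Q = P" using Q by auto
  qed
  then show ?thesis using Wx unfolding P_def by blast
qed

section \<open>Subsets of a commutative ring as rings\<close>

text \<open>
  All rings that occur below apart from localizations and quotients are subsets of commutative
  rings that are types, with the operations of the type. In particular, the polynomial rings in
  \<open>0, 1, 2, \<dots>\<close> variables, form an increasing chain inside one type. Ideals of such a subset are
  the ideals of the following record; the locales below translate between the record and the
  type.
\<close>

definition subring_record :: "'b::comm_ring_1 set \<Rightarrow> 'b ring" where
  "subring_record T = \<lparr>carrier = T, mult = (*), one = 1, zero = 0, add = (+)\<rparr>"

lemma subring_record_simps [simp]:
  "carrier (subring_record T) = T"
  "x \<otimes>\<^bsub>subring_record T\<^esub> y = x * y"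
  "x \<oplus>\<^bsub>subring_record T\<^esub> y = x + y"
  "\<one>\<^bsub>subring_record T\<^esub> = 1"
  "\<zero>\<^bsub>subring_record T\<^esub> = 0"
  by (simp_all add: subring_record_def)

locale subring_of =
  fixes T :: "'b::comm_ring_1 set"
  assumes zero_closed [simp, intro]: "0 \<in> T"
    and one_closed [simp, intro]: "1 \<in> T"
    and add_closed [simp, intro]: "x \<in> T \<Longrightarrow> y \<in> T \<Longrightarrow> x + y \<in> T"
    and mult_closed [simp, intro]: "x \<in> T \<Longrightarrow> y \<in> T \<Longrightarrow> x * y \<in> T"
    and uminus_closed [simp, intro]: "x \<in> T \<Longrightarrow> - x \<in> T"
begin

lemma diff_closed [simp, intro]: "x \<in> T \<Longrightarrow> y \<in> T \<Longrightarrow> x - y \<in> T"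
  using add_closed[of x "- y"] by simp

lemma sum_closed [simp, intro]: "(\<And>i. i \<in> A \<Longrightarrow> f i \<in> T) \<Longrightarrow> sum f A \<in> T"
  by (induction A rule: infinite_finite_induct) auto

lemma prod_closed [simp, intro]: "(\<And>i. i \<in> A \<Longrightarrow> f i \<in> T) \<Longrightarrow> prod f A \<in> T"
  by (induction A rule: infinite_finite_induct) auto

lemma power_closed [simp, intro]: "x \<in> T \<Longrightarrow> x ^ k \<in> T"
  by (induction k) auto

lemma is_cring: "cring (subring_record T)"
proof (rule cringI)
  show "abelian_group (subring_record T)"
  proof (rule abelian_groupI)
    fix x assume "x \<in> carrier (subring_record T)"
    then show "\<exists>y\<in>carrier (subring_record T). y \<oplus>\<^bsub>subring_record T\<^esub> x = \<zero>\<^bsub>subring_record T\<^esub>"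
      by (intro bexI[of _ "- x"]) auto
  qed (auto simp: algebra_simps)
  show "Group.comm_monoid (subring_record T)"
    by (rule comm_monoidI) (auto simp: algebra_simps)
qed (auto simp: algebra_simps)

lemma finsum_eq:
  assumes "finite A" "\<And>i. i \<in> A \<Longrightarrow> f i \<in> T"
  shows "finsum (subring_record T) f A = sum f A"
proof -
  interpret cring "subring_record T" by (rule is_cring)
  show ?thesis using assms
    by (induction A rule: finite_induct) (auto simp: finsum_insert Pi_def)
qed

lemma ideal_iff:
  "ideal I (subring_record T) \<longleftrightarrow> I \<subseteq> T \<and> 0 \<in> I \<and> (\<forall>x\<in>I. \<forall>y\<in>I. x + y \<in> I) \<and>
     (\<forall>a\<in>T. \<forall>x\<in>I. a * x \<in> I)" (is "?L = ?R")
proof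
  interpret cring "subring_record T" by (rule is_cring)
  assume ?L
  then interpret ideal I "subring_record T" .
  show ?R using a_subset I_l_closed a_closed zero_closed by auto
next
  assume ?R
  then show ?L by (intro cring_idealI[OF is_cring]) simp_all
qed

lemma primeideal_iff:
  "primeideal P (subring_record T) \<longleftrightarrow> ideal P (subring_record T) \<and> 1 \<notin> P \<and>
     (\<forall>x\<in>T. \<forall>y\<in>T. x * y \<in> P \<longrightarrow> x \<in> P \<or> y \<in> P)" (is "?L = ?R")
proof
  assume ?L
  then interpret primeideal P "subring_record T" .
  have "1 \<notin> P" using one_imp_carrier I_notcarr by auto
  moreover have "\<forall>x\<in>T. \<forall>y\<in>T. x * y \<in> P \<longrightarrow> x \<in> P \<or> y \<in> P"
    using I_prime unfolding subring_record_simps by blast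
  ultimately show ?R using ideal_axioms by blast
next
  assume R: ?R
  show ?L
  proof (rule primeidealI[OF _ is_cring])
    show "ideal P (subring_record T)" using R by blast
    show "carrier (subring_record T) \<noteq> P" using R one_closed by auto
    show "a \<in> P \<or> b \<in> P" if "a \<in> carrier (subring_record T)" "b \<in> carrier (subring_record T)"
      "a \<otimes>\<^bsub>subring_record T\<^esub> b \<in> P" for a b
      using R that unfolding subring_record_simps by blast
  qed
qed

end

locale ideal_of = subring_of T for T :: "'b::comm_ring_1 set" +
  fixes I
  assumes is_ideal_of: "ideal I (subring_record T)"
begin

lemma ideal_subset: "x \<in> I \<Longrightarrow> x \<in> T"
  and ideal_zero [simp]: "0 \<in> I"
  and ideal_add: "x \<in> I \<Longrightarrow> y \<in> I \<Longrightarrow> x + y \<in> I"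
  and ideal_mult: "a \<in> T \<Longrightarrow> x \<in> I \<Longrightarrow> a * x \<in> I"
  using is_ideal_of unfolding ideal_iff by blast+

lemma ideal_mult_right: "a \<in> T \<Longrightarrow> x \<in> I \<Longrightarrow> x * a \<in> I"
  using ideal_mult by (simp add: mult.commute)

lemma ideal_uminus: "x \<in> I \<Longrightarrow> - x \<in> I"
  using ideal_mult[of "- 1" x] by simp

lemma ideal_diff: "x \<in> I \<Longrightarrow> y \<in> I \<Longrightarrow> x - y \<in> I"
  using ideal_add[of x "- y"] ideal_uminus[of y] by simp

lemma ideal_sum: "(\<And>i. i \<in> A \<Longrightarrow> f i \<in> I) \<Longrightarrow> sum f A \<in> I"
  by (induction A rule: infinite_finite_induct) (simp_all add: ideal_add)

end

lemma ideal_ofI: "subring_of T \<Longrightarrow> ideal I (subring_record T) \<Longrightarrow> ideal_of T I"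
  by (simp add: ideal_of_def ideal_of_axioms_def)

section \<open>Polynomials, evaluation and Taylor expansion\<close>

definition polys :: "nat \<Rightarrow> 'a::comm_ring_1 mpoly set" where
  "polys n = {p. \<forall>m\<in>Poly_Mapping.keys p. Poly_Mapping.keys m \<subseteq> {..<n}}"

definition mpoly_var :: "nat \<Rightarrow> 'a::comm_ring_1 mpoly" where
  "mpoly_var j = Poly_Mapping.single (Poly_Mapping.single j 1) 1"

lemma mpoly_ring_eq: "mpoly_ring n = subring_record (polys n)"
  by (simp add: mpoly_ring_def subring_record_def polys_def)

lemma coeff_ring_eq: "coeff_ring = subring_record UNIV"
  by (simp add: coeff_ring_def subring_record_def)

lemma subring_of_UNIV: "subring_of UNIV"
  by unfold_locales auto

lemma subring_of_polys: "subring_of (polys n :: 'a::comm_ring_1 mpoly set)"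
proof
  fix x y :: "'a mpoly" assume xy: "x \<in> polys n" "y \<in> polys n"
  show "x + y \<in> polys n" using xy Poly_Mapping.keys_add[of x y] unfolding polys_def by blast
  show "x * y \<in> polys n"
  proof -
    have "Poly_Mapping.keys m \<subseteq> {..<n}" if m: "m \<in> Poly_Mapping.keys (x * y)" for m
    proof -
      obtain a b where "m = a + b" "a \<in> Poly_Mapping.keys x" "b \<in> Poly_Mapping.keys y"
        using m Poly_Mapping.keys_mult[of x y] by blast
      then show ?thesis using xy Poly_Mapping.keys_add[of a b] unfolding polys_def by blast
    qed
    then show ?thesis unfolding polys_def by blast
  qed
qed (auto simp: polys_def)

lemma mpoly_const_in_polys [simp]: "mpoly_const c \<in> polys n"
  by (simp add: polys_def mpoly_const_def)

lemma mpoly_var_in_polys [simp]: "j < n \<Longrightarrow> mpoly_var j \<in> polys n"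
  by (simp add: polys_def mpoly_var_def)

lemma polys_mono: "m \<le> n \<Longrightarrow> polys m \<subseteq> polys n"
  unfolding polys_def by fastforce

lemma mpoly_const_hom:
  "mpoly_const 0 = 0" "mpoly_const 1 = 1" "mpoly_const (a + b) = mpoly_const a + mpoly_const b"
  "mpoly_const (a * b) = mpoly_const a * mpoly_const b"
  by (simp_all add: mpoly_const_def single_add mult_single)

lemma mpoly_eq_sum_single:
  "(\<Sum>m\<in>Poly_Mapping.keys p. Poly_Mapping.single m (Poly_Mapping.lookup p m)) = p"
  by (rule poly_mapping_eqI)
     (auto simp: lookup_sum lookup_single when_def in_keys_iff sum.delta)

lemma single_eq_monomial:
  assumes "Poly_Mapping.keys m \<subseteq> {..<n}"
  shows "Poly_Mapping.single m c = mpoly_const c * (\<Prod>j<n. mpoly_var j ^ Poly_Mapping.lookup m j)"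
proof -
  have pow: "mpoly_var j ^ k = (Poly_Mapping.single (Poly_Mapping.single j k) 1 :: 'a mpoly)" for j k
    by (induction k) (auto simp: mpoly_var_def mult_single single_add[symmetric])
  have "(\<Prod>j\<in>A. mpoly_var j ^ k j) = (Poly_Mapping.single (\<Sum>j\<in>A. Poly_Mapping.single j (k j)) 1 :: 'a mpoly)"
    if "finite A" for A and k :: "nat \<Rightarrow> nat"
    using that by (induction A) (auto simp: pow mult_single)
  moreover have "(\<Sum>j<n. Poly_Mapping.single j (Poly_Mapping.lookup m j)) = m"
    using assms
    by (intro poly_mapping_eqI) (auto simp: lookup_sum lookup_single when_def in_keys_iff sum.delta not_less subset_iff)
  ultimately show ?thesis by (simp add: mpoly_const_def mult_single)
qed

lemma mpoly_additive_induct [case_names zero add single]: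
  assumes "P 0" "\<And>p q. P p \<Longrightarrow> P q \<Longrightarrow> P (p + q)" "\<And>m c. P (Poly_Mapping.single m c)"
  shows "P (p :: 'a::comm_ring_1 mpoly)"
proof -
  have "P (\<Sum>m\<in>A. Poly_Mapping.single m (Poly_Mapping.lookup p m))" if "finite A" for A
    using that by (induction A) (simp_all add: assms)
  from this[of "Poly_Mapping.keys p"] show ?thesis by (simp add: mpoly_eq_sum_single)
qed

lemma polys_induct [consumes 1, case_names const var add mult]:
  assumes "p \<in> polys n"
    and const: "\<And>c. P (mpoly_const c)"
    and var: "\<And>j. j < n \<Longrightarrow> P (mpoly_var j)"
    and add: "\<And>p q. p \<in> polys n \<Longrightarrow> q \<in> polys n \<Longrightarrow> P p \<Longrightarrow> P q \<Longrightarrow> P (p + q)"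
    and mult: "\<And>p q. p \<in> polys n \<Longrightarrow> q \<in> polys n \<Longrightarrow> P p \<Longrightarrow> P q \<Longrightarrow> P (p * q)"
  shows "P p"
proof -
  interpret subring_of "polys n" by (rule subring_of_polys)
  have one: "P 1" using const[of 1] by (simp add: mpoly_const_hom)
  have pow: "P (mpoly_var j ^ k)" if "j < n" for j k
    by (induction k) (use that one in \<open>auto intro!: mult var\<close>)
  have pc: "(\<Prod>j\<in>A. mpoly_var j ^ k j) \<in> polys n" if "A \<subseteq> {..<n}" for A k
    using that by (intro prod_closed power_closed) auto
  have prod: "P (\<Prod>j\<in>A. mpoly_var j ^ k j)" if "finite A" "A \<subseteq> {..<n}" for A k
    using that by (induction A) (auto intro!: mult pow one pc)
  have single: "P (Poly_Mapping.single m c)" if "Poly_Mapping.keys m \<subseteq> {..<n}" for m c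
    unfolding single_eq_monomial[OF that] by (intro mult const prod) auto
  have "P (\<Sum>m\<in>A. Poly_Mapping.single m (Poly_Mapping.lookup p m))"
    if "finite A" "A \<subseteq> Poly_Mapping.keys p" for A
    using that
  proof (induction A)
    case empty
    show ?case using const[of 0] by (simp add: mpoly_const_hom)
  next
    case (insert m A)
    have k: "Poly_Mapping.keys m' \<subseteq> {..<n}" if "m' \<in> Poly_Mapping.keys p" for m'
      using that assms(1) unfolding polys_def by blast
    then have c: "Poly_Mapping.single m' c \<in> polys n" if "m' \<in> Poly_Mapping.keys p" for m' c
      using that by (simp add: polys_def)
    have "(\<Sum>m\<in>A. Poly_Mapping.single m (Poly_Mapping.lookup p m)) \<in> polys n"
      using insert.prems by (intro sum_closed c) auto
    then show ?case using insert k c by (auto intro!: add single)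
  qed
  from this[of "Poly_Mapping.keys p"] show ?thesis by (simp add: mpoly_eq_sum_single)
qed

text \<open>
  Evaluation and partial differentiation are both sums over the monomials of a polynomial of
  terms that are additive in the coefficient; additivity of both follows from here.
\<close>

lemma sum_keys_add:
  fixes g :: "'m \<Rightarrow> 'c::comm_monoid_add \<Rightarrow> 'd::comm_monoid_add"
  assumes "\<And>m. g m 0 = 0" "\<And>m a b. g m (a + b) = g m a + g m b"
  shows "(\<Sum>m\<in>Poly_Mapping.keys (p + q). g m (Poly_Mapping.lookup (p + q) m)) =
    (\<Sum>m\<in>Poly_Mapping.keys p. g m (Poly_Mapping.lookup p m)) +
    (\<Sum>m\<in>Poly_Mapping.keys q. g m (Poly_Mapping.lookup q m))"
proof -
  let ?K = "Poly_Mapping.keys p \<union> Poly_Mapping.keys q"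
  have ext: "(\<Sum>m\<in>Poly_Mapping.keys s. g m (Poly_Mapping.lookup s m)) =
    (\<Sum>m\<in>?K. g m (Poly_Mapping.lookup s m))" if "Poly_Mapping.keys s \<subseteq> ?K" for s
    using that assms(1) by (intro sum.mono_neutral_left) (auto simp: in_keys_iff)
  show ?thesis
    using Poly_Mapping.keys_add[of p q]
    by (subst (1 2 3) ext) (simp_all add: lookup_add assms(2) sum.distrib)
qed

definition eval_monomial :: "(nat \<Rightarrow> 'b::comm_ring_1) \<Rightarrow> (nat \<Rightarrow>\<^sub>0 nat) \<Rightarrow> 'b" where
  "eval_monomial u m = (\<Prod>j\<in>Poly_Mapping.keys m. u j ^ Poly_Mapping.lookup m j)"

lemma eval_monomial_add: "eval_monomial u (m + m') = eval_monomial u m * eval_monomial u m'"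
proof -
  let ?K = "Poly_Mapping.keys m \<union> Poly_Mapping.keys m'"
  have ext: "eval_monomial u s = (\<Prod>j\<in>?K. u j ^ Poly_Mapping.lookup s j)"
    if "Poly_Mapping.keys s \<subseteq> ?K" for s
    unfolding eval_monomial_def using that
    by (intro prod.mono_neutral_left) (auto simp: in_keys_iff)
  show ?thesis
    using Poly_Mapping.keys_add[of m m']
    by (simp add: ext lookup_add power_add prod.distrib)
qed

definition eval_mpoly :: "('a::comm_ring_1 \<Rightarrow> 'b::comm_ring_1) \<Rightarrow> (nat \<Rightarrow> 'b) \<Rightarrow> 'a mpoly \<Rightarrow> 'b" where
  "eval_mpoly h u p = (\<Sum>m\<in>Poly_Mapping.keys p. h (Poly_Mapping.lookup p m) * eval_monomial u m)"

locale coeff_hom =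
  fixes h :: "'a::comm_ring_1 \<Rightarrow> 'b::comm_ring_1"
  assumes hom_zero [simp]: "h 0 = 0"
    and hom_one [simp]: "h 1 = 1"
    and hom_add: "h (a + b) = h a + h b"
    and hom_mult: "h (a * b) = h a * h b"
begin

lemma eval_add: "eval_mpoly h u (p + q) = eval_mpoly h u p + eval_mpoly h u q"
  unfolding eval_mpoly_def by (rule sum_keys_add) (simp_all add: hom_add distrib_right)

lemma eval_zero [simp]: "eval_mpoly h u 0 = 0"
  by (simp add: eval_mpoly_def)

lemma eval_single: "eval_mpoly h u (Poly_Mapping.single m c) = h c * eval_monomial u m"
  by (cases "c = 0") (simp_all add: eval_mpoly_def)

lemma eval_const [simp]: "eval_mpoly h u (mpoly_const c) = h c"
  by (simp add: mpoly_const_def eval_single eval_monomial_def)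

lemma eval_var [simp]: "eval_mpoly h u (mpoly_var j) = u j"
  by (simp add: mpoly_var_def eval_single eval_monomial_def)

lemma eval_mult: "eval_mpoly h u (p * q) = eval_mpoly h u p * eval_mpoly h u q"
proof (induction p rule: mpoly_additive_induct)
  case (single m c)
  show ?case
    by (induction q rule: mpoly_additive_induct)
       (simp_all add: eval_add distrib_left distrib_right mult_single eval_single hom_mult
          eval_monomial_add mult_ac)
qed (simp_all add: eval_add distrib_right)

lemma eval_one [simp]: "eval_mpoly h u 1 = 1"
  using eval_const[of u 1] by (simp add: mpoly_const_hom)

lemma eval_uminus: "eval_mpoly h u (- p) = - eval_mpoly h u p"
  using eval_add[of u p "- p"] by (simp add: eq_neg_iff_add_eq_0 add.commute)

lemma eval_diff: "eval_mpoly h u (p - q) = eval_mpoly h u p - eval_mpoly h u q"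
  using eval_add[of u p "- q"] by (simp add: eval_uminus)

lemma eval_sum: "eval_mpoly h u (sum f A) = (\<Sum>i\<in>A. eval_mpoly h u (f i))"
  by (induction A rule: infinite_finite_induct) (simp_all add: eval_add)

lemma eval_closed:
  assumes "subring_of U" "p \<in> polys n" "\<And>c. h c \<in> U" "\<And>j. j < n \<Longrightarrow> u j \<in> U"
  shows "eval_mpoly h u p \<in> U"
proof -
  interpret U: subring_of U by fact
  show ?thesis using assms(2)
    by (induction p rule: polys_induct) (simp_all add: assms eval_add eval_mult)
qed

end

lemma partial_deriv_add: "partial_deriv j (p + q) = partial_deriv j p + partial_deriv j q"
  unfolding partial_deriv_def by (rule sum_keys_add) (simp_all add: single_add distrib_left)

lemma partial_deriv_zero [simp]: "partial_deriv j 0 = 0"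
  by (simp add: partial_deriv_def)

lemma partial_deriv_single:
  "partial_deriv j (Poly_Mapping.single m c) =
     Poly_Mapping.single (m - Poly_Mapping.single j 1) (of_nat (Poly_Mapping.lookup m j) * c)"
  by (cases "c = 0") (simp_all add: partial_deriv_def)

lemma partial_deriv_mult:
  "partial_deriv j (p * q) = p * partial_deriv j q + q * partial_deriv j p"
proof (induction p rule: mpoly_additive_induct)
  case (single m c)
  show ?case
  proof (induction q rule: mpoly_additive_induct)
    case (single m' c')
    let ?e = "Poly_Mapping.single j (1::nat)"
    have shift: "of_nat (Poly_Mapping.lookup m j) * c = 0 \<or> m' + (m - ?e) = m + m' - ?e"
      for m m' :: "nat \<Rightarrow>\<^sub>0 nat" and c :: 'a
    proof (cases "Poly_Mapping.lookup m j = 0")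
      case False
      then have "m' + (m - ?e) = m + m' - ?e"
        by (intro poly_mapping_eqI) (auto simp: lookup_add lookup_minus lookup_single when_def)
      then show ?thesis ..
    qed simp
    have 1: "Poly_Mapping.single m' c' * Poly_Mapping.single (m - ?e) (of_nat (Poly_Mapping.lookup m j) * c)
      = Poly_Mapping.single (m + m' - ?e) (of_nat (Poly_Mapping.lookup m j) * c * c')"
      for m m' :: "nat \<Rightarrow>\<^sub>0 nat" and c c' :: 'a
      using shift[of m c m'] by (auto simp: mult_single mult_ac)
    show ?case
      unfolding mult_single partial_deriv_single 1 1[of m c m' c', unfolded add.commute[of m m']]
      using 1[of m' c' m c] 1[of m c m' c']
      by (simp add: mult_single partial_deriv_single lookup_add single_add[symmetric] algebra_simps)
  qed (simp_all add: partial_deriv_add algebra_simps)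
qed (simp_all add: partial_deriv_add algebra_simps)

lemma partial_deriv_const [simp]: "partial_deriv j (mpoly_const c) = 0"
  by (simp add: mpoly_const_def partial_deriv_single)

lemma partial_deriv_var [simp]: "partial_deriv j (mpoly_var i) = (if i = j then 1 else 0)"
  by (simp add: mpoly_var_def partial_deriv_single lookup_single when_def)

lemma partial_deriv_closed: "p \<in> polys n \<Longrightarrow> partial_deriv j p \<in> polys n"
proof -
  interpret subring_of "polys n" by (rule subring_of_polys)
  show "p \<in> polys n \<Longrightarrow> partial_deriv j p \<in> polys n"
    by (induction p rule: polys_induct) (simp_all add: partial_deriv_add partial_deriv_mult)
qed

lemma partial_deriv_sum: "partial_deriv j (sum f A) = (\<Sum>i\<in>A. partial_deriv j (f i))"
  by (induction A rule: infinite_finite_induct) (simp_all add: partial_deriv_add)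

text \<open>
  The remainder need not be explicit: the polynomials for which there is some remainder in \<open>U\<close>
  contain the constants and the variables, and are closed under sums and products. Divisibility
  of the remainder by \<open>e\<^sup>2\<close>, even if \<open>e\<close> is a zero divisor, makes the obstructions in the
  lifting argument below solvable.
\<close>

lemma (in coeff_hom) eval_taylor:
  assumes "subring_of U" "p \<in> polys n" "\<And>c. h c \<in> U"
    and u: "\<And>j. j < n \<Longrightarrow> u j \<in> U" and v: "\<And>j. j < n \<Longrightarrow> v j \<in> U" and e: "e \<in> U"
  shows "\<exists>q\<in>U. eval_mpoly h (\<lambda>j. u j + e * v j) p =
    eval_mpoly h u p + e * (\<Sum>j<n. eval_mpoly h u (partial_deriv j p) * v j) + e\<^sup>2 * q"
proof -
  interpret U: subring_of U by fact
  have ev: "eval_mpoly h u p \<in> U" if "p \<in> polys n" for p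
    using eval_closed[OF assms(1) that assms(3), of u] u by blast
  have lin: "(\<Sum>j<n. eval_mpoly h u (partial_deriv j p) * v j) \<in> U" if "p \<in> polys n" for p
    using ev partial_deriv_closed[OF that] v by auto
  show ?thesis using assms(2)
  proof (induction p rule: polys_induct)
    case (const c)
    show ?case by (intro bexI[of _ 0]) simp_all
  next
    case (var i)
    have "(\<Sum>j<n. eval_mpoly h u (partial_deriv j (mpoly_var i)) * v j) = (\<Sum>j<n. if j = i then v j else 0)"
      by (intro sum.cong) auto
    also have "\<dots> = v i" using var by simp
    finally show ?case by (intro bexI[of _ 0]) simp_all
  next
    case (add p q)
    then obtain a b where "a \<in> U" "b \<in> U"
      "eval_mpoly h (\<lambda>j. u j + e * v j) p =
        eval_mpoly h u p + e * (\<Sum>j<n. eval_mpoly h u (partial_deriv j p) * v j) + e\<^sup>2 * a"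
      "eval_mpoly h (\<lambda>j. u j + e * v j) q =
        eval_mpoly h u q + e * (\<Sum>j<n. eval_mpoly h u (partial_deriv j q) * v j) + e\<^sup>2 * b"
      by blast
    then show ?case
      by (intro bexI[of _ "a + b"])
         (simp_all add: eval_add partial_deriv_add distrib_left distrib_right sum.distrib add_ac)
  next
    case (mult p q)
    let ?P = "eval_mpoly h u p" and ?Q = "eval_mpoly h u q"
      and ?DP = "\<Sum>j<n. eval_mpoly h u (partial_deriv j p) * v j"
      and ?DQ = "\<Sum>j<n. eval_mpoly h u (partial_deriv j q) * v j"
    obtain a b where ab: "a \<in> U" "b \<in> U"
      "eval_mpoly h (\<lambda>j. u j + e * v j) p = ?P + e * ?DP + e\<^sup>2 * a"
      "eval_mpoly h (\<lambda>j. u j + e * v j) q = ?Q + e * ?DQ + e\<^sup>2 * b"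
      using mult.IH by blast
    have D: "(\<Sum>j<n. eval_mpoly h u (partial_deriv j (p * q)) * v j) = ?P * ?DQ + ?Q * ?DP"
      by (simp add: partial_deriv_mult eval_add eval_mult distrib_right sum.distrib sum_distrib_left mult.assoc)
    let ?q = "?P * b + ?DP * ?DQ + e * (?DP * b) + a * ?Q + e * (a * ?DQ) + e\<^sup>2 * (a * b)"
    have "?q \<in> U" using ab ev lin mult.hyps e by auto
    moreover have "eval_mpoly h (\<lambda>j. u j + e * v j) (p * q) = ?P * ?Q + e * (?P * ?DQ + ?Q * ?DP) + e\<^sup>2 * ?q"
      unfolding eval_mult ab(3,4)
      by (simp only: power2_eq_square distrib_left distrib_right mult_ac add_ac)
    ultimately show ?case unfolding D eval_mult[of u] by blast
  qed
qed

section \<open>Primes that are locally generated by few elements\<close>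

locale prime_of = subring_of T for T :: "'b::comm_ring_1 set" +
  fixes P
  assumes prime: "primeideal P (subring_record T)"
begin

sublocale ideal_of T P
  using prime[unfolded primeideal_iff] by (simp add: ideal_of_def ideal_of_axioms_def subring_of_axioms)

lemma one_notin: "1 \<notin> P"
  using prime primeideal_iff by blast

lemma prime_mult: "x \<in> T \<Longrightarrow> y \<in> T \<Longrightarrow> x * y \<in> P \<Longrightarrow> x \<in> P \<or> y \<in> P"
  using prime primeideal_iff by blast

lemma compl_mult: "x \<in> T - P \<Longrightarrow> y \<in> T - P \<Longrightarrow> x * y \<in> T - P"
  using prime_mult by blast

lemma compl_one: "1 \<in> T - P"
  using one_notin by simp

lemma compl_power: "x \<in> T - P \<Longrightarrow> x ^ k \<in> T - P"
  by (induction k) (use compl_mult compl_one in auto)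

lemma compl_prod: "(\<And>i. i \<in> A \<Longrightarrow> f i \<in> T - P) \<Longrightarrow> prod f A \<in> T - P"
  by (induction A rule: infinite_finite_induct) (use compl_mult compl_one in auto)

end

text \<open>
  The elements of \<open>T\<close> whose image in the localization of \<open>T\<close> at \<open>P\<close> lies in the ideal generated
  by \<open>g 0, \<dots>, g (h - 1)\<close>. With this set, local statements about \<open>P\<close> are formulated without
  fractions.
\<close>

definition saturation :: "'b::comm_ring_1 set \<Rightarrow> 'b set \<Rightarrow> (nat \<Rightarrow> 'b) \<Rightarrow> nat \<Rightarrow> 'b set" where
  "saturation T P g h =
     {x \<in> T. \<exists>s\<in>T - P. \<exists>c. (\<forall>i<h. c i \<in> T) \<and> s * x = (\<Sum>i<h. c i * g i)}"

context prime_of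
begin

lemma saturationI:
  "x \<in> T \<Longrightarrow> s \<in> T - P \<Longrightarrow> (\<And>i. i < h \<Longrightarrow> c i \<in> T) \<Longrightarrow> s * x = (\<Sum>i<h. c i * g i) \<Longrightarrow>
    x \<in> saturation T P g h"
  unfolding saturation_def by blast

lemma ideal_saturation: "ideal (saturation T P g h) (subring_record T)"
  unfolding ideal_iff
proof (intro conjI ballI)
  show "saturation T P g h \<subseteq> T" unfolding saturation_def by blast
  show "0 \<in> saturation T P g h"
    using compl_one by (intro saturationI[of _ 1 _ "\<lambda>_. 0"]) auto
  fix x y assume "x \<in> saturation T P g h" "y \<in> saturation T P g h"
  then obtain s t c d where *: "x \<in> T" "y \<in> T" "s \<in> T - P" "t \<in> T - P"
    "\<And>i. i < h \<Longrightarrow> c i \<in> T" "\<And>i. i < h \<Longrightarrow> d i \<in> T"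
    "s * x = (\<Sum>i<h. c i * g i)" "t * y = (\<Sum>i<h. d i * g i)"
    unfolding saturation_def by blast
  have "(s * t) * (x + y) = t * (s * x) + s * (t * y)" by (simp add: algebra_simps)
  also have "\<dots> = (\<Sum>i<h. (t * c i + s * d i) * g i)"
    unfolding * by (simp add: sum_distrib_left sum.distrib algebra_simps)
  finally show "x + y \<in> saturation T P g h"
    using * compl_mult by (intro saturationI[of _ "s * t" _ "\<lambda>i. t * c i + s * d i"]) auto
next
  fix a x assume a: "a \<in> T" and "x \<in> saturation T P g h"
  then obtain s c where *: "x \<in> T" "s \<in> T - P"
    "\<And>i. i < h \<Longrightarrow> c i \<in> T" "s * x = (\<Sum>i<h. c i * g i)"
    unfolding saturation_def by blast
  have "s * (a * x) = a * (s * x)" by (simp add: algebra_simps)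
  also have "\<dots> = (\<Sum>i<h. (a * c i) * g i)"
    unfolding * by (simp add: sum_distrib_left algebra_simps)
  finally show "a * x \<in> saturation T P g h"
    using * a by (intro saturationI[of _ s _ "\<lambda>i. a * c i"]) auto
qed

lemma saturation_cancel:
  assumes "s \<in> T - P" "x \<in> T" "s * x \<in> saturation T P g h"
  shows "x \<in> saturation T P g h"
proof -
  obtain t c where *: "t \<in> T - P" "\<And>i. i < h \<Longrightarrow> c i \<in> T" "t * (s * x) = (\<Sum>i<h. c i * g i)"
    using assms(3) unfolding saturation_def by blast
  then show ?thesis
    using assms compl_mult by (intro saturationI[of _ "t * s" _ c]) (auto simp: mult.assoc)
qed

lemma saturation_generator:
  assumes "j < h" "g j \<in> T"
  shows "g j \<in> saturation T P g h"
proof -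
  have "1 * g j = (\<Sum>i<h. (if i = j then 1 else 0) * g i)"
    using assms(1) by (simp add: if_distrib[of "\<lambda>c. c * _"] sum.delta cong: if_cong)
  then show ?thesis
    using assms(2) compl_one by (intro saturationI[of _ 1 _ "\<lambda>i. if i = j then 1 else 0"]) auto
qed

end

lemma saturation_mono:
  assumes "T \<subseteq> T'" "T - P \<subseteq> T' - P'" "h \<le> h'" "\<And>i. i < h \<Longrightarrow> g' i = g i" "0 \<in> T'"
  shows "saturation T P g h \<subseteq> saturation T' P' g' h'"
proof
  fix x assume "x \<in> saturation T P g h"
  then obtain s c where *: "x \<in> T" "s \<in> T - P"
    "\<And>i. i < h \<Longrightarrow> c i \<in> T" "s * x = (\<Sum>i<h. c i * g i)"
    unfolding saturation_def by blast
  let ?c = "\<lambda>i. if i < h then c i else 0"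
  have "(\<Sum>i<h. c i * g i) = (\<Sum>i<h'. ?c i * g' i)"
    using assms(3,4) by (intro sum.mono_neutral_cong_left) auto
  then show "x \<in> saturation T' P' g' h'"
    unfolding saturation_def using * assms(1,2,5)
    by (intro CollectI conjI bexI[of _ s] exI[of _ ?c]) auto
qed

text \<open>
  If \<open>P\<close> has height \<open>h\<close>, this says that the maximal ideal of the localization at \<open>P\<close> needs only
  as many generators as the height. Only a chain of length \<open>h\<close> is asked for, that is, the lower
  bound \<open>h\<close> for the height; such chains are easy to lengthen when a variable is adjoined.
\<close>

definition generated_by_height :: "'b::comm_ring_1 set \<Rightarrow> 'b set \<Rightarrow> nat \<Rightarrow> bool" where
  "generated_by_height T P h \<longleftrightarrow> (\<exists>C g. prime_chain (subring_record T) C h \<and> C h = P \<and>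
     (\<forall>i<h. g i \<in> P) \<and> P \<subseteq> saturation T P g h)"

section \<open>Localization of a regular ring\<close>

text \<open>
  A chain of length \<open>krull_dim\<close> can thus be extracted from the supremum in its definition. The
  supremum of the empty set is also \<open>0\<close>, hence the condition on \<open>h\<close>.
\<close>

lemma enat_Sup_attained:
  assumes "enat h = Sup {enat l |l. Q l}" "h > 0"
  shows "Q h"
proof (rule ccontr)
  assume "\<not> Q h"
  have "x \<le> enat (h - 1)" if "x \<in> {enat l |l. Q l}" for x
  proof -
    from that obtain l where l: "x = enat l" "Q l" by blast
    have "enat l \<le> enat h" unfolding assms(1) using l by (intro Sup_upper) blast
    then have "l < h" using \<open>\<not> Q h\<close> l(2) by (cases "l = h") auto
    then show ?thesis using l(1) by simp
  qed
  then have "enat h \<le> enat (h - 1)" unfolding assms(1) by (intro Sup_least) blast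
  then show False using assms(2) by simp
qed

context
  fixes P :: "'a::comm_ring_1 set"
  assumes P: "primeideal P coeff_ring"
begin

interpretation prime_of UNIV P
  using P subring_of_UNIV
  by (simp add: prime_of_def prime_of_axioms_def coeff_ring_eq)

definition loc_frac :: "'a \<Rightarrow> 'a \<Rightarrow> ('a \<times> 'a) set" where
  "loc_frac = fraction coeff_ring (carrier coeff_ring - P)"

definition loc :: "('a \<times> 'a) set ring" where
  "loc = localization coeff_ring (carrier coeff_ring - P)"

lemma loc_frac_eq: "loc_frac a s = {(b, t). t \<notin> P \<and> (\<exists>u. u \<notin> P \<and> u * (a * t) = u * (b * s))}"
  by (auto simp: loc_frac_def fraction_def coeff_ring_eq)

lemma notin_mult: "x \<notin> P \<Longrightarrow> y \<notin> P \<Longrightarrow> x * y \<notin> P"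
  using prime_mult by blast

lemma loc_frac_eqI:
  assumes "s \<notin> P" "t \<notin> P" "u \<notin> P" "u * (a * t) = u * (b * s)"
  shows "loc_frac a s = loc_frac b t"
proof -
  have "loc_frac a s \<subseteq> loc_frac b t" if "s \<notin> P" "t \<notin> P" "u \<notin> P" "u * (a * t) = u * (b * s)" for a s b t u
  proof (clarsimp simp: loc_frac_eq)
    fix c w v assume *: "w \<notin> P" "v \<notin> P" "v * (a * w) = v * (c * s)"
    have "(u * v * s) * (b * w) = (u * (b * s)) * (v * w)" by (simp add: mult_ac)
    also have "\<dots> = (u * t) * (v * (a * w))" unfolding that(4)[symmetric] by (simp add: mult_ac)
    also have "\<dots> = (u * v * s) * (c * t)" unfolding *(3) by (simp add: mult_ac)
    finally show "\<exists>u. u \<notin> P \<and> u * (b * w) = u * (c * t)"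
      using that(1,3) *(2) by (intro exI[of _ "u * v * s"]) (simp add: notin_mult)
  qed
  from this[OF assms] this[OF assms(2,1,3) assms(4)[symmetric]] show ?thesis by blast
qed

lemma loc_frac_memD:
  assumes "s \<notin> P" "(b, t) \<in> loc_frac a s"
  shows "t \<notin> P \<and> (\<exists>u. u \<notin> P \<and> u * (a * t) = u * (b * s))"
  using assms by (simp add: loc_frac_eq)

lemma mem_loc_frac: "s \<notin> P \<Longrightarrow> (a, s) \<in> loc_frac a s"
  unfolding loc_frac_eq using one_notin by blast

lemma loc_frac_eqD:
  assumes "s \<notin> P" "t \<notin> P" "loc_frac a s = loc_frac b t"
  shows "\<exists>u. u \<notin> P \<and> u * (a * t) = u * (b * s)"
  using loc_frac_memD[OF assms(1), of b t a] mem_loc_frac[OF assms(2), of b] assms(3) by simp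

lemma loc_carrier: "carrier loc = {loc_frac a s |a s. s \<notin> P}"
  by (auto simp: loc_def loc_frac_def localization_def coeff_ring_eq)

text \<open>
  The operations of the localization are unions over all representatives of the operands; they
  all contribute the same fraction.
\<close>

lemma loc_mult:
  assumes "s \<notin> P" "t \<notin> P"
  shows "loc_frac a s \<otimes>\<^bsub>loc\<^esub> loc_frac b t = loc_frac (a * b) (s * t)"
proof -
  have "loc_frac (fst x * fst y) (snd x * snd y) = loc_frac (a * b) (s * t)"
    if xs: "x \<in> loc_frac a s" and yt: "y \<in> loc_frac b t" for x y
  proof -
    obtain a' s' b' t' where xy: "x = (a', s')" "y = (b', t')" by (cases x, cases y)
    obtain u v where *: "s' \<notin> P" "t' \<notin> P" "u \<notin> P" "v \<notin> P"
      "u * (a * s') = u * (a' * s)" "v * (b * t') = v * (b' * t)"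
      using loc_frac_memD[OF assms(1) xs[unfolded xy]] loc_frac_memD[OF assms(2) yt[unfolded xy]] by blast
    have "(u * v) * ((a' * b') * (s * t)) = (u * (a' * s)) * (v * (b' * t))" by (simp add: mult_ac)
    also have "\<dots> = (u * (a * s')) * (v * (b * t'))" by (simp only: *(5,6))
    also have "\<dots> = (u * v) * ((a * b) * (s' * t'))" by (simp add: mult_ac)
    finally show ?thesis
      unfolding xy fst_conv snd_conv
      using * assms by (intro loc_frac_eqI[of _ _ "u * v"]) (simp_all add: notin_mult)
  qed
  then have "(\<Union>x\<in>loc_frac a s. \<Union>y\<in>loc_frac b t. loc_frac (fst x * fst y) (snd x * snd y)) = loc_frac (a * b) (s * t)"
    using mem_loc_frac[OF assms(1), of a] mem_loc_frac[OF assms(2), of b] by blast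
  then show ?thesis
    by (simp add: loc_def loc_frac_def localization_def coeff_ring_eq)
qed

lemma loc_add:
  assumes "s \<notin> P" "t \<notin> P"
  shows "loc_frac a s \<oplus>\<^bsub>loc\<^esub> loc_frac b t = loc_frac (a * t + b * s) (s * t)"
proof -
  have "loc_frac (fst x * snd y + fst y * snd x) (snd x * snd y) = loc_frac (a * t + b * s) (s * t)"
    if xs: "x \<in> loc_frac a s" and yt: "y \<in> loc_frac b t" for x y
  proof -
    obtain a' s' b' t' where xy: "x = (a', s')" "y = (b', t')" by (cases x, cases y)
    obtain u v where *: "s' \<notin> P" "t' \<notin> P" "u \<notin> P" "v \<notin> P"
      "u * (a * s') = u * (a' * s)" "v * (b * t') = v * (b' * t)"
      using loc_frac_memD[OF assms(1) xs[unfolded xy]] loc_frac_memD[OF assms(2) yt[unfolded xy]] by blast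
    have "(u * v) * ((a' * t' + b' * s') * (s * t)) =
      (u * (a' * s)) * (v * t * t') + (v * (b' * t)) * (u * s * s')" by (simp add: algebra_simps)
    also have "\<dots> = (u * (a * s')) * (v * t * t') + (v * (b * t')) * (u * s * s')"
      by (simp only: *(5,6))
    also have "\<dots> = (u * v) * ((a * t + b * s) * (s' * t'))" by (simp add: algebra_simps)
    finally show ?thesis
      unfolding xy fst_conv snd_conv
      using * assms by (intro loc_frac_eqI[of _ _ "u * v"]) (simp_all add: notin_mult)
  qed
  then have "(\<Union>x\<in>loc_frac a s. \<Union>y\<in>loc_frac b t. loc_frac (fst x * snd y + fst y * snd x) (snd x * snd y)) = loc_frac (a * t + b * s) (s * t)"
    using mem_loc_frac[OF assms(1), of a] mem_loc_frac[OF assms(2), of b] by blast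
  then show ?thesis
    by (simp add: loc_def loc_frac_def localization_def coeff_ring_eq)
qed

lemma loc_one: "\<one>\<^bsub>loc\<^esub> = loc_frac 1 1" and loc_zero: "\<zero>\<^bsub>loc\<^esub> = loc_frac 0 1"
  by (simp_all add: loc_def loc_frac_def localization_def coeff_ring_eq)

lemma loc_frac_unit: "a \<notin> P \<Longrightarrow> loc_frac a a = \<one>\<^bsub>loc\<^esub>"
  unfolding loc_one using one_notin by (intro loc_frac_eqI[of _ _ 1]) simp_all

lemma loc_frac_in_max_iff:
  assumes "s \<notin> P"
  shows "loc_frac a s \<in> {loc_frac a s |a s. a \<in> P \<and> s \<notin> P} \<longleftrightarrow> a \<in> P"
proof
  assume "loc_frac a s \<in> {loc_frac a s |a s. a \<in> P \<and> s \<notin> P}"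
  then obtain b t where b: "loc_frac a s = loc_frac b t" "b \<in> P" "t \<notin> P" by blast
  then obtain u where u: "u \<notin> P" "u * (a * t) = u * (b * s)" using loc_frac_eqD assms by blast
  have "u * (a * t) \<in> P" unfolding u(2) using b(2) ideal_mult ideal_mult_right by simp
  then show "a \<in> P" using u(1) b(3) notin_mult by blast
qed (use assms in blast)

text \<open>
  A fraction outside this set has its numerator outside \<open>P\<close>, so it is a unit.
\<close>

lemma maximal_loc:
  assumes "cring loc"
  shows "maximalideal {loc_frac a s |a s. a \<in> P \<and> s \<notin> P} loc" (is "maximalideal ?M loc")
proof -
  interpret L: cring loc by fact
  have ideal: "ideal ?M loc"
  proof (rule cring_idealI[OF assms])
    show "?M \<subseteq> carrier loc" unfolding loc_carrier by blast
    show "\<zero>\<^bsub>loc\<^esub> \<in> ?M" unfolding loc_zero using one_notin ideal_zero by blast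
  next
    fix x y assume "x \<in> ?M" "y \<in> ?M"
    then obtain a s b t where xy: "x = loc_frac a s" "y = loc_frac b t" "a \<in> P" "b \<in> P" "s \<notin> P" "t \<notin> P" by blast
    have "a * t + b * s \<in> P" using xy by (intro ideal_add ideal_mult_right) auto
    then show "x \<oplus>\<^bsub>loc\<^esub> y \<in> ?M" using xy notin_mult by (auto simp: loc_add)
  next
    fix x y assume "x \<in> carrier loc" "y \<in> ?M"
    then obtain a s b t where xy: "x = loc_frac a s" "y = loc_frac b t" "b \<in> P" "s \<notin> P" "t \<notin> P"
      unfolding loc_carrier by blast
    have "a * b \<in> P" using xy by (intro ideal_mult) auto
    then show "x \<otimes>\<^bsub>loc\<^esub> y \<in> ?M" using xy notin_mult by (auto simp: loc_mult)
  qed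
  show ?thesis
  proof (rule maximalidealI[OF ideal])
    show "carrier loc \<noteq> ?M"
      using loc_frac_in_max_iff[of 1 1] one_notin unfolding loc_carrier by blast
    fix J assume J: "ideal J loc" "?M \<subseteq> J" "J \<subseteq> carrier loc"
    show "J = ?M \<or> J = carrier loc"
    proof (rule disjCI)
      assume "J \<noteq> carrier loc"
      show "J = ?M"
      proof (rule ccontr)
        assume "J \<noteq> ?M"
        then obtain x where x: "x \<in> J" "x \<notin> ?M" using J(2) by blast
        then obtain a s where as: "x = loc_frac a s" "s \<notin> P" using J(3) unfolding loc_carrier by blast
        then have a: "a \<notin> P" using x(2) by blast
        have "loc_frac s a \<otimes>\<^bsub>loc\<^esub> x \<in> J"
          using ideal.I_l_closed[OF J(1) x(1)] a unfolding loc_carrier by blast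
        moreover have "loc_frac s a \<otimes>\<^bsub>loc\<^esub> x = \<one>\<^bsub>loc\<^esub>"
          unfolding as(1) using a as(2)
          by (simp add: loc_mult notin_mult mult.commute[of a] loc_frac_unit)
        ultimately show False using ideal.one_imp_carrier[OF J(1)] \<open>J \<noteq> carrier loc\<close> by simp
      qed
    qed
  qed
qed

lemma hom_loc:
  assumes "cring loc"
  shows "ring_hom_ring coeff_ring loc (\<lambda>a. loc_frac a 1)"
proof (rule ring_hom_ringI2)
  show "ring (coeff_ring :: 'a ring)" using is_cring by (simp add: coeff_ring_eq cring.axioms(1))
  show "ring loc" using assms by (simp add: cring.axioms(1))
  show "(\<lambda>a. loc_frac a 1) \<in> ring_hom coeff_ring loc"
    using one_notin
    by (intro ring_hom_memI) (simp_all add: loc_carrier loc_mult loc_add loc_one coeff_ring_eq, blast)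
qed

text \<open>
  The primes of the localization contract to a strictly increasing chain of primes inside \<open>P\<close>:
  if \<open>a / s\<close> lies in one prime of the chain and not in the preceding one, so does \<open>a / 1\<close>.
  Replacing the last contraction by \<open>P\<close> itself makes the chain end in \<open>P\<close>.
\<close>

lemma chain_of_loc:
  assumes "cring loc" "prime_chain loc C h" "h > 0"
  shows "\<exists>C'. prime_chain (subring_record UNIV) C' h \<and> C' h = P"
proof -
  interpret L: cring loc by fact
  define c where "c i = {r \<in> carrier coeff_ring. loc_frac r 1 \<in> C i}" for i
  define C' where "C' i = (if i < h then c i else P)" for i
  have Cp: "primeideal (C i) loc" if "i \<le> h" for i
    using assms(2) that by (simp add: prime_chain_def)
  have cp: "primeideal (c i) coeff_ring" if "i \<le> h" for i
    unfolding c_def using is_cring Cp[OF that]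
    by (intro ring_hom_ring.primeideal_vimage[OF hom_loc[OF assms(1)]]) (simp_all add: coeff_ring_eq)
  have strict: "c i \<subset> c (Suc i)" if "i < h" for i
  proof -
    have sub: "C i \<subset> C (Suc i)" using assms(2) that by (simp add: prime_chain_def)
    interpret Ci: ideal "C i" loc using Cp[of i] that by (simp add: primeideal_def)
    interpret Cs: ideal "C (Suc i)" loc using Cp[of "Suc i"] that by (simp add: primeideal_def)
    obtain x where x: "x \<in> C (Suc i)" "x \<notin> C i" using sub by blast
    then have "x \<in> carrier loc" using Cs.Icarr by blast
    then obtain a s where as: "x = loc_frac a s" "s \<notin> P" unfolding loc_carrier by blast
    have "loc_frac s 1 \<otimes>\<^bsub>loc\<^esub> x \<in> C (Suc i)"
      using one_notin x(1) by (intro Cs.I_l_closed) (auto simp: loc_carrier)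
    moreover have "loc_frac s 1 \<otimes>\<^bsub>loc\<^esub> x = loc_frac a 1"
      unfolding as(1) loc_mult[OF one_notin as(2)] using as(2) one_notin
      by (intro loc_frac_eqI[of _ _ 1]) (simp_all add: mult_ac)
    ultimately have 1: "loc_frac a 1 \<in> C (Suc i)" by simp
    have 2: "loc_frac a 1 \<notin> C i"
    proof
      assume "loc_frac a 1 \<in> C i"
      then have "loc_frac 1 s \<otimes>\<^bsub>loc\<^esub> loc_frac a 1 \<in> C i"
        using as(2) by (intro Ci.I_l_closed) (auto simp: loc_carrier)
      moreover have "loc_frac 1 s \<otimes>\<^bsub>loc\<^esub> loc_frac a 1 = x"
        unfolding as(1) using as(2) one_notin by (simp add: loc_mult)
      ultimately show False using x(2) by simp
    qed
    from 1 2 have "a \<in> c (Suc i)" "a \<notin> c i" by (simp_all add: c_def coeff_ring_eq)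
    moreover have "c i \<subseteq> c (Suc i)" using sub unfolding c_def by blast
    ultimately show ?thesis by blast
  qed
  have le: "c i \<subseteq> P" if "i \<le> h" for i
  proof
    fix a assume a: "a \<in> c i"
    interpret Ci: primeideal "C i" loc using Cp[OF that] .
    show "a \<in> P"
    proof (rule ccontr)
      assume "a \<notin> P"
      then have "loc_frac 1 a \<otimes>\<^bsub>loc\<^esub> loc_frac a 1 \<in> C i"
        using a by (intro Ci.I_l_closed) (auto simp: loc_carrier c_def)
      moreover have "loc_frac 1 a \<otimes>\<^bsub>loc\<^esub> loc_frac a 1 = \<one>\<^bsub>loc\<^esub>"
        using \<open>a \<notin> P\<close> one_notin by (simp add: loc_mult loc_frac_unit)
      ultimately show False using Ci.one_imp_carrier Ci.I_notcarr by auto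
    qed
  qed
  have "C' i \<subset> C' (Suc i)" if "i < h" for i
  proof (cases "Suc i < h")
    case True
    then show ?thesis using strict[OF that] that by (simp add: C'_def)
  next
    case False
    then have "Suc i = h" using that by simp
    then show ?thesis using strict[OF that] le[of "Suc i"] that by (auto simp: C'_def)
  qed
  moreover have "primeideal (C' i) (subring_record UNIV)" if "i \<le> h" for i
    using cp that P by (simp add: C'_def coeff_ring_eq)
  ultimately show ?thesis by (intro exI[of _ C']) (simp add: prime_chain_def C'_def)
qed

text \<open>
  Regularity provides fractions \<open>a\<^sub>i / s\<^sub>i\<close> that generate the maximal ideal, as many as the
  dimension of the localization; their numerators are the required generators. To pass from the
  ideal generated by the fractions to the numerators, note that the fractions with numerator in
  the saturation form an ideal that contains the generators.
\<close>

lemma regular_generated_by_height: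
  assumes "regular_ring (coeff_ring :: 'a ring)"
  shows "\<exists>h. generated_by_height UNIV P h"
proof -
  let ?M = "{loc_frac a s |a s. a \<in> P \<and> s \<notin> P}"
  have reg: "regular_local_ring loc" using assms P unfolding regular_ring_def loc_def by blast
  then have L: "cring loc" unfolding regular_local_ring_def by blast
  then interpret L: cring loc .
  obtain G where G: "G \<subseteq> carrier loc" "finite G" "enat (card G) = krull_dim loc" "?M = Idl\<^bsub>loc\<^esub> G"
    using reg[unfolded regular_local_ring_def, THEN conjunct2, THEN conjunct2, THEN conjunct2,
        rule_format, OF maximal_loc[OF L]] by blast
  define h where "h = card G"
  obtain e where e: "bij_betw e {0..<h} G" using ex_bij_betw_nat_finite[OF G(2)] h_def by blast
  have "G \<subseteq> ?M" unfolding G(4) by (rule L.genideal_self[OF G(1)])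
  moreover have eG: "e i \<in> G" if "i < h" for i using e that by (auto simp: bij_betw_def)
  ultimately have "\<forall>i<h. \<exists>a s. e i = loc_frac a s \<and> a \<in> P \<and> s \<notin> P" by blast
  then obtain a s where as: "\<And>i. i < h \<Longrightarrow> e i = loc_frac (a i) (s i)"
    "\<And>i. i < h \<Longrightarrow> a i \<in> P" "\<And>i. i < h \<Longrightarrow> s i \<notin> P" by metis
  let ?S = "saturation UNIV P a h"
  interpret S: ideal_of UNIV ?S by (rule ideal_ofI[OF subring_of_UNIV ideal_saturation])
  let ?N = "{loc_frac b t |b t. b \<in> ?S \<and> t \<notin> P}"
  have "ideal ?N loc"
  proof (rule cring_idealI[OF L])
    show "?N \<subseteq> carrier loc" unfolding loc_carrier by blast
    show "\<zero>\<^bsub>loc\<^esub> \<in> ?N" unfolding loc_zero using one_notin S.ideal_zero by blast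
  next
    fix x y assume "x \<in> ?N" "y \<in> ?N"
    then obtain a s b t where xy: "x = loc_frac a s" "y = loc_frac b t" "a \<in> ?S" "b \<in> ?S" "s \<notin> P" "t \<notin> P" by blast
    have "a * t + b * s \<in> ?S" using xy by (intro S.ideal_add S.ideal_mult_right) auto
    then show "x \<oplus>\<^bsub>loc\<^esub> y \<in> ?N" using xy notin_mult by (auto simp: loc_add)
  next
    fix x y assume "x \<in> carrier loc" "y \<in> ?N"
    then obtain a s b t where xy: "x = loc_frac a s" "y = loc_frac b t" "b \<in> ?S" "s \<notin> P" "t \<notin> P"
      unfolding loc_carrier by blast
    have "a * b \<in> ?S" using xy by (intro S.ideal_mult) auto
    then show "x \<otimes>\<^bsub>loc\<^esub> y \<in> ?N" using xy notin_mult by (auto simp: loc_mult)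
  qed
  moreover have "G \<subseteq> ?N"
  proof
    fix x assume "x \<in> G"
    then have "x \<in> e ` {0..<h}" using e by (simp add: bij_betw_def)
    then obtain i where "i < h" "x = e i" by auto
    moreover from this have "a i \<in> ?S" by (intro saturation_generator) auto
    ultimately show "x \<in> ?N" using as by blast
  qed
  ultimately have MN: "?M \<subseteq> ?N" unfolding G(4) by (rule L.genideal_minimal)
  have "P \<subseteq> ?S"
  proof
    fix x assume "x \<in> P"
    then have "loc_frac x 1 \<in> ?N" using MN one_notin by blast
    then obtain b t where b: "loc_frac x 1 = loc_frac b t" "b \<in> ?S" "t \<notin> P" by blast
    then obtain u where u: "u \<notin> P" "u * (x * t) = u * (b * 1)" using loc_frac_eqD one_notin by blast
    have "u * b \<in> ?S" using b(2) by (intro S.ideal_mult) auto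
    then have "(u * t) * x \<in> ?S" using u(2) by (simp add: mult_ac)
    moreover have "u * t \<in> UNIV - P" using notin_mult[OF u(1) b(3)] by simp
    ultimately show "x \<in> ?S" using saturation_cancel by blast
  qed
  moreover have "\<exists>C. prime_chain (subring_record UNIV) C h \<and> C h = P"
  proof (cases "h = 0")
    case True
    then show ?thesis using prime by (intro exI[of _ "\<lambda>_. P"]) (simp add: prime_chain_def)
  next
    case False
    have "enat h = Sup {enat l |l. \<exists>C. prime_chain loc C l}"
      using G(3) unfolding h_def krull_dim_def .
    from enat_Sup_attained[OF this] False obtain C where "prime_chain loc C h" by blast
    then show ?thesis using chain_of_loc[OF L] False by blast
  qed
  ultimately have "generated_by_height UNIV P h"
    unfolding generated_by_height_def using as(2) by blast
  then show ?thesis ..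
qed

end

section \<open>Adjoining a variable\<close>

lemma subring_of_poly_coeffs:
  assumes "subring_of T"
  shows "subring_of {q. \<forall>i. Polynomial.coeff q i \<in> T}"
proof -
  interpret subring_of T by fact
  show ?thesis
    by unfold_locales (auto simp: Polynomial.coeff_mult Polynomial.coeff_1)
qed

text \<open>
  The isomorphism of the polynomials in \<open>n + 1\<close> variables with the univariate polynomials over
  those in \<open>n\<close> variables. Its inverse is evaluation at the last variable, see
  \<open>last_var_poly_eval\<close>.
\<close>

definition last_var_poly :: "nat \<Rightarrow> 'a::comm_ring_1 mpoly \<Rightarrow> 'a mpoly poly" where
  "last_var_poly n =
     eval_mpoly (\<lambda>c. [:mpoly_const c:]) (\<lambda>j. if j = n then [:0, 1:] else [:mpoly_var j:])"

lemma coeff_hom_last_var: "coeff_hom (\<lambda>c::'a::comm_ring_1. [:mpoly_const c:])"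
  by unfold_locales (simp_all add: mpoly_const_hom one_pCons)

lemma last_var_poly_simps:
  "last_var_poly n (p + q) = last_var_poly n p + last_var_poly n q"
  "last_var_poly n (p - q) = last_var_poly n p - last_var_poly n q"
  "last_var_poly n (p * q) = last_var_poly n p * last_var_poly n q"
  "last_var_poly n 1 = 1" "last_var_poly n 0 = 0"
  "last_var_poly n (mpoly_const c) = [:mpoly_const c:]"
  "last_var_poly n (mpoly_var j) = (if j = n then [:0, 1:] else [:mpoly_var j:])"
  unfolding last_var_poly_def
  by (simp_all add: coeff_hom.eval_add[OF coeff_hom_last_var] coeff_hom.eval_diff[OF coeff_hom_last_var]
    coeff_hom.eval_mult[OF coeff_hom_last_var] coeff_hom.eval_one[OF coeff_hom_last_var]
    coeff_hom.eval_zero[OF coeff_hom_last_var] coeff_hom.eval_const[OF coeff_hom_last_var]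
    coeff_hom.eval_var[OF coeff_hom_last_var])

lemma last_var_poly_eval:
  fixes F :: "'a::comm_ring_1 mpoly"
  assumes "F \<in> polys (Suc n)"
  shows "poly (last_var_poly n F) (mpoly_var n) = F"
  using assms by (induction F rule: polys_induct) (simp_all add: last_var_poly_simps)

lemma last_var_poly_const:
  fixes F :: "'a::comm_ring_1 mpoly"
  assumes "F \<in> polys n"
  shows "last_var_poly n F = [:F:]"
  using assms
  by (induction F rule: polys_induct) (simp_all add: last_var_poly_simps)

lemma last_var_poly_coeff_closed:
  fixes F :: "'a::comm_ring_1 mpoly"
  assumes "F \<in> polys (Suc n)"
  shows "Polynomial.coeff (last_var_poly n F) i \<in> polys n"
proof -
  have "last_var_poly n F \<in> {q. \<forall>i. Polynomial.coeff q i \<in> polys n}"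
    unfolding last_var_poly_def
    by (rule coeff_hom.eval_closed[OF coeff_hom_last_var subring_of_poly_coeffs[OF subring_of_polys] assms])
       (auto simp: coeff_pCons subring_of.zero_closed[OF subring_of_polys]
         subring_of.one_closed[OF subring_of_polys] split: nat.splits)
  then show ?thesis by blast
qed

lemma last_var_poly_monom:
  fixes b :: "'a::comm_ring_1 mpoly"
  assumes "b \<in> polys n"
  shows "last_var_poly n (b * mpoly_var n ^ k) = Polynomial.monom b k"
proof -
  have "last_var_poly n (mpoly_var n ^ k :: 'a mpoly) = Polynomial.monom 1 k"
    by (induction k) (simp_all add: last_var_poly_simps monom_Suc one_pCons monom_0)
  then show ?thesis
    using last_var_poly_const[OF assms] by (simp add: last_var_poly_simps smult_monom)
qed

text \<open>
  If \<open>p\<close> is an ideal, this is the ideal that it generates in the polynomials in \<open>n + 1\<close>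
  variables.
\<close>

definition extension :: "nat \<Rightarrow> 'a::comm_ring_1 mpoly set \<Rightarrow> 'a mpoly set" where
  "extension n p = {F \<in> polys (Suc n). \<forall>i. Polynomial.coeff (last_var_poly n F) i \<in> p}"

lemma const_in_extension_iff:
  fixes F :: "'a::comm_ring_1 mpoly"
  assumes "F \<in> polys n" "0 \<in> p"
  shows "F \<in> extension n p \<longleftrightarrow> F \<in> p"
proof -
  interpret T: subring_of "polys n :: 'a mpoly set" by (rule subring_of_polys)
  interpret T': subring_of "polys (Suc n) :: 'a mpoly set" by (rule subring_of_polys)
  have "F \<in> polys (Suc n)" using assms(1) polys_mono[of n "Suc n"] by auto
  then show ?thesis
    using assms by (auto simp: extension_def last_var_poly_const coeff_pCons split: nat.splits)
qed

lemma extension_subset: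
  fixes J :: "'a::comm_ring_1 mpoly set"
  assumes "ideal J (subring_record (polys (Suc n)))" "p \<subseteq> J"
  shows "extension n p \<subseteq> J"
proof
  interpret J: ideal_of "polys (Suc n)" J by (rule ideal_ofI[OF subring_of_polys assms(1)])
  fix F assume F: "F \<in> extension n p"
  have "poly (last_var_poly n F) (mpoly_var n) \<in> J"
    unfolding poly_altdef using F assms(2)
    by (intro J.ideal_sum J.ideal_mult_right) (auto simp: extension_def)
  then show "F \<in> J" using F by (simp add: extension_def last_var_poly_eval)
qed

text \<open>
  Gauss's argument: the product of the first coefficients outside \<open>p\<close> of two polynomials is the
  only summand outside \<open>p\<close> in a coefficient of the product.
\<close>

lemma extension_prime:
  fixes p :: "'a::comm_ring_1 mpoly set"
  assumes "primeideal p (subring_record (polys n))"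
  shows "primeideal (extension n p) (subring_record (polys (Suc n)))"
proof -
  interpret T: subring_of "polys n :: 'a mpoly set" by (rule subring_of_polys)
  interpret T': subring_of "polys (Suc n) :: 'a mpoly set" by (rule subring_of_polys)
  interpret p: prime_of "polys n" p
    using assms by (simp add: prime_of_def prime_of_axioms_def subring_of_polys)
  have "ideal (extension n p) (subring_record (polys (Suc n)))"
    unfolding T'.ideal_iff
  proof (intro conjI ballI)
    show "extension n p \<subseteq> polys (Suc n)" "0 \<in> extension n p"
      by (auto simp: extension_def last_var_poly_simps)
    show "x + y \<in> extension n p" if "x \<in> extension n p" "y \<in> extension n p" for x y
      using that by (auto simp: extension_def last_var_poly_simps p.ideal_add)
    show "a * x \<in> extension n p" if "a \<in> polys (Suc n)" "x \<in> extension n p" for a x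
      using that last_var_poly_coeff_closed[of a]
      by (auto simp: extension_def last_var_poly_simps Polynomial.coeff_mult intro!: p.ideal_sum p.ideal_mult)
  qed
  moreover have "1 \<notin> extension n p"
    using const_in_extension_iff[of 1 n p] p.one_notin by simp
  moreover have "F \<in> extension n p \<or> G \<in> extension n p"
    if FG: "F \<in> polys (Suc n)" "G \<in> polys (Suc n)" "F * G \<in> extension n p" for F G
  proof (rule ccontr)
    assume no: "\<not> ?thesis"
    let ?f = "Polynomial.coeff (last_var_poly n F)" and ?g = "Polynomial.coeff (last_var_poly n G)"
    define i where "i = (LEAST i. ?f i \<notin> p)"
    define j where "j = (LEAST j. ?g j \<notin> p)"
    have ex: "\<exists>i. ?f i \<notin> p" "\<exists>j. ?g j \<notin> p"
      using no FG by (auto simp: extension_def)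
    have i: "?f i \<notin> p" "\<And>k. k < i \<Longrightarrow> ?f k \<in> p"
      unfolding i_def using LeastI_ex[OF ex(1)] not_less_Least by blast+
    have j: "?g j \<notin> p" "\<And>k. k < j \<Longrightarrow> ?g k \<in> p"
      unfolding j_def using LeastI_ex[OF ex(2)] not_less_Least by blast+
    have c: "?f k \<in> polys n" "?g k \<in> polys n" for k
      using FG last_var_poly_coeff_closed by auto
    have "(\<Sum>k\<le>i + j. ?f k * ?g (i + j - k)) \<in> p"
      using FG(3) by (simp add: extension_def last_var_poly_simps Polynomial.coeff_mult)
    moreover have "(\<Sum>k\<in>{..i + j} - {i}. ?f k * ?g (i + j - k)) \<in> p"
    proof (rule p.ideal_sum)
      fix k assume k: "k \<in> {..i + j} - {i}"
      show "?f k * ?g (i + j - k) \<in> p"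
      proof (cases "k < i")
        case True
        then show ?thesis using i c by (intro p.ideal_mult_right) auto
      next
        case False
        then have "i + j - k < j" using k by auto
        then show ?thesis using j c by (intro p.ideal_mult) auto
      qed
    qed
    moreover have "(\<Sum>k\<le>i + j. ?f k * ?g (i + j - k)) =
      ?f i * ?g j + (\<Sum>k\<in>{..i + j} - {i}. ?f k * ?g (i + j - k))"
      by (subst sum.remove[of _ i]) auto
    ultimately have "?f i * ?g j \<in> p" using p.ideal_diff by fastforce
    then show False using p.prime_mult[OF c] i j by blast
  qed
  ultimately show ?thesis unfolding T'.primeideal_iff by blast
qed

lemma extension_strict_mono:
  fixes p p' :: "'a::comm_ring_1 mpoly set"
  assumes "p \<subset> p'" "p' \<subseteq> polys n" "0 \<in> p"
  shows "extension n p \<subset> extension n p'"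
proof -
  obtain x where x: "x \<in> p'" "x \<notin> p" using assms(1) by blast
  moreover have "x \<in> extension n p \<longleftrightarrow> x \<in> p" "x \<in> extension n p' \<longleftrightarrow> x \<in> p'"
    using x(1) assms by (intro const_in_extension_iff; blast)+
  moreover have "extension n p \<subseteq> extension n p'" using assms(1) by (auto simp: extension_def)
  ultimately show ?thesis by blast
qed

lemma prime_chain_extension:
  fixes C :: "nat \<Rightarrow> 'a::comm_ring_1 mpoly set"
  assumes "prime_chain (subring_record (polys n)) C h"
  shows "prime_chain (subring_record (polys (Suc n))) (\<lambda>i. extension n (C i)) h"
proof -
  interpret T: subring_of "polys n :: 'a mpoly set" by (rule subring_of_polys)
  interpret T': subring_of "polys (Suc n) :: 'a mpoly set" by (rule subring_of_polys)
  have C: "ideal (C i) (subring_record (polys n))" "primeideal (C i) (subring_record (polys n))" if "i \<le> h" for i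
    using assms that by (auto simp: prime_chain_def primeideal_def)
  have "extension n (C i) \<subset> extension n (C (Suc i))" if "i < h" for i
    using assms that C[of i] C[of "Suc i"]
    by (intro extension_strict_mono) (auto simp: prime_chain_def T.ideal_iff)
  then show ?thesis using extension_prime[OF C(2)] unfolding prime_chain_def by blast
qed

lemma contraction_prime:
  fixes P :: "'a::comm_ring_1 mpoly set"
  assumes "primeideal P (subring_record (polys (Suc n)))"
  shows "primeideal (P \<inter> polys n) (subring_record (polys n :: 'a mpoly set))"
proof -
  interpret T: subring_of "polys n :: 'a mpoly set" by (rule subring_of_polys)
  interpret T': subring_of "polys (Suc n) :: 'a mpoly set" by (rule subring_of_polys)
  have "polys n \<subseteq> (polys (Suc n) :: 'a mpoly set)" by (rule polys_mono) simp
  then show ?thesis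
    using assms unfolding T.primeideal_iff T'.primeideal_iff T.ideal_iff T'.ideal_iff
    by (simp add: subset_iff)
qed

text \<open>
  Let \<open>p\<close> be the contraction of \<open>P\<close>. If \<open>P\<close> is the extension of \<open>p\<close>, then chain and generators
  for \<open>p\<close> serve for \<open>P\<close>. Otherwise the extension of \<open>p\<close> can be put below \<open>P\<close> in the chain, and
  one further generator suffices: an \<open>F \<in> P\<close> outside the extension of least degree in the last
  variable. Its leading coefficient \<open>c\<close> is not in \<open>p\<close>, so that \<open>c\<close> is a unit locally at \<open>P\<close>, and
  division by \<open>F\<close> reduces every element of \<open>P\<close> to an element of the extension.
\<close>

lemma generated_by_height_step:
  fixes P :: "'a::comm_ring_1 mpoly set"
  assumes P: "primeideal P (subring_record (polys (Suc n)))"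
    and IH: "generated_by_height (polys n) (P \<inter> polys n) h"
  shows "\<exists>h. generated_by_height (polys (Suc n)) P h"
proof -
  interpret T: subring_of "polys n :: 'a mpoly set" by (rule subring_of_polys)
  interpret T': subring_of "polys (Suc n) :: 'a mpoly set" by (rule subring_of_polys)
  interpret P: prime_of "polys (Suc n)" P
    using P by (simp add: prime_of_def prime_of_axioms_def subring_of_polys)
  define p where "p = P \<inter> polys n"
  interpret p: prime_of "polys n" p
    using contraction_prime[OF P]
    by (simp add: prime_of_def prime_of_axioms_def subring_of_polys p_def)
  have TT: "polys n \<subseteq> (polys (Suc n) :: 'a mpoly set)" by (rule polys_mono) simp
  have compl: "polys n - p \<subseteq> polys (Suc n) - P" using TT unfolding p_def by blast
  have pP: "p \<subseteq> P" unfolding p_def by blast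
  have eP: "extension n p \<subseteq> P" by (rule extension_subset[OF P.is_ideal_of pP])
  obtain C g where C: "prime_chain (subring_record (polys n)) C h" "C h = p"
    and g: "\<And>i. i < h \<Longrightarrow> g i \<in> p" "p \<subseteq> saturation (polys n) p g h"
    using IH unfolding generated_by_height_def p_def by blast
  have eC: "prime_chain (subring_record (polys (Suc n))) (\<lambda>i. extension n (C i)) h"
    by (rule prime_chain_extension[OF C(1)])
  show ?thesis
  proof (cases "P \<subseteq> extension n p")
    case True
    have "saturation (polys n) p g h \<subseteq> saturation (polys (Suc n)) P g h"
      using TT compl by (intro saturation_mono) auto
    then have "extension n p \<subseteq> saturation (polys (Suc n)) P g h"
      using g(2) by (intro extension_subset[OF P.ideal_saturation]) blast
    moreover have "P = extension n p" using True eP by blast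
    ultimately have "generated_by_height (polys (Suc n)) P h"
      unfolding generated_by_height_def using eC C(2) g(1) pP
      by (intro exI[of _ "\<lambda>i. extension n (C i)"] exI[of _ g]) auto
    then show ?thesis ..
  next
    case False
    let ?c = "\<lambda>F. Polynomial.coeff (last_var_poly n F)"
    define d where "d = (LEAST d. \<exists>F\<in>P - extension n p. \<forall>i>d. ?c F i = 0)"
    obtain F0 where "F0 \<in> P - extension n p" using False by blast
    then have "\<exists>d. \<exists>F\<in>P - extension n p. \<forall>i>d. ?c F i = 0"
      using coeff_eq_0[of "last_var_poly n F0"] by blast
    from LeastI_ex[OF this] obtain F where F: "F \<in> P" "F \<notin> extension n p" "\<And>i. i > d \<Longrightarrow> ?c F i = 0"
      unfolding d_def by blast
    have least: "d \<le> e" if "G \<in> P" "G \<notin> extension n p" "\<And>i. i > e \<Longrightarrow> ?c G i = 0" for G e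
      unfolding d_def using that by (intro Least_le) blast
    have FT: "F \<in> polys (Suc n)" using F(1) P.ideal_subset by blast
    have X: "mpoly_var n ^ k \<in> (polys (Suc n) :: 'a mpoly set)" for k by (rule T'.power_closed) simp
    define c where "c = ?c F d"
    have cT: "c \<in> polys n" unfolding c_def using last_var_poly_coeff_closed[OF FT] .
    have ext_zero: "G \<in> extension n p" if "G \<in> P" "\<And>i. ?c G i = 0" for G
      using that P.ideal_subset by (auto simp: extension_def)
    have c: "c \<in> polys n - p"
    proof (rule ccontr)
      assume "c \<notin> polys n - p"
      then have cp: "c \<in> p" using cT by blast
      define F1 where "F1 = F - c * mpoly_var n ^ d"
      have "c * mpoly_var n ^ d \<in> extension n p"
      proof -
        have "c * mpoly_var n ^ d \<in> polys (Suc n)" using cT TT X by auto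
        then show ?thesis
          using cp by (auto simp: extension_def last_var_poly_monom[OF cT] coeff_monom)
      qed
      interpret e: ideal_of "polys (Suc n)" "extension n p"
        using extension_prime[OF p.prime] by (intro ideal_ofI subring_of_polys) (simp add: primeideal_def)
      have F1P: "F1 \<in> P" unfolding F1_def
        using F(1) \<open>c * mpoly_var n ^ d \<in> extension n p\<close> eP by (intro P.ideal_diff) blast+
      moreover have F1e: "F1 \<notin> extension n p"
        using e.ideal_add[OF _ \<open>c * mpoly_var n ^ d \<in> extension n p\<close>, of F1] F(2) unfolding F1_def by auto
      moreover have coeffs: "?c F1 i = 0" if "i \<ge> d" for i
        using that F(3)[of i] unfolding F1_def c_def
        by (cases "i = d") (simp_all add: last_var_poly_simps(2) last_var_poly_monom[OF cT, unfolded c_def])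
      ultimately show False
      proof (cases d)
        case 0
        then show False using ext_zero[OF F1P] coeffs F1e by auto
      next
        case (Suc d')
        have "d \<le> d'" using coeffs Suc by (intro least[OF F1P F1e]) auto
        then show False using Suc by simp
      qed
    qed
    define g' where "g' = g(h := F)"
    let ?S = "saturation (polys (Suc n)) P g' (Suc h)"
    interpret S: ideal_of "polys (Suc n)" ?S by (rule ideal_ofI[OF subring_of_polys P.ideal_saturation])
    have "saturation (polys n) p g h \<subseteq> ?S"
      using TT compl by (intro saturation_mono) (auto simp: g'_def)
    then have eS: "extension n p \<subseteq> ?S"
      using g(2) by (intro extension_subset[OF P.ideal_saturation]) blast
    have FS: "F \<in> ?S" using P.saturation_generator[of h "Suc h" g'] FT by (simp add: g'_def)
    have "G \<in> ?S" if "G \<in> P" "\<And>i. i \<ge> e \<Longrightarrow> ?c G i = 0" for G e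
      using that
    proof (induction e arbitrary: G)
      case 0
      then show ?case using ext_zero eS by auto
    next
      case (Suc e)
      show ?case
      proof (cases "G \<in> extension n p")
        case False
        have GT: "G \<in> polys (Suc n)" using Suc.prems(1) P.ideal_subset by blast
        have de: "d \<le> e" using Suc.prems by (intro least[OF _ False]) auto
        define b where "b = ?c G e"
        have bT: "b \<in> polys n" unfolding b_def using last_var_poly_coeff_closed[OF GT] .
        define H where "H = c * G - b * mpoly_var n ^ (e - d) * F"
        have bX: "b * mpoly_var n ^ (e - d) \<in> polys (Suc n)" using bT TT X by auto
        have "H \<in> P" unfolding H_def using Suc.prems(1) F(1) bX cT TT
          by (intro P.ideal_diff P.ideal_mult) blast+
        moreover have "?c H i = 0" if "i \<ge> e" for i
        proof -
          have "?c H i = c * ?c G i - b * ?c F (i - (e - d))"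
            unfolding H_def last_var_poly_simps(2) last_var_poly_simps(3)[of n _ F] last_var_poly_simps(3)[of n c]
              last_var_poly_monom[OF bT] last_var_poly_const[OF cT]
            using that de by (simp add: coeff_monom_mult)
          also have "\<dots> = 0"
          proof (cases "i = e")
            case True
            then show ?thesis using de by (simp add: c_def b_def mult.commute)
          next
            case False
            then show ?thesis using that de Suc.prems(2)[of i] F(3)[of "i - (e - d)"] by simp
          qed
          finally show ?thesis .
        qed
        ultimately have "H \<in> ?S" by (rule Suc.IH)
        then have "H + b * mpoly_var n ^ (e - d) * F \<in> ?S"
          by (intro S.ideal_add S.ideal_mult bX FS)
        then have "c * G \<in> ?S" by (simp add: H_def)
        then show ?thesis using c compl GT P.saturation_cancel by blast
      qed (use eS in blast)
    qed note S = this
    have PS: "P \<subseteq> ?S"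
    proof
      fix G assume "G \<in> P"
      then show "G \<in> ?S"
        by (rule S[of _ "Suc (Polynomial.degree (last_var_poly n G))"]) (simp add: coeff_eq_0)
    qed
    define C' where "C' i = (if i \<le> h then extension n (C i) else P)" for i
    have "prime_chain (subring_record (polys (Suc n))) C' (Suc h)"
      unfolding prime_chain_def
    proof (intro conjI allI impI)
      fix i assume "i \<le> Suc h"
      then show "primeideal (C' i) (subring_record (polys (Suc n)))"
        using eC P by (auto simp: C'_def prime_chain_def)
    next
      fix i assume "i < Suc h"
      then show "C' i \<subset> C' (Suc i)"
        using eC eP False C(2) by (cases "i = h") (auto simp: C'_def prime_chain_def)
    qed
    moreover have "g' i \<in> P" if "i < Suc h" for i
      using that g(1) pP F(1) by (auto simp: g'_def less_Suc_eq)
    ultimately have "generated_by_height (polys (Suc n)) P (Suc h)"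
      unfolding generated_by_height_def using PS
      by (intro exI[of _ C'] exI[of _ g']) (auto simp: C'_def)
    then show ?thesis ..
  qed
qed

lemma polys_zero: "polys 0 = range (mpoly_const :: 'a::comm_ring_1 \<Rightarrow> 'a mpoly)"
proof
  show "polys 0 \<subseteq> range (mpoly_const :: 'a \<Rightarrow> 'a mpoly)"
  proof
    fix p :: "'a mpoly" assume "p \<in> polys 0"
    then show "p \<in> range mpoly_const"
      by (induction p rule: polys_induct) (auto simp: mpoly_const_hom[symmetric] image_iff)
  qed
qed auto

lemma inj_mpoly_const: "inj mpoly_const"
  unfolding inj_on_def mpoly_const_def by (metis lookup_single_eq)

lemma primeideal_mpoly_const_image:
  fixes p :: "'a::comm_ring_1 set"
  shows "primeideal (mpoly_const ` p) (subring_record (polys 0)) \<longleftrightarrow> primeideal p (subring_record UNIV)"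
proof -
  interpret U: subring_of "UNIV :: 'a set" by (rule subring_of_UNIV)
  interpret T: subring_of "polys 0 :: 'a mpoly set" by (rule subring_of_polys)
  have *: "mpoly_const x \<in> mpoly_const ` p \<longleftrightarrow> x \<in> p" for x
    using inj_mpoly_const by (auto simp: inj_on_def)
  have z: "0 \<in> mpoly_const ` p \<longleftrightarrow> 0 \<in> p" "1 \<in> mpoly_const ` p \<longleftrightarrow> 1 \<in> p"
    using *[of 0] *[of 1] by (simp_all add: mpoly_const_hom)
  show ?thesis
    unfolding U.primeideal_iff U.ideal_iff T.primeideal_iff T.ideal_iff z
    by (simp add: polys_zero mpoly_const_hom(3,4)[symmetric] * ball_UNIV image_subset_iff)
qed

lemma generated_by_height_const:
  fixes p :: "'a::comm_ring_1 set"
  assumes "generated_by_height UNIV p h"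
  shows "generated_by_height (polys 0) (mpoly_const ` p) h"
proof -
  obtain C g where C: "prime_chain (subring_record UNIV) C h" "C h = p"
    and g: "\<And>i. i < h \<Longrightarrow> g i \<in> p" "p \<subseteq> saturation UNIV p g h"
    using assms unfolding generated_by_height_def by blast
  have inj: "mpoly_const x \<in> mpoly_const ` q \<longleftrightarrow> x \<in> q" for x :: 'a and q
    using inj_mpoly_const by (auto simp: inj_on_def)
  have sum: "mpoly_const (sum f A) = (\<Sum>i\<in>A. mpoly_const (f i))" for f :: "nat \<Rightarrow> 'a" and A
    by (induction A rule: infinite_finite_induct) (simp_all add: mpoly_const_hom)
  have "mpoly_const ` p \<subseteq> saturation (polys 0) (mpoly_const ` p) (\<lambda>i. mpoly_const (g i)) h"
  proof clarify
    fix x assume "x \<in> p"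
    then obtain s c where *: "s \<notin> p" "s * x = (\<Sum>i<h. c i * g i)"
      using g(2) unfolding saturation_def by blast
    then have "mpoly_const s * mpoly_const x = (\<Sum>i<h. mpoly_const (c i) * mpoly_const (g i))"
      by (simp add: mpoly_const_hom(4)[symmetric] sum[symmetric])
    moreover have "mpoly_const s \<in> polys 0 - mpoly_const ` p" using *(1) inj by simp
    ultimately show "mpoly_const x \<in> saturation (polys 0) (mpoly_const ` p) (\<lambda>i. mpoly_const (g i)) h"
      unfolding saturation_def by (intro CollectI conjI bexI[of _ "mpoly_const s"] exI[of _ "\<lambda>i. mpoly_const (c i)"]) simp_all
  qed
  moreover have "prime_chain (subring_record (polys 0)) (\<lambda>i. mpoly_const ` C i) h"
    using C(1) unfolding prime_chain_def primeideal_mpoly_const_image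
    by (simp add: psubset_eq inj_image_subset_iff[OF inj_mpoly_const] inj_image_eq_iff[OF inj_mpoly_const])
  ultimately show ?thesis
    unfolding generated_by_height_def using C(2) g(1)
    by (intro exI[of _ "\<lambda>i. mpoly_const ` C i"] exI[of _ "\<lambda>i. mpoly_const (g i)"]) auto
qed

theorem generated_by_height_polys:
  fixes P :: "'a::comm_ring_1 mpoly set"
  assumes "regular_ring (coeff_ring :: 'a ring)" "primeideal P (subring_record (polys n))"
  shows "\<exists>h. generated_by_height (polys n) P h"
  using assms(2)
proof (induction n arbitrary: P)
  case 0
  define p where "p = {c. mpoly_const c \<in> P}"
  interpret T: subring_of "polys 0 :: 'a mpoly set" by (rule subring_of_polys)
  have "P \<subseteq> polys 0" using 0 unfolding T.primeideal_iff T.ideal_iff by blast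
  then have P: "P = mpoly_const ` p" unfolding p_def polys_zero by blast
  have "primeideal p coeff_ring"
    using 0 unfolding P primeideal_mpoly_const_image coeff_ring_eq .
  then show ?case
    using regular_generated_by_height[OF _ assms(1)] generated_by_height_const unfolding P by blast
next
  case (Suc n)
  then show ?case using contraction_prime generated_by_height_step by blast
qed

section \<open>Jacobian determinants that are units at a prime\<close>

context subring_of
begin

lemma signof_closed [simp]: "signof p \<in> T"
  by (auto simp: sign_def)

lemma det_closed:
  assumes "A \<in> carrier_mat k k" "\<And>i j. i < k \<Longrightarrow> j < k \<Longrightarrow> A $$ (i, j) \<in> T"
  shows "det A \<in> T"
  unfolding det_def'[OF assms(1)] using assms(2)
  by (intro sum_closed mult_closed prod_closed signof_closed) (auto simp: permutes_in_image)

lemma adj_mat_closed: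
  assumes "A \<in> carrier_mat k k" "\<And>i j. i < k \<Longrightarrow> j < k \<Longrightarrow> A $$ (i, j) \<in> T" "i < k" "j < k"
  shows "adj_mat A $$ (i, j) \<in> T"
proof -
  have "det (mat_delete A j i) \<in> T"
    using assms by (intro det_closed[of _ "k - 1"] mat_delete_carrier) (auto simp: mat_delete_def)
  then show ?thesis
    using assms by (auto simp: adj_mat_def cofactor_def)
qed

end

context ideal_of
begin

lemma prod_cong_mod:
  assumes "\<And>i. i \<in> A \<Longrightarrow> f i \<in> T" "\<And>i. i \<in> A \<Longrightarrow> g i \<in> T" "\<And>i. i \<in> A \<Longrightarrow> f i - g i \<in> I"
  shows "prod f A - prod g A \<in> I"
  using assms
proof (induction A rule: infinite_finite_induct)
  case (insert a A)
  have "f a * prod f A - g a * prod g A = f a * (prod f A - prod g A) + (f a - g a) * prod g A"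
    by (simp add: algebra_simps)
  also have "\<dots> \<in> I"
    using insert by (intro ideal_add ideal_mult ideal_mult_right prod_closed) auto
  finally show ?case using insert by simp
qed auto

lemma det_cong_mod:
  assumes "A \<in> carrier_mat k k" "B \<in> carrier_mat k k"
    and "\<And>i j. i < k \<Longrightarrow> j < k \<Longrightarrow> A $$ (i, j) \<in> T"
    and "\<And>i j. i < k \<Longrightarrow> j < k \<Longrightarrow> B $$ (i, j) \<in> T"
    and "\<And>i j. i < k \<Longrightarrow> j < k \<Longrightarrow> A $$ (i, j) - B $$ (i, j) \<in> I"
  shows "det A - det B \<in> I"
  unfolding det_def'[OF assms(1)] det_def'[OF assms(2)] sum_subtractf[symmetric] right_diff_distrib[symmetric]
  by (intro ideal_sum ideal_mult signof_closed prod_cong_mod)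
     (use assms(3-5) in \<open>auto simp: permutes_in_image\<close>)

end

text \<open>
  One direction of the Jacobian criterion. The relations \<open>s f\<^sub>i = \<Sum> C\<^sub>i\<^sub>l g\<^sub>l\<close> and their
  derivatives modulo \<open>P\<close> yield a matrix identity; taking determinants shows that \<open>C\<close> is
  invertible locally at \<open>P\<close>. The family \<open>g\<close> is padded with zeros to length \<open>r\<close> so that \<open>C\<close> is
  square.
\<close>

lemma saturation_of_jacobian_det_notin:
  fixes P :: "'a::comm_ring_1 mpoly set" and f g :: "nat \<Rightarrow> 'a mpoly"
  assumes P: "primeideal P (subring_record (polys n))"
    and f: "\<And>i. i < r \<Longrightarrow> f i \<in> P"
    and det: "det (mat r r (\<lambda>(i, j). partial_deriv (\<beta> j) (f i))) \<notin> P"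
    and g: "\<And>i. i < h \<Longrightarrow> g i \<in> P" "P \<subseteq> saturation (polys n) P g h" and "h \<le> r"
  shows "P \<subseteq> saturation (polys n) P f r"
proof -
  interpret prime_of "polys n" P
    using P by (simp add: prime_of_def prime_of_axioms_def subring_of_polys)
  note pd = partial_deriv_closed[of _ n]
  define g' where "g' i = (if i < h then g i else 0)" for i
  have g': "g' i \<in> P" for i using g(1) by (simp add: g'_def)
  have Pg': "P \<subseteq> saturation (polys n) P g' r"
    using g(2) saturation_mono[of "polys n" "polys n" P P h r g' g] \<open>h \<le> r\<close> by (auto simp: g'_def)
  have "\<exists>s c. s \<in> polys n - P \<and> (\<forall>l<r. c l \<in> polys n) \<and> s * f i = (\<Sum>l<r. c l * g' l)" if "i < r" for i
  proof -
    have "f i \<in> saturation (polys n) P g' r" using f[OF that] Pg' by blast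
    then show ?thesis unfolding saturation_def by blast
  qed
  then have "\<forall>i. \<exists>s c. i < r \<longrightarrow>
      s \<in> polys n - P \<and> (\<forall>l<r. c l \<in> polys n) \<and> s * f i = (\<Sum>l<r. c l * g' l)" by blast
  from this[unfolded choice_iff] obtain s c where sc: "\<And>i. i < r \<Longrightarrow> s i \<in> polys n - P"
    "\<And>i l. i < r \<Longrightarrow> l < r \<Longrightarrow> c i l \<in> polys n"
    "\<And>i. i < r \<Longrightarrow> s i * f i = (\<Sum>l<r. c i l * g' l)" by blast
  define S where "S = (\<Prod>i<r. s i)"
  have S: "S \<in> polys n - P" unfolding S_def using sc(1) by (intro compl_prod) auto
  define C where "C i l = (\<Prod>k\<in>{..<r} - {i}. s k) * c i l" for i l
  have CT: "C i l \<in> polys n" if "i < r" "l < r" for i l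
    unfolding C_def using sc that by (intro mult_closed prod_closed) auto
  have SC: "S * f i = (\<Sum>l<r. C i l * g' l)" if "i < r" for i
  proof -
    have "S * f i = (\<Prod>k\<in>{..<r} - {i}. s k) * (s i * f i)"
      unfolding S_def using that by (subst prod.remove[of _ i]) (auto simp: mult_ac)
    also have "\<dots> = (\<Sum>l<r. C i l * g' l)"
      unfolding sc(3)[OF that] C_def by (simp add: sum_distrib_left mult.assoc)
    finally show ?thesis .
  qed
  define J where "J = mat r r (\<lambda>(i, j). partial_deriv (\<beta> j) (f i))"
  define M where "M = mat r r (\<lambda>(i, l). C i l)"
  define G where "G = mat r r (\<lambda>(l, j). partial_deriv (\<beta> j) (g' l))"
  have carr: "J \<in> carrier_mat r r" "M \<in> carrier_mat r r" "G \<in> carrier_mat r r"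
    by (simp_all add: J_def M_def G_def)
  have fT: "f i \<in> polys n" if "i < r" for i using f[OF that] by (rule ideal_subset)
  have gT: "g' i \<in> polys n" for i using g' by (rule ideal_subset)
  have MG: "(M * G) $$ (i, j) = (\<Sum>l<r. C i l * partial_deriv (\<beta> j) (g' l))" if "i < r" "j < r" for i j
    using that by (simp add: M_def G_def scalar_prod_def atLeast0LessThan)
  have "det (S \<cdot>\<^sub>m J) - det (M * G) \<in> P"
  proof (rule det_cong_mod)
    fix i j assume ij: "i < r" "j < r"
    show "(S \<cdot>\<^sub>m J) $$ (i, j) \<in> polys n" using ij S fT pd by (auto simp: J_def)
    show "(M * G) $$ (i, j) \<in> polys n"
      unfolding MG[OF ij] using CT ij gT by (intro sum_closed mult_closed pd) auto
    have "partial_deriv (\<beta> j) (S * f i) = (\<Sum>l<r. partial_deriv (\<beta> j) (C i l * g' l))"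
      unfolding SC[OF ij(1)] by (rule partial_deriv_sum)
    then have "S * partial_deriv (\<beta> j) (f i) + f i * partial_deriv (\<beta> j) S =
        (\<Sum>l<r. C i l * partial_deriv (\<beta> j) (g' l)) + (\<Sum>l<r. g' l * partial_deriv (\<beta> j) (C i l))"
      by (simp add: partial_deriv_mult sum.distrib)
    then have "(S \<cdot>\<^sub>m J) $$ (i, j) - (M * G) $$ (i, j) =
        (\<Sum>l<r. g' l * partial_deriv (\<beta> j) (C i l)) - f i * partial_deriv (\<beta> j) S"
      unfolding MG[OF ij] using ij by (simp add: J_def algebra_simps)
    also have "\<dots> \<in> P"
      using f g' CT ij S by (intro ideal_diff ideal_sum ideal_mult_right pd) auto
    finally show "(S \<cdot>\<^sub>m J) $$ (i, j) - (M * G) $$ (i, j) \<in> P" .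
  qed (use carr in auto)
  moreover have "det (S \<cdot>\<^sub>m J) \<notin> P"
  proof -
    have "S ^ r \<in> polys n - P" using S by (rule compl_power)
    moreover have "det J \<in> polys n - P"
      using det det_closed[OF carr(1)] fT pd by (auto simp: J_def)
    ultimately have "S ^ r * det J \<in> polys n - P" by (rule compl_mult)
    then show ?thesis using carr(1) by (simp add: det_smult)
  qed
  moreover have "det (M * G) = det M * det G" by (rule det_mult[OF carr(2,3)])
  moreover have GT: "det G \<in> polys n"
    using gT pd by (intro det_closed[OF carr(3)]) (auto simp: G_def)
  ultimately have "det M \<notin> P"
    using ideal_add[of "det (S \<cdot>\<^sub>m J) - det (M * G)" "det (M * G)"] ideal_mult_right by fastforce
  moreover have MT: "M $$ (i, l) \<in> polys n" if "i < r" "l < r" for i l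
    using that CT by (simp add: M_def)
  ultimately have detM: "det M \<in> polys n - P" using det_closed[OF carr(2)] by blast
  have "g' l \<in> saturation (polys n) P f r" if l: "l < r" for l
  proof (rule saturationI)
    show "g' l \<in> polys n" "det M \<in> polys n - P" using gT detM by auto
    show "adj_mat M $$ (l, i) * S \<in> polys n" if "i < r" for i
      using adj_mat_closed[OF carr(2) MT l that] S by auto
    have adj: "(\<Sum>i<r. adj_mat M $$ (l, i) * C i k) = (if l = k then det M else 0)" if k: "k < r" for k
    proof -
      have "(adj_mat M * M) $$ (l, k) = (\<Sum>i<r. adj_mat M $$ (l, i) * C i k)"
        using l k adj_mat(1)[OF carr(2)] by (auto simp: M_def scalar_prod_def atLeast0LessThan)
      then show ?thesis using l k unfolding adj_mat(3)[OF carr(2)] by (simp split: if_splits)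
    qed
    have "(\<Sum>i<r. adj_mat M $$ (l, i) * S * f i) = (\<Sum>i<r. \<Sum>k<r. adj_mat M $$ (l, i) * C i k * g' k)"
      by (intro sum.cong) (simp_all add: mult.assoc SC sum_distrib_left)
    also have "\<dots> = (\<Sum>k<r. (\<Sum>i<r. adj_mat M $$ (l, i) * C i k) * g' k)"
      by (subst sum.swap) (simp add: sum_distrib_right)
    also have "\<dots> = (\<Sum>k<r. if l = k then det M * g' k else 0)"
      by (intro sum.cong) (auto simp: adj)
    also have "\<dots> = det M * g' l" using l by simp
    finally show "det M * g' l = (\<Sum>i<r. adj_mat M $$ (l, i) * S * f i)" ..
  qed note gS = this
  interpret S: ideal_of "polys n" "saturation (polys n) P f r"
    by (rule ideal_ofI[OF subring_of_polys ideal_saturation])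
  show ?thesis
  proof
    fix x assume x: "x \<in> P"
    then obtain t c where *: "t \<in> polys n - P" "\<And>l. l < r \<Longrightarrow> c l \<in> polys n" "t * x = (\<Sum>l<r. c l * g' l)"
      using Pg' unfolding saturation_def by blast
    have "t * x \<in> saturation (polys n) P f r"
      unfolding *(3) using *(2) gS by (intro S.ideal_sum S.ideal_mult) auto
    then show "x \<in> saturation (polys n) P f r"
      using *(1) ideal_subset[OF x] saturation_cancel by blast
  qed
qed

section \<open>Substituting power series into polynomials\<close>

lemma subring_of_fps_coeffs:
  assumes "subring_of T"
  shows "subring_of {F. \<forall>k. fps_nth F k \<in> T}"
proof -
  interpret subring_of T by fact
  show ?thesis by unfold_locales (auto simp: fps_mult_nth)
qed

definition fps_poly_const :: "'a::comm_ring_1 \<Rightarrow> 'a mpoly fps" where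
  "fps_poly_const c = fps_const (mpoly_const c)"

definition fps_eval :: "(nat \<Rightarrow> 'a::comm_ring_1 mpoly fps) \<Rightarrow> 'a mpoly \<Rightarrow> 'a mpoly fps" where
  "fps_eval = eval_mpoly fps_poly_const"

lemma coeff_hom_fps: "coeff_hom fps_poly_const"
  by unfold_locales (simp_all add: fps_poly_const_def mpoly_const_hom)

lemma fps_eval_simps [simp]:
  "fps_eval u (p + q) = fps_eval u p + fps_eval u q"
  "fps_eval u (p * q) = fps_eval u p * fps_eval u q"
  "fps_eval u (mpoly_const c) = fps_const (mpoly_const c)"
  "fps_eval u (mpoly_var j) = u j"
  "fps_eval u (sum f A) = (\<Sum>i\<in>A. fps_eval u (f i))"
  unfolding fps_eval_def
  by (simp_all add: coeff_hom.eval_add[OF coeff_hom_fps] coeff_hom.eval_mult[OF coeff_hom_fps]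
    coeff_hom.eval_const[OF coeff_hom_fps] coeff_hom.eval_var[OF coeff_hom_fps]
    coeff_hom.eval_sum[OF coeff_hom_fps] fps_poly_const_def)

definition series_over :: "nat \<Rightarrow> 'a::comm_ring_1 mpoly fps set" where
  "series_over n = {F. \<forall>k. fps_nth F k \<in> polys n}"

lemma subring_of_series_over: "subring_of (series_over n)"
  unfolding series_over_def by (rule subring_of_fps_coeffs[OF subring_of_polys])

lemma fps_const_in_series_over [simp]: "p \<in> polys n \<Longrightarrow> fps_const p \<in> series_over n"
  by (simp add: series_over_def subring_of.zero_closed[OF subring_of_polys])

lemma fps_X_power_in_series_over [simp]: "fps_X ^ k \<in> series_over n"
  by (simp add: series_over_def subring_of.zero_closed[OF subring_of_polys]
    subring_of.one_closed[OF subring_of_polys])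

lemma fps_X_in_series_over [simp]: "fps_X \<in> series_over n"
  using fps_X_power_in_series_over[of 1] by simp

lemma fps_shift_in_series_over [simp]: "F \<in> series_over n \<Longrightarrow> fps_shift k F \<in> series_over n"
  by (simp add: series_over_def)

lemma fps_eval_closed:
  assumes "p \<in> polys n" "\<And>j. j < n \<Longrightarrow> u j \<in> series_over n"
  shows "fps_eval u p \<in> series_over n"
  unfolding fps_eval_def using assms
  by (intro coeff_hom.eval_closed[OF coeff_hom_fps subring_of_series_over]) (auto simp: fps_poly_const_def)

lemma fps_eval_taylor:
  assumes "p \<in> polys n"
    and "\<And>j. j < n \<Longrightarrow> u j \<in> series_over n" "\<And>j. j < n \<Longrightarrow> v j \<in> series_over n" "e \<in> series_over n"
  shows "\<exists>q\<in>series_over n. fps_eval (\<lambda>j. u j + e * v j) p =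
    fps_eval u p + e * (\<Sum>j<n. fps_eval u (partial_deriv j p) * v j) + e\<^sup>2 * q"
  unfolding fps_eval_def using assms
  by (intro coeff_hom.eval_taylor[OF coeff_hom_fps subring_of_series_over]) (auto simp: fps_poly_const_def)

lemma fps_eval_cong:
  assumes "p \<in> polys n" "\<And>j. j < n \<Longrightarrow> u j = u' j"
  shows "fps_eval u p = fps_eval u' p"
  using assms(1) by (induction p rule: polys_induct) (simp_all add: assms(2))

lemma fps_eval_base:
  assumes "p \<in> polys n"
  shows "fps_eval (\<lambda>j. fps_const (mpoly_var j)) p = fps_const p"
  using assms by (induction p rule: polys_induct) simp_all

lemma fps_eval_nth_0:
  assumes "p \<in> polys n" "\<And>j. j < n \<Longrightarrow> fps_nth (u j) 0 = mpoly_var j"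
  shows "fps_nth (fps_eval u p) 0 = p"
  using assms(1) by (induction p rule: polys_induct) (simp_all add: assms(2))

lemma fps_eval_nth_cong:
  assumes p: "p \<in> polys n"
    and u: "\<And>j. j < n \<Longrightarrow> u j \<in> series_over n" "\<And>j. j < n \<Longrightarrow> u' j \<in> series_over n"
    and eq: "\<And>j i. j < n \<Longrightarrow> i \<le> k \<Longrightarrow> fps_nth (u j) i = fps_nth (u' j) i"
  shows "fps_nth (fps_eval u p) k = fps_nth (fps_eval u' p) k"
proof -
  interpret U: subring_of "series_over n :: 'a mpoly fps set" by (rule subring_of_series_over)
  define v where "v j = fps_shift (Suc k) (u j - u' j)" for j
  have uv: "u j = u' j + fps_X ^ Suc k * v j" if "j < n" for j
  proof (rule fps_ext)
    fix i
    show "fps_nth (u j) i = fps_nth (u' j + fps_X ^ Suc k * v j) i"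
      using eq[OF that, of i] unfolding fps_add_nth fps_X_power_mult_nth
      by (cases "i \<le> k") (auto simp: v_def)
  qed
  have "\<exists>q\<in>series_over n. fps_eval (\<lambda>j. u' j + fps_X ^ Suc k * v j) p =
    fps_eval u' p + fps_X ^ Suc k * (\<Sum>j<n. fps_eval u' (partial_deriv j p) * v j) + (fps_X ^ Suc k)\<^sup>2 * q"
    using u by (intro fps_eval_taylor[OF p]) (auto simp: v_def simp del: power_Suc)
  then obtain q where "fps_eval (\<lambda>j. u' j + fps_X ^ Suc k * v j) p =
    fps_eval u' p + fps_X ^ Suc k * (\<Sum>j<n. fps_eval u' (partial_deriv j p) * v j) + (fps_X ^ Suc k)\<^sup>2 * q"
    by blast
  then have "fps_eval u p =
    fps_eval u' p + fps_X ^ Suc k * (\<Sum>j<n. fps_eval u' (partial_deriv j p) * v j) + (fps_X ^ Suc k)\<^sup>2 * q"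
    using fps_eval_cong[OF p, of u "\<lambda>j. u' j + fps_X ^ Suc k * v j"] uv by simp
  then show ?thesis
    by (simp add: fps_X_power_mult_nth power_mult[symmetric] del: power_Suc)
qed

text \<open>
  First order Taylor expansion at \<open>u\<close>: the remainder has order at least \<open>2 k > k\<close>, and in the
  linear term only the constant coefficient \<open>x\<close> of \<open>u\<close> contributes to degree \<open>k\<close>.
\<close>

lemma fps_eval_perturb_nth:
  assumes p: "p \<in> polys n" and "k > 0"
    and u: "\<And>j. j < n \<Longrightarrow> u j \<in> series_over n" "\<And>j. j < n \<Longrightarrow> v j \<in> polys n"
    and u0: "\<And>j. j < n \<Longrightarrow> fps_nth (u j) 0 = mpoly_var j"
  shows "fps_nth (fps_eval (\<lambda>j. u j + fps_X ^ k * fps_const (v j)) p) k =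
    fps_nth (fps_eval u p) k + (\<Sum>j<n. partial_deriv j p * v j)"
proof -
  have "\<exists>q\<in>series_over n. fps_eval (\<lambda>j. u j + fps_X ^ k * fps_const (v j)) p =
    fps_eval u p + fps_X ^ k * (\<Sum>j<n. fps_eval u (partial_deriv j p) * fps_const (v j)) + (fps_X ^ k)\<^sup>2 * q"
    using u by (intro fps_eval_taylor[OF p]) auto
  then obtain q where q: "fps_eval (\<lambda>j. u j + fps_X ^ k * fps_const (v j)) p =
    fps_eval u p + fps_X ^ k * (\<Sum>j<n. fps_eval u (partial_deriv j p) * fps_const (v j)) + (fps_X ^ k)\<^sup>2 * q"
    by blast
  have "fps_nth (fps_eval u (partial_deriv j p)) 0 = partial_deriv j p" for j
    by (rule fps_eval_nth_0[OF partial_deriv_closed[OF p] u0])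
  then show ?thesis
    unfolding q using \<open>k > 0\<close> by (simp add: fps_X_power_mult_nth power_mult[symmetric] fps_sum_nth)
qed

definition shifted_point :: "'a::comm_ring_1 mpoly \<Rightarrow> (nat \<Rightarrow> 'a mpoly fps) \<Rightarrow> nat \<Rightarrow> 'a mpoly fps" where
  "shifted_point c w j = fps_const (mpoly_var j) + fps_const c * w j"

lemma shifted_point_closed:
  assumes "c \<in> polys n" "w j \<in> series_over n" "j < n"
  shows "shifted_point c w j \<in> series_over n"
proof -
  interpret U: subring_of "series_over n :: 'a mpoly fps set" by (rule subring_of_series_over)
  show ?thesis unfolding shifted_point_def using assms by auto
qed

text \<open>
  Taylor expansion with \<open>e = c t\<close>, using that \<open>w\<close> is divisible by \<open>t\<close>: the remainder is then
  divisible by \<open>c\<^sup>2 t\<^sup>2\<close>, so that it does not interfere in degree one.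
\<close>

lemma fps_eval_shifted_point:
  assumes p: "p \<in> polys n" and c: "c \<in> polys n"
    and w: "\<And>j. j < n \<Longrightarrow> w j \<in> series_over n" "\<And>j. j < n \<Longrightarrow> fps_nth (w j) 0 = 0"
  shows "fps_nth (fps_eval (shifted_point c w) p) 0 = p"
    and "fps_nth (fps_eval (shifted_point c w) p) 1 = c * (\<Sum>j<n. partial_deriv j p * fps_nth (w j) 1)"
    and "k \<ge> 2 \<Longrightarrow> \<exists>q\<in>polys n. fps_nth (fps_eval (shifted_point c w) p) k =
      c * (\<Sum>j<n. partial_deriv j p * fps_nth (w j) k) + c\<^sup>2 * q"
proof -
  interpret U: subring_of "series_over n :: 'a mpoly fps set" by (rule subring_of_series_over)
  define v where "v j = fps_shift 1 (w j)" for j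
  let ?e = "fps_const c * fps_X ^ 1"
  have eq: "shifted_point c w j = fps_const (mpoly_var j) + ?e * v j" if "j < n" for j
  proof (rule fps_ext)
    fix i show "fps_nth (shifted_point c w j) i = fps_nth (fps_const (mpoly_var j) + ?e * v j) i"
      using w(2)[OF that] by (cases i) (simp_all add: shifted_point_def v_def mult.assoc)
  qed
  have "\<exists>q\<in>series_over n. fps_eval (\<lambda>j. fps_const (mpoly_var j) + ?e * v j) p =
    fps_eval (\<lambda>j. fps_const (mpoly_var j)) p +
      ?e * (\<Sum>j<n. fps_eval (\<lambda>j. fps_const (mpoly_var j)) (partial_deriv j p) * v j) + ?e\<^sup>2 * q"
    using w c by (intro fps_eval_taylor[OF p] U.mult_closed) (auto simp: v_def simp del: power_one_right)
  then obtain q where q: "q \<in> series_over n" "fps_eval (\<lambda>j. fps_const (mpoly_var j) + ?e * v j) p =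
    fps_const p + ?e * (\<Sum>j<n. fps_const (partial_deriv j p) * v j) + ?e\<^sup>2 * q"
    unfolding fps_eval_base[OF p] fps_eval_base[OF partial_deriv_closed[OF p]] by blast
  have "?e\<^sup>2 * q = fps_const (c\<^sup>2) * (fps_X ^ 2 * q)"
    by (simp add: power_mult_distrib fps_const_power mult.assoc)
  then have main: "fps_eval (shifted_point c w) p = fps_const p +
      fps_const c * (fps_X ^ 1 * (\<Sum>j<n. fps_const (partial_deriv j p) * v j)) + fps_const (c\<^sup>2) * (fps_X ^ 2 * q)"
    using fps_eval_cong[OF p eq] q(2) by (simp add: mult.assoc)
  have nth: "fps_nth (fps_eval (shifted_point c w) p) k = (if k = 0 then p else
      c * (\<Sum>j<n. partial_deriv j p * fps_nth (w j) k) + c\<^sup>2 * (if k < 2 then 0 else fps_nth q (k - 2)))" for k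
    unfolding main fps_add_nth fps_mult_left_const_nth fps_X_power_mult_nth
    by (auto simp: fps_sum_nth v_def)
  show "fps_nth (fps_eval (shifted_point c w) p) 0 = p"
    and "fps_nth (fps_eval (shifted_point c w) p) 1 = c * (\<Sum>j<n. partial_deriv j p * fps_nth (w j) 1)"
    by (simp_all add: nth)
  show "\<exists>q\<in>polys n. fps_nth (fps_eval (shifted_point c w) p) k =
      c * (\<Sum>j<n. partial_deriv j p * fps_nth (w j) k) + c\<^sup>2 * q" if "k \<ge> 2"
    using q(1) that by (intro bexI[of _ "fps_nth q (k - 2)"]) (auto simp: nth series_over_def)
qed

section \<open>Lifting a tangent vector to a power series point\<close>

text \<open>
  The analogue of Hensel's lemma in which \<open>c\<close> is not inverted. The multiple \<open>c w\<close> instead of \<open>w\<close>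
  makes the obstruction in each degree from two on divisible by \<open>c\<^sup>2\<close>, and a correction of \<open>w\<close>
  in that degree changes the value by \<open>c J y\<close>, whose values include all multiples of \<open>c\<^sup>2\<close>
  because \<open>J adj(J) = c\<close>.
\<close>

lemma shifted_point_lift:
  fixes f :: "nat \<Rightarrow> 'a::comm_ring_1 mpoly" and a :: "nat \<Rightarrow> 'a mpoly"
  assumes I: "ideal I (subring_record (polys n))"
    and f: "\<And>i. i < r \<Longrightarrow> f i \<in> I"
    and \<beta>: "\<And>i. i < r \<Longrightarrow> \<beta> i < n"
    and a: "\<And>j. j < n \<Longrightarrow> a j \<in> polys n"
    and tangent: "\<And>i. i < r \<Longrightarrow> (\<Sum>j<n. partial_deriv j (f i) * a j) \<in> I"
    and c: "c = det (mat r r (\<lambda>(i, j). partial_deriv (\<beta> j) (f i)))"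
  shows "\<exists>w. (\<forall>j<n. w j \<in> series_over n \<and> fps_nth (w j) 0 = 0 \<and> fps_nth (w j) 1 = a j) \<and>
    (\<forall>i<r. \<forall>k. fps_nth (fps_eval (shifted_point c w) (f i)) k \<in> I)"
proof -
  interpret I: ideal_of "polys n" I by (rule ideal_ofI[OF subring_of_polys I])
  interpret U: subring_of "series_over n :: 'a mpoly fps set" by (rule subring_of_series_over)
  define J where "J = mat r r (\<lambda>(i, j). partial_deriv (\<beta> j) (f i))"
  have J: "J \<in> carrier_mat r r" by (simp add: J_def)
  have fT: "f i \<in> polys n" if "i < r" for i using f[OF that] by (rule I.ideal_subset)
  have JT: "J $$ (i, j) \<in> polys n" if "i < r" "j < r" for i j
    using that fT by (simp add: J_def partial_deriv_closed)
  have cT: "c \<in> polys n" unfolding c J_def[symmetric] by (rule I.det_closed[OF J JT])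
  \<comment> \<open>The solution up to degree \<open>m + 1\<close>, as polynomials in \<open>t\<close>; it starts in degree one with \<open>a t\<close>.\<close>
  define approx where "approx m w \<longleftrightarrow>
    (\<forall>j<n. w j \<in> series_over n \<and> fps_nth (w j) 0 = 0 \<and> fps_nth (w j) 1 = a j \<and> (\<forall>k>Suc m. fps_nth (w j) k = 0)) \<and>
    (\<forall>i<r. \<forall>k\<le>Suc m. fps_nth (fps_eval (shifted_point c w) (f i)) k \<in> I)" for m and w :: "nat \<Rightarrow> 'a mpoly fps"
  have "\<exists>W. \<forall>m. approx m (W m) \<and> (\<forall>j<n. \<forall>k\<le>Suc m. fps_nth (W (Suc m) j) k = fps_nth (W m j) k)"
  proof (rule dependent_nat_choice)
    define w where "w j = fps_const (a j) * fps_X ^ 1" for j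
    have w: "w j \<in> series_over n" "fps_nth (w j) 0 = 0" if "j < n" for j
      using a[OF that] unfolding w_def by (auto intro!: U.mult_closed simp del: power_one_right)
    have w1: "fps_nth (w j) 1 = a j" for j by (simp add: w_def)
    have "fps_nth (fps_eval (shifted_point c w) (f i)) k \<in> I" if "i < r" "k \<le> Suc 0" for i k
    proof -
      have "k = 0 \<or> k = 1" using that by auto
      then show ?thesis
      proof
        assume "k = 0"
        then show ?thesis using fps_eval_shifted_point(1)[OF fT[OF that(1)] cT w] f[OF that(1)] by simp
      next
        assume "k = 1"
        then show ?thesis
          using fps_eval_shifted_point(2)[OF fT[OF that(1)] cT w] I.ideal_mult[OF cT tangent[OF that(1)]]
          unfolding w1 by simp
      qed
    qed
    then show "\<exists>w. approx 0 w" unfolding approx_def using w w1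
      by (intro exI[of _ w]) (auto simp: w_def)
  next
    fix w m assume w: "approx m w"
    have wc: "w j \<in> series_over n" "fps_nth (w j) 0 = 0" if "j < n" for j
      using w that unfolding approx_def by blast+
    let ?k = "Suc (Suc m)"
    have "\<exists>q\<in>polys n. fps_nth (fps_eval (shifted_point c w) (f i)) ?k = c\<^sup>2 * q" if "i < r" for i
    proof -
      have "\<exists>q\<in>polys n. fps_nth (fps_eval (shifted_point c w) (f i)) ?k =
          c * (\<Sum>j<n. partial_deriv j (f i) * fps_nth (w j) ?k) + c\<^sup>2 * q"
        by (rule fps_eval_shifted_point(3)[OF fT[OF that] cT wc]) simp_all
      moreover have "fps_nth (w j) ?k = 0" if "j < n" for j using w that unfolding approx_def by simp
      ultimately show ?thesis by simp
    qed
    then obtain q where q: "\<And>i. i < r \<Longrightarrow> q i \<in> polys n"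
      "\<And>i. i < r \<Longrightarrow> fps_nth (fps_eval (shifted_point c w) (f i)) ?k = c\<^sup>2 * q i" by metis
    define z where "z i = (\<Sum>l<r. adj_mat J $$ (i, l) * q l)" for i
    have zT: "z i \<in> polys n" if "i < r" for i
      unfolding z_def using I.adj_mat_closed[OF J JT that] q(1) by (intro I.sum_closed I.mult_closed) auto
    \<comment> \<open>The vector \<open>- adj(J) q\<close>, placed in the columns \<open>\<beta> 0, \<dots>, \<beta> (r - 1)\<close> from which \<open>J\<close> was taken.\<close>
    define y where "y j = (\<Sum>i<r. if \<beta> i = j then - z i else 0)" for j
    have yT: "y j \<in> polys n" for j unfolding y_def using zT by (intro I.sum_closed) auto
    define w' where "w' j = w j + fps_const (y j) * fps_X ^ ?k" for j
    have w'nth: "fps_nth (w' j) k = fps_nth (w j) k + (if k = ?k then y j else 0)" for j k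
      by (simp add: w'_def fps_X_power_nth del: power_Suc)
    have w'c: "w' j \<in> series_over n" if "j < n" for j
      unfolding w'_def using wc that yT by (intro U.add_closed U.mult_closed) (auto simp del: power_Suc)
    have pt: "shifted_point c w' j = shifted_point c w j + fps_X ^ ?k * fps_const (c * y j)" for j
    proof -
      have "fps_const (c * y j) = fps_const c * fps_const (y j)" by simp
      then show ?thesis unfolding shifted_point_def w'_def by (simp only: distrib_left mult_ac add_ac)
    qed
    have low: "fps_nth (fps_eval (shifted_point c w') (f i)) k \<in> I" if "i < r" "k \<le> Suc m" for i k
    proof -
      have "fps_nth (fps_eval (shifted_point c w') (f i)) k = fps_nth (fps_eval (shifted_point c w) (f i)) k"
        using that wc w'c cT
        by (intro fps_eval_nth_cong[OF fT[OF that(1)]] shifted_point_closed) (auto simp: shifted_point_def w'nth)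
      then show ?thesis using w that unfolding approx_def by simp
    qed
    have top: "fps_nth (fps_eval (shifted_point c w') (f i)) ?k = 0" if i: "i < r" for i
    proof -
      have "fps_nth (fps_eval (shifted_point c w') (f i)) ?k =
        fps_nth (fps_eval (shifted_point c w) (f i)) ?k + (\<Sum>j<n. partial_deriv j (f i) * (c * y j))"
        unfolding pt using wc cT yT
        by (intro fps_eval_perturb_nth[OF fT[OF i]] shifted_point_closed I.mult_closed)
           (auto simp: shifted_point_def)
      also have "(\<Sum>j<n. partial_deriv j (f i) * (c * y j)) =
          (\<Sum>j<n. \<Sum>l<r. if j = \<beta> l then - (c * (partial_deriv j (f i) * z l)) else 0)"
        unfolding y_def sum_distrib_left by (intro sum.cong) (auto simp: mult_ac)
      also have "\<dots> = (\<Sum>l<r. \<Sum>j<n. if j = \<beta> l then - (c * (partial_deriv j (f i) * z l)) else 0)"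
        by (rule sum.swap)
      also have "\<dots> = (\<Sum>l<r. - (c * (J $$ (i, l) * z l)))"
        using \<beta> i by (intro sum.cong) (auto simp: J_def)
      also have "\<dots> = - (c * (\<Sum>l<r. J $$ (i, l) * z l))"
        by (simp add: sum_negf sum_distrib_left)
      also have "(\<Sum>l<r. J $$ (i, l) * z l) = (\<Sum>l<r. \<Sum>k<r. J $$ (i, l) * adj_mat J $$ (l, k) * q k)"
        unfolding z_def by (simp add: sum_distrib_left mult.assoc)
      also have "\<dots> = (\<Sum>k<r. (\<Sum>l<r. J $$ (i, l) * adj_mat J $$ (l, k)) * q k)"
        by (subst sum.swap) (simp add: sum_distrib_right)
      also have "\<dots> = (\<Sum>k<r. if i = k then c * q k else 0)"
      proof (intro sum.cong refl)
        fix k assume k: "k \<in> {..<r}"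
        have "(J * adj_mat J) $$ (i, k) = (\<Sum>l<r. J $$ (i, l) * adj_mat J $$ (l, k))"
          using i k J adj_mat(1)[OF J] by (auto simp: scalar_prod_def atLeast0LessThan)
        then have "(\<Sum>l<r. J $$ (i, l) * adj_mat J $$ (l, k)) = (if i = k then c else 0)"
          using i k unfolding adj_mat(2)[OF J] by (simp add: c J_def[symmetric] split: if_splits)
        then show "(\<Sum>l<r. J $$ (i, l) * adj_mat J $$ (l, k)) * q k = (if i = k then c * q k else 0)" by simp
      qed
      also have "\<dots> = c * q i" using i by simp
      finally show ?thesis using q(2)[OF i] by (simp add: power2_eq_square mult.assoc)
    qed
    have "approx (Suc m) w'"
      unfolding approx_def
    proof (intro conjI allI impI)
      fix j assume "j < n"
      then show "w' j \<in> series_over n" "fps_nth (w' j) 0 = 0" "fps_nth (w' j) 1 = a j"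
        "\<And>k. k > Suc (Suc m) \<Longrightarrow> fps_nth (w' j) k = 0"
        using w w'c by (auto simp: w'nth approx_def)
    next
      fix i k assume "i < r" "k \<le> Suc (Suc m)"
      then show "fps_nth (fps_eval (shifted_point c w') (f i)) k \<in> I"
        using low top by (cases "k = ?k") auto
    qed
    then show "\<exists>w'. approx (Suc m) w' \<and> (\<forall>j<n. \<forall>k\<le>Suc m. fps_nth (w' j) k = fps_nth (w j) k)"
      by (intro exI[of _ w']) (auto simp: w'nth)
  qed
  then obtain W where W: "\<And>m. approx m (W m)"
    "\<And>m j k. j < n \<Longrightarrow> k \<le> Suc m \<Longrightarrow> fps_nth (W (Suc m) j) k = fps_nth (W m j) k" by blast
  have stable: "fps_nth (W m j) i = fps_nth (W i j) i" if "j < n" "i \<le> m" for i m j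
    using that(2) by (induction m rule: dec_induct) (use W(2) that(1) in auto)
  \<comment> \<open>The coefficient of degree \<open>k\<close> is final from the \<open>k\<close>-th approximation on.\<close>
  define w where "w j = Abs_fps (\<lambda>k. fps_nth (W k j) k)" for j
  have WU: "W m j \<in> series_over n" if "j < n" for m j using W(1)[of m] that unfolding approx_def by blast
  have wU: "w j \<in> series_over n" if "j < n" for j
    using WU[OF that] unfolding w_def series_over_def by simp
  have "fps_nth (w j) 0 = 0" "fps_nth (w j) 1 = a j" if "j < n" for j
    using W(1)[of 0] W(1)[of 1] that by (auto simp: w_def approx_def)
  moreover have "fps_nth (fps_eval (shifted_point c w) (f i)) k \<in> I" if "i < r" for i k
  proof -
    have "fps_nth (fps_eval (shifted_point c w) (f i)) k = fps_nth (fps_eval (shifted_point c (W k)) (f i)) k"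
    proof (rule fps_eval_nth_cong[OF fT[OF that]])
      fix j l assume "j < n" "l \<le> k"
      then show "fps_nth (shifted_point c w j) l = fps_nth (shifted_point c (W k) j) l"
        using stable[of j l k] by (simp add: shifted_point_def w_def)
    qed (rule shifted_point_closed[OF cT]; use wU WU in simp)+
    then show ?thesis using W(1)[of k] that unfolding approx_def by simp
  qed
  ultimately show ?thesis using wU by blast
qed

text \<open>
  Modulo \<open>c\<close> the point \<open>x + c w\<close> is \<open>x\<close>, so every coefficient of the value except the constant
  one is a multiple of \<open>c\<close>.
\<close>

lemma shifted_point_preserves_ideal:
  assumes I: "ideal I (subring_record (polys n))" and c: "c \<in> I" and g: "g \<in> I"
    and w: "\<And>j. j < n \<Longrightarrow> w j \<in> series_over n" "\<And>j. j < n \<Longrightarrow> fps_nth (w j) 0 = 0"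
  shows "fps_nth (fps_eval (shifted_point c w) g) k \<in> I"
proof -
  interpret I: ideal_of "polys n" I by (rule ideal_ofI[OF subring_of_polys I])
  have gT: "g \<in> polys n" and cT: "c \<in> polys n" using g c I.ideal_subset by blast+
  have S: "c * (\<Sum>j<n. partial_deriv j g * fps_nth (w j) k) \<in> I" for k
    using w gT by (intro I.ideal_mult_right[OF _ c] I.sum_closed I.mult_closed partial_deriv_closed)
      (auto simp: series_over_def)
  consider "k = 0" | "k = 1" | "k \<ge> 2" by linarith
  then show ?thesis
  proof cases
    case 1
    then show ?thesis using fps_eval_shifted_point(1)[OF gT cT w] g by simp
  next
    case 2
    then show ?thesis using fps_eval_shifted_point(2)[OF gT cT w] S[of 1] by simp
  next
    case 3
    have "\<exists>q\<in>polys n. fps_nth (fps_eval (shifted_point c w) g) k =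
        c * (\<Sum>j<n. partial_deriv j g * fps_nth (w j) k) + c\<^sup>2 * q"
      by (rule fps_eval_shifted_point(3)[OF gT cT w 3])
    then obtain q where q: "q \<in> polys n" "fps_nth (fps_eval (shifted_point c w) g) k =
        c * (\<Sum>j<n. partial_deriv j g * fps_nth (w j) k) + c\<^sup>2 * q" by blast
    have "c\<^sup>2 * q \<in> I"
      unfolding power2_eq_square mult.assoc using c cT q(1) by (intro I.ideal_mult_right) auto
    then show ?thesis unfolding q(2) using S by (intro I.ideal_add)
  qed
qed

text \<open>
  It suffices that the coefficients lie in every minimal prime \<open>P\<close> of \<open>I\<close>. If \<open>c \<in> P\<close>,
  \<open>shifted_point_preserves_ideal\<close> applies to \<open>P\<close>. Otherwise \<open>f\<close> generates \<open>P\<close> locally, and a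
  relation \<open>s g = \<Sum> e\<^sub>i f\<^sub>i\<close> with \<open>s \<notin> P\<close> carries the information from \<open>f\<close> to \<open>g\<close>: the value of
  \<open>s\<close> has constant term \<open>s\<close>, so it can be cancelled modulo \<open>P\<close> degree by degree.
\<close>

lemma shifted_point_preserves_radical_ideal:
  fixes I :: "'a::comm_ring_1 mpoly set" and f :: "nat \<Rightarrow> 'a mpoly"
  assumes reg: "regular_ring (coeff_ring :: 'a ring)"
    and I: "radical_ideal I (mpoly_ring n)"
    and ht: "\<forall>P\<in>min_primes (mpoly_ring n) I. height (mpoly_ring n) P \<le> enat r"
    and f: "\<And>i. i < r \<Longrightarrow> f i \<in> I"
    and c: "c = det (mat r r (\<lambda>(i, j). partial_deriv (\<beta> j) (f i)))"
    and w: "\<And>j. j < n \<Longrightarrow> w j \<in> series_over n" "\<And>j. j < n \<Longrightarrow> fps_nth (w j) 0 = 0"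
    and fw: "\<And>i k. i < r \<Longrightarrow> fps_nth (fps_eval (shifted_point c w) (f i)) k \<in> I"
    and g: "g \<in> I"
  shows "fps_nth (fps_eval (shifted_point c w) g) k \<in> I"
proof -
  interpret T: subring_of "polys n :: 'a mpoly set" by (rule subring_of_polys)
  interpret U: subring_of "series_over n :: 'a mpoly fps set" by (rule subring_of_series_over)
  have "ideal I (subring_record (polys n))" using I by (simp add: radical_ideal_def mpoly_ring_eq)
  then interpret I: ideal_of "polys n" I by (rule ideal_ofI[OF subring_of_polys])
  have fT: "f i \<in> polys n" if "i < r" for i using f[OF that] by (rule I.ideal_subset)
  have cT: "c \<in> polys n" unfolding c
    by (rule T.det_closed[of _ r]) (auto intro: partial_deriv_closed fT)
  have ev: "fps_eval (shifted_point c w) p \<in> series_over n" if "p \<in> polys n" for p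
    using that by (rule fps_eval_closed) (rule shifted_point_closed[OF cT w(1)])
  then have evT: "fps_nth (fps_eval (shifted_point c w) p) k \<in> polys n" if "p \<in> polys n" for p k
    using that by (auto simp: series_over_def)
  have ev0: "fps_nth (fps_eval (shifted_point c w) p) 0 = p" if "p \<in> polys n" for p
    by (rule fps_eval_shifted_point(1)[OF that cT w])
  have gT: "g \<in> polys n" using g by (rule I.ideal_subset)
  have "fps_nth (fps_eval (shifted_point c w) g) k \<in> P" if PI: "P \<in> min_primes (mpoly_ring n) I" for P
  proof -
    have P: "primeideal P (subring_record (polys n))" and IP: "I \<subseteq> P"
      using PI by (auto simp: min_primes_def mpoly_ring_eq)
    interpret P: prime_of "polys n" P
      using P by (simp add: prime_of_def prime_of_axioms_def subring_of_polys)
    show ?thesis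
    proof (cases "c \<in> P")
      case True
      have "g \<in> P" using g IP by blast
      then show ?thesis by (rule shifted_point_preserves_ideal[OF P.is_ideal_of True _ w])
    next
      case False
      obtain h C d where h: "prime_chain (subring_record (polys n)) C h" "C h = P"
        "\<And>i. i < h \<Longrightarrow> d i \<in> P" "P \<subseteq> saturation (polys n) P d h"
        using generated_by_height_polys[OF reg P] unfolding generated_by_height_def by blast
      have "enat h \<le> height (mpoly_ring n) P"
        unfolding height_def mpoly_ring_eq using h(1,2) by (intro Sup_upper) blast
      then have "enat h \<le> enat r" using ht PI order_trans by blast
      then have "h \<le> r" by simp
      have "P \<subseteq> saturation (polys n) P f r"
        using f IP False unfolding c
        by (intro saturation_of_jacobian_det_notin[OF P _ _ h(3,4) \<open>h \<le> r\<close>]) auto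
      then have "g \<in> saturation (polys n) P f r" using g IP by blast
      then obtain s e where s: "s \<in> polys n - P" "\<And>i. i < r \<Longrightarrow> e i \<in> polys n"
        "s * g = (\<Sum>i<r. e i * f i)" unfolding saturation_def by blast
      let ?s = "fps_eval (shifted_point c w) s" and ?g = "fps_eval (shifted_point c w) g"
      have prod: "fps_nth (?s * ?g) m \<in> P" for m
      proof -
        have "?s * ?g = fps_eval (shifted_point c w) (s * g)" by simp
        also have "\<dots> = (\<Sum>i<r. fps_eval (shifted_point c w) (e i) * fps_eval (shifted_point c w) (f i))"
          unfolding s(3) by simp
        finally show ?thesis
          using fw IP evT s(2)
          by (auto simp: fps_sum_nth fps_mult_nth intro!: P.ideal_sum P.ideal_mult)
      qed
      show ?thesis
      proof (induction k rule: less_induct)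
        case (less m)
        have "fps_nth (?s * ?g) m = (\<Sum>i=0..m. fps_nth ?s i * fps_nth ?g (m - i))" by (rule fps_mult_nth)
        also have "\<dots> = s * fps_nth ?g m + (\<Sum>i\<in>{0..m} - {0}. fps_nth ?s i * fps_nth ?g (m - i))"
          using ev0 s(1) by (subst sum.remove[of _ 0]) auto
        finally have "s * fps_nth ?g m = fps_nth (?s * ?g) m - (\<Sum>i\<in>{0..m} - {0}. fps_nth ?s i * fps_nth ?g (m - i))"
          by simp
        also have "\<dots> \<in> P"
          using evT s(1) less by (intro P.ideal_diff prod P.ideal_sum P.ideal_mult) auto
        finally show ?case using P.prime_mult s(1) evT[OF gT] by blast
      qed
    qed
  qed
  then show ?thesis
    using radical_ideal_min_primes[of "mpoly_ring n" I] I evT[OF gT] T.is_cring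
    by (auto simp: mpoly_ring_eq)
qed

section \<open>Derivations and Hasse-Schmidt derivations of a polynomial ring\<close>

lemma alg_linear_polys_iff:
  "alg_linear coeff_ring (mpoly_ring n) mpoly_const d \<longleftrightarrow>
    (\<forall>x\<in>polys n. d x \<in> polys n) \<and> (\<forall>x\<in>polys n. \<forall>y\<in>polys n. d (x + y) = d x + d y) \<and>
    (\<forall>c. \<forall>x\<in>polys n. d (mpoly_const c * x) = mpoly_const c * d x)"
  by (auto simp: alg_linear_def mpoly_ring_eq coeff_ring_eq Pi_iff)

lemma Der_polys_iff:
  "d \<in> Der coeff_ring (mpoly_ring n) mpoly_const \<longleftrightarrow>
    alg_linear coeff_ring (mpoly_ring n) mpoly_const d \<and>
    (\<forall>x\<in>polys n. \<forall>y\<in>polys n. d (x * y) = x * d y + y * d x)"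
  by (simp add: Der_def mpoly_ring_eq)

lemma HS_polys_iff:
  "D \<in> HS coeff_ring (mpoly_ring n) mpoly_const \<longleftrightarrow>
    (\<forall>\<alpha>. alg_linear coeff_ring (mpoly_ring n) mpoly_const (D \<alpha>)) \<and> (\<forall>x\<in>polys n. D 0 x = x) \<and>
    (\<forall>\<alpha>. \<forall>x\<in>polys n. \<forall>y\<in>polys n. D \<alpha> (x * y) = (\<Sum>i\<le>\<alpha>. D i x * D (\<alpha> - i) y))"
proof -
  interpret T: subring_of "polys n :: 'a mpoly set" by (rule subring_of_polys)
  have "finsum (mpoly_ring n) (\<lambda>i. D i x * D (\<alpha> - i) y) {..\<alpha>} = (\<Sum>i\<le>\<alpha>. D i x * D (\<alpha> - i) y)"
    if "\<forall>\<alpha>. alg_linear coeff_ring (mpoly_ring n) mpoly_const (D \<alpha>)" "x \<in> polys n" "y \<in> polys n" for \<alpha> x y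
    unfolding mpoly_ring_eq using that by (intro T.finsum_eq) (auto simp: alg_linear_polys_iff)
  then show ?thesis by (auto simp: HS_def mpoly_ring_eq)
qed

lemma IDer_log_polys_iff:
  "d \<in> IDer_log coeff_ring (mpoly_ring n) mpoly_const I \<longleftrightarrow>
    d \<in> Der coeff_ring (mpoly_ring n) mpoly_const \<and>
    (\<exists>D\<in>HS coeff_ring (mpoly_ring n) mpoly_const.
      (\<forall>x\<in>polys n. D 1 x = d x) \<and> (\<forall>\<alpha>. \<forall>x\<in>I. D \<alpha> x \<in> I))"
  by (simp add: IDer_log_def mpoly_ring_eq image_subset_iff)

lemma IDer_log_polysI:
  assumes "d \<in> Der coeff_ring (mpoly_ring n) mpoly_const" "D \<in> HS coeff_ring (mpoly_ring n) mpoly_const"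
    and "\<And>x. x \<in> polys n \<Longrightarrow> D 1 x = d x" "\<And>\<alpha> x. x \<in> I \<Longrightarrow> D \<alpha> x \<in> I"
  shows "d \<in> IDer_log coeff_ring (mpoly_ring n) mpoly_const I"
  unfolding IDer_log_polys_iff using assms by blast

text \<open>
  Multiplicativity of the evaluation homomorphism, read off coefficientwise, is the Leibniz rule
  of a Hasse-Schmidt derivation.
\<close>

lemma HS_fps_eval:
  assumes "\<And>j. j < n \<Longrightarrow> u j \<in> series_over n" "\<And>j. j < n \<Longrightarrow> fps_nth (u j) 0 = mpoly_var j"
  shows "(\<lambda>\<alpha> p. fps_nth (fps_eval u p) \<alpha>) \<in> HS coeff_ring (mpoly_ring n) mpoly_const"
  unfolding HS_polys_iff alg_linear_polys_iff
  using fps_eval_closed[of _ n u] assms fps_eval_nth_0[of _ n u]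
  by (auto simp: series_over_def fps_mult_nth[of "fps_eval u _"] atMost_atLeast0)

text \<open>
  Stated modulo an ideal, the formula serves for derivations of the polynomial ring (zero ideal)
  and also for maps that represent a derivation of the quotient by \<open>I\<close>.
\<close>

lemma Der_polys_formula_mod:
  assumes I: "ideal I (subring_record (polys n))"
    and closed: "\<And>x. x \<in> polys n \<Longrightarrow> d x \<in> polys n"
    and const: "\<And>c. d (mpoly_const c) \<in> I"
    and add: "\<And>x y. x \<in> polys n \<Longrightarrow> y \<in> polys n \<Longrightarrow> d (x + y) - (d x + d y) \<in> I"
    and mult: "\<And>x y. x \<in> polys n \<Longrightarrow> y \<in> polys n \<Longrightarrow> d (x * y) - (x * d y + y * d x) \<in> I"
    and p: "p \<in> polys n"
  shows "d p - (\<Sum>j<n. partial_deriv j p * d (mpoly_var j)) \<in> I"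
proof -
  interpret I: ideal_of "polys n" I by (rule ideal_ofI[OF subring_of_polys I])
  let ?S = "\<lambda>p. \<Sum>j<n. partial_deriv j p * d (mpoly_var j)"
  show ?thesis using p
  proof (induction p rule: polys_induct)
    case (const c)
    then show ?case using assms(3) by simp
  next
    case (var i)
    have "?S (mpoly_var i) = (\<Sum>j<n. if j = i then d (mpoly_var j) else 0)"
      by (intro sum.cong) auto
    then show ?case using var by simp
  next
    case (add p q)
    have "d (p + q) - ?S (p + q) = (d (p + q) - (d p + d q)) + ((d p - ?S p) + (d q - ?S q))"
      by (simp add: partial_deriv_add distrib_right sum.distrib)
    also have "\<dots> \<in> I" using add assms(4) by (intro I.ideal_add) auto
    finally show ?case .
  next
    case (mult p q)
    have "?S (p * q) = p * ?S q + q * ?S p"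
      by (simp add: partial_deriv_mult distrib_right sum.distrib sum_distrib_left mult.assoc)
    then have "d (p * q) - ?S (p * q) =
        (d (p * q) - (p * d q + q * d p)) + (p * (d q - ?S q) + q * (d p - ?S p))"
      by (simp add: algebra_simps)
    also have "\<dots> \<in> I" using mult assms(5) by (intro I.ideal_add I.ideal_mult) auto
    finally show ?case .
  qed
qed

lemma Der_polys_const:
  assumes "d \<in> Der coeff_ring (mpoly_ring n) mpoly_const"
  shows "d (mpoly_const c) = 0"
proof -
  have 1: "1 \<in> polys n" by (rule subring_of.one_closed[OF subring_of_polys])
  have "d (1 * 1) = 1 * d 1 + 1 * d 1" using assms 1 unfolding Der_polys_iff by blast
  then have "d 1 = 0" by simp
  moreover have "d (mpoly_const c * 1) = mpoly_const c * d 1"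
    using assms 1 unfolding Der_polys_iff alg_linear_polys_iff by blast
  ultimately show ?thesis by simp
qed

lemma Der_polys_formula:
  assumes "d \<in> Der coeff_ring (mpoly_ring n) mpoly_const" "p \<in> polys n"
  shows "d p = (\<Sum>j<n. partial_deriv j p * d (mpoly_var j))"
proof -
  interpret T: subring_of "polys n :: 'a mpoly set" by (rule subring_of_polys)
  have "d p - (\<Sum>j<n. partial_deriv j p * d (mpoly_var j)) \<in> {0}"
    using assms Der_polys_const[OF assms(1)]
    by (intro Der_polys_formula_mod) (auto simp: Der_polys_iff alg_linear_polys_iff T.ideal_iff)
  then show ?thesis by simp
qed

lemma IDer_log_of_shifted_point:
  assumes d: "d \<in> Der coeff_ring (mpoly_ring n) mpoly_const" and c: "c \<in> polys n"
    and w: "\<And>j. j < n \<Longrightarrow> w j \<in> series_over n" "\<And>j. j < n \<Longrightarrow> fps_nth (w j) 0 = 0"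
    and w1: "\<And>j. j < n \<Longrightarrow> fps_nth (w j) 1 = d (mpoly_var j)"
    and I: "\<And>g k. g \<in> I \<Longrightarrow> fps_nth (fps_eval (shifted_point c w) g) k \<in> I"
  shows "(\<lambda>x. c * d x) \<in> IDer_log coeff_ring (mpoly_ring n) mpoly_const I"
proof -
  interpret T: subring_of "polys n :: 'a mpoly set" by (rule subring_of_polys)
  let ?D = "\<lambda>\<alpha> p. fps_nth (fps_eval (shifted_point c w) p) \<alpha>"
  have "(\<lambda>x. c * d x) \<in> Der coeff_ring (mpoly_ring n) mpoly_const"
    using d c by (auto simp: Der_polys_iff alg_linear_polys_iff algebra_simps)
  moreover have "?D \<in> HS coeff_ring (mpoly_ring n) mpoly_const"
    using shifted_point_closed[OF c w(1)] w(2) by (intro HS_fps_eval) (auto simp: shifted_point_def)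
  moreover have "?D 1 x = c * d x" if "x \<in> polys n" for x
    using fps_eval_shifted_point(2)[OF that c w] Der_polys_formula[OF d that] w1 by simp
  ultimately show ?thesis
    by (rule IDer_log_polysI) (assumption | rule I)+
qed

lemma IDer_log_jacobian_det:
  fixes I :: "'a::comm_ring_1 mpoly set" and f :: "nat \<Rightarrow> 'a mpoly"
  assumes reg: "regular_ring (coeff_ring :: 'a ring)"
    and I: "radical_ideal I (mpoly_ring n)"
    and ht: "\<forall>P\<in>min_primes (mpoly_ring n) I. height (mpoly_ring n) P \<le> enat r"
    and f: "\<And>i. i < r \<Longrightarrow> f i \<in> I" and \<beta>: "\<And>i. i < r \<Longrightarrow> \<beta> i < n"
    and d: "d \<in> Der_log coeff_ring (mpoly_ring n) mpoly_const I"
  shows "(\<lambda>x. det (mat r r (\<lambda>(i, j). partial_deriv (\<beta> j) (f i))) * d x)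
    \<in> IDer_log coeff_ring (mpoly_ring n) mpoly_const I"
proof -
  interpret T: subring_of "polys n :: 'a mpoly set" by (rule subring_of_polys)
  define c where "c = det (mat r r (\<lambda>(i, j). partial_deriv (\<beta> j) (f i)))"
  have II: "ideal I (subring_record (polys n))" using I by (simp add: radical_ideal_def mpoly_ring_eq)
  then interpret I: ideal_of "polys n" I by (rule ideal_ofI[OF subring_of_polys])
  have fT: "f i \<in> polys n" if "i < r" for i using f[OF that] by (rule I.ideal_subset)
  have cT: "c \<in> polys n" unfolding c_def
    by (rule T.det_closed[of _ r]) (auto intro: partial_deriv_closed fT)
  have dD: "d \<in> Der coeff_ring (mpoly_ring n) mpoly_const" and dI: "\<And>x. x \<in> I \<Longrightarrow> d x \<in> I"
    using d by (auto simp: Der_log_def)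
  have dT: "d (mpoly_var j) \<in> polys n" if "j < n" for j
    using dD that by (simp add: Der_polys_iff alg_linear_polys_iff)
  have "(\<Sum>j<n. partial_deriv j (f i) * d (mpoly_var j)) \<in> I" if "i < r" for i
    using Der_polys_formula[OF dD fT[OF that]] dI[OF f[OF that]] by simp
  from shifted_point_lift[OF II f \<beta> dT this c_def]
  obtain w where w: "\<And>j. j < n \<Longrightarrow> w j \<in> series_over n" "\<And>j. j < n \<Longrightarrow> fps_nth (w j) 0 = 0"
    "\<And>j. j < n \<Longrightarrow> fps_nth (w j) 1 = d (mpoly_var j)"
    "\<And>i k. i < r \<Longrightarrow> fps_nth (fps_eval (shifted_point c w) (f i)) k \<in> I" by blast
  show ?thesis unfolding c_def[symmetric]
    using shifted_point_preserves_radical_ideal[OF reg I ht f c_def w(1,2,4)]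
    by (intro IDer_log_of_shifted_point[OF dD cT w(1,2,3)]) auto
qed

lemma IDer_log_ideal_element:
  assumes I: "ideal I (mpoly_ring n)" and c: "c \<in> I"
    and d: "d \<in> Der_log coeff_ring (mpoly_ring n) mpoly_const I"
  shows "(\<lambda>x. c * d x) \<in> IDer_log coeff_ring (mpoly_ring n) mpoly_const I"
proof -
  interpret I: ideal_of "polys n" I by (rule ideal_ofI[OF subring_of_polys]) (use I in \<open>simp add: mpoly_ring_eq\<close>)
  interpret U: subring_of "series_over n :: 'a mpoly fps set" by (rule subring_of_series_over)
  define w where "w j = fps_const (d (mpoly_var j)) * fps_X" for j
  have dD: "d \<in> Der coeff_ring (mpoly_ring n) mpoly_const" using d by (simp add: Der_log_def)
  have dT: "d (mpoly_var j) \<in> polys n" if "j < n" for j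
    using dD that by (simp add: Der_polys_iff alg_linear_polys_iff)
  have cT: "c \<in> polys n" using c by (rule I.ideal_subset)
  have w: "w j \<in> series_over n" "fps_nth (w j) 0 = 0" if "j < n" for j
    using dT[OF that] by (auto simp: w_def)
  have w1: "fps_nth (w j) 1 = d (mpoly_var j)" for j by (simp add: w_def)
  show ?thesis
    using shifted_point_preserves_ideal[OF I.is_ideal_of c _ w]
    by (intro IDer_log_of_shifted_point[OF dD cT w w1])
qed

text \<open>
  In terms of homomorphisms to power series, this is \<open>D\<close> extended to power series by \<open>D t = t\<close>,
  after \<open>E\<close>.
\<close>

lemma HS_polys_compose:
  assumes D: "D \<in> HS coeff_ring (mpoly_ring n) mpoly_const"
    and E: "E \<in> HS coeff_ring (mpoly_ring n) mpoly_const"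
  shows "(\<lambda>\<alpha> x. \<Sum>i\<le>\<alpha>. D i (E (\<alpha> - i) x)) \<in> HS coeff_ring (mpoly_ring n) mpoly_const"
proof -
  interpret T: subring_of "polys n :: 'a mpoly set" by (rule subring_of_polys)
  have closed: "D \<alpha> x \<in> polys n" "E \<alpha> x \<in> polys n" if "x \<in> polys n" for \<alpha> x
    using D E that unfolding HS_polys_iff alg_linear_polys_iff by blast+
  have add: "D \<alpha> (x + y) = D \<alpha> x + D \<alpha> y" "E \<alpha> (x + y) = E \<alpha> x + E \<alpha> y"
    if "x \<in> polys n" "y \<in> polys n" for \<alpha> x y
    using D E that unfolding HS_polys_iff alg_linear_polys_iff by blast+
  have const: "D \<alpha> (mpoly_const c * x) = mpoly_const c * D \<alpha> x" "E \<alpha> (mpoly_const c * x) = mpoly_const c * E \<alpha> x"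
    if "x \<in> polys n" for \<alpha> x c
    using D E that unfolding HS_polys_iff alg_linear_polys_iff by blast+
  have mult: "D \<alpha> (x * y) = (\<Sum>i\<le>\<alpha>. D i x * D (\<alpha> - i) y)" "E \<alpha> (x * y) = (\<Sum>i\<le>\<alpha>. E i x * E (\<alpha> - i) y)"
    if "x \<in> polys n" "y \<in> polys n" for \<alpha> x y
    using D E that unfolding HS_polys_iff by blast+
  have zero: "D 0 x = x" "E 0 x = x" if "x \<in> polys n" for x
    using D E that unfolding HS_polys_iff by blast+
  have D0: "D \<alpha> 0 = 0" for \<alpha> using add(1)[of 0 0 \<alpha>] by simp
  have sum: "D \<alpha> (sum f A) = (\<Sum>i\<in>A. D \<alpha> (f i))" if "finite A" "\<And>i. i \<in> A \<Longrightarrow> f i \<in> polys n" for \<alpha> A and f :: "nat \<Rightarrow> 'a mpoly"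
    using that by (induction A) (simp_all add: D0 add)
  have "(\<Sum>i\<le>\<alpha>. D i (E (\<alpha> - i) (x * y))) =
      (\<Sum>i\<le>\<alpha>. (\<Sum>j\<le>i. D j (E (i - j) x)) * (\<Sum>j\<le>\<alpha> - i. D j (E (\<alpha> - i - j) y)))"
    if xy: "x \<in> polys n" "y \<in> polys n" for \<alpha> x y
  proof -
    have "(\<Sum>i\<le>\<alpha>. D i (E (\<alpha> - i) (x * y))) =
      (\<Sum>i\<le>\<alpha>. \<Sum>a\<le>\<alpha> - i. \<Sum>b\<le>i. D b (E a x) * D (i - b) (E (\<alpha> - i - a) y))"
      using xy closed by (simp add: mult sum)
    also have "\<dots> = (\<Sum>(i, a, b)\<in>(SIGMA i:{..\<alpha>}. {..\<alpha> - i} \<times> {..i}). D b (E a x) * D (i - b) (E (\<alpha> - i - a) y))"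
      by (simp add: sum.Sigma sum.cartesian_product split_def)
    also have "\<dots> = (\<Sum>(i, b, e)\<in>(SIGMA i:{..\<alpha>}. {..i} \<times> {..\<alpha> - i}). D b (E (i - b) x) * D e (E (\<alpha> - i - e) y))"
      \<comment> \<open>The summation indices change from the orders \<open>(i, a, b)\<close> to \<open>(a + b, b, i - b)\<close>: the total order that acts on \<open>x\<close> comes first.\<close>
      by (rule sum.reindex_bij_witness[of _ "\<lambda>(i, b, e). (b + e, i - b, b)" "\<lambda>(i, a, b). (a + b, b, i - b)"])
         (auto simp: algebra_simps)
    also have "\<dots> = (\<Sum>i\<le>\<alpha>. \<Sum>b\<le>i. \<Sum>e\<le>\<alpha> - i. D b (E (i - b) x) * D e (E (\<alpha> - i - e) y))"
      by (simp add: sum.Sigma sum.cartesian_product split_def)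
    finally show ?thesis by (simp add: sum_product)
  qed
  then show ?thesis
    unfolding HS_polys_iff alg_linear_polys_iff
    using closed by (auto simp: add const zero sum.distrib sum_distrib_left)
qed

lemma IDer_log_add:
  assumes I: "ideal I (mpoly_ring n)"
    and d: "d \<in> IDer_log coeff_ring (mpoly_ring n) mpoly_const I"
    and e: "e \<in> IDer_log coeff_ring (mpoly_ring n) mpoly_const I"
  shows "(\<lambda>x. d x + e x) \<in> IDer_log coeff_ring (mpoly_ring n) mpoly_const I"
proof -
  interpret I: ideal_of "polys n" I by (rule ideal_ofI[OF subring_of_polys]) (use I in \<open>simp add: mpoly_ring_eq\<close>)
  obtain D where D: "D \<in> HS coeff_ring (mpoly_ring n) mpoly_const"
    "\<And>x. x \<in> polys n \<Longrightarrow> D 1 x = d x" "\<And>\<alpha> x. x \<in> I \<Longrightarrow> D \<alpha> x \<in> I"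
    using d unfolding IDer_log_polys_iff by blast
  obtain E where E: "E \<in> HS coeff_ring (mpoly_ring n) mpoly_const"
    "\<And>x. x \<in> polys n \<Longrightarrow> E 1 x = e x" "\<And>\<alpha> x. x \<in> I \<Longrightarrow> E \<alpha> x \<in> I"
    using e unfolding IDer_log_polys_iff by blast
  let ?F = "\<lambda>\<alpha> x. \<Sum>i\<le>\<alpha>. D i (E (\<alpha> - i) x)"
  have de: "d \<in> Der coeff_ring (mpoly_ring n) mpoly_const" "e \<in> Der coeff_ring (mpoly_ring n) mpoly_const"
    using d e by (simp_all add: IDer_log_def)
  then have "(\<lambda>x. d x + e x) \<in> Der coeff_ring (mpoly_ring n) mpoly_const"
    by (auto simp: Der_polys_iff alg_linear_polys_iff algebra_simps)
  moreover have "?F 1 x = d x + e x" if "x \<in> polys n" for x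
  proof -
    have "e x \<in> polys n" using de(2) that by (simp add: Der_polys_iff alg_linear_polys_iff)
    then have "D 0 (e x) = e x" "E 0 x = x"
      using D(1) E(1) that unfolding HS_polys_iff by blast+
    then show ?thesis using D(2) E(2) that by (simp add: atMost_Suc)
  qed
  moreover have "?F \<alpha> x \<in> I" if "x \<in> I" for \<alpha> x
    using that D(3) E(3) by (intro I.ideal_sum) auto
  ultimately show ?thesis
    by (intro IDer_log_polysI[OF _ HS_polys_compose[OF D(1) E(1)]])
qed

section \<open>The ideal of integrating multipliers\<close>

lemma minors_jacobian_det:
  assumes "m \<in> minors r (jacobian_mat n fs)"
  shows "\<exists>f \<beta>. (\<forall>i<r. f i \<in> set fs) \<and> (\<forall>j<r. \<beta> j < n) \<and>
    m = det (mat r r (\<lambda>(i, j). partial_deriv (\<beta> j) (f i)))"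
proof -
  obtain U V where UV: "U \<subseteq> {..<length fs}" "V \<subseteq> {..<n}" "card U = r" "card V = r"
    "m = det (submatrix (jacobian_mat n fs) U V)"
    using assms unfolding minors_def by (auto simp: jacobian_mat_def)
  have cards: "card {i. i < length fs \<and> i \<in> U} = r" "card {j. j < n \<and> j \<in> V} = r"
    using UV(1-4) by (metis (no_types, lifting) Collect_cong Collect_mem_eq lessThan_iff subsetD)+
  have pU: "pick U i < length fs" and pV: "pick V i < n" if "i < r" for i
    using that UV(1-4) pick_in_set_le[of i U] pick_in_set_le[of i V] by auto
  have "submatrix (jacobian_mat n fs) U V = mat r r (\<lambda>(i, j). partial_deriv (pick V j) (fs ! pick U i))"
    by (rule eq_matI) (auto simp: submatrix_def jacobian_mat_def cards pU pV)
  then show ?thesis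
    using pU pV UV(5) by (intro exI[of _ "\<lambda>i. fs ! pick U i"] exI[of _ "pick V"]) auto
qed

lemma zero_in_IDer_log:
  assumes "ideal I (mpoly_ring n)"
  shows "(\<lambda>x. 0) \<in> IDer_log coeff_ring (mpoly_ring n) mpoly_const I"
proof -
  interpret I: ideal_of "polys n" I by (rule ideal_ofI[OF subring_of_polys]) (use assms in \<open>simp add: mpoly_ring_eq\<close>)
  have "(\<lambda>x. 0) \<in> Der_log coeff_ring (mpoly_ring n) mpoly_const I"
    by (auto simp: Der_log_def Der_polys_iff alg_linear_polys_iff)
  from IDer_log_ideal_element[OF assms I.ideal_zero this] show ?thesis by simp
qed

definition integrating_multipliers :: "nat \<Rightarrow> 'a::comm_ring_1 mpoly set \<Rightarrow> 'a mpoly set" where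
  "integrating_multipliers n I = {c \<in> polys n. \<forall>d\<in>Der_log coeff_ring (mpoly_ring n) mpoly_const I.
     (\<lambda>x. c * d x) \<in> IDer_log coeff_ring (mpoly_ring n) mpoly_const I}"

text \<open>
  Closure under sums is closure of the integrable derivations under sums; closure under
  multiples is immediate, because \<open>a \<delta>\<close> is logarithmic when \<open>\<delta>\<close> is.
\<close>

lemma ideal_integrating_multipliers:
  fixes I :: "'a::comm_ring_1 mpoly set"
  assumes I: "ideal I (mpoly_ring n)"
  shows "ideal (integrating_multipliers n I) (mpoly_ring n)"
proof -
  interpret I: ideal_of "polys n" I by (rule ideal_ofI[OF subring_of_polys]) (use I in \<open>simp add: mpoly_ring_eq\<close>)
  show ?thesis
    unfolding mpoly_ring_eq I.ideal_iff
  proof (intro conjI ballI)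
    show "integrating_multipliers n I \<subseteq> polys n" by (auto simp: integrating_multipliers_def)
    show "0 \<in> integrating_multipliers n I"
      using zero_in_IDer_log[OF I] by (simp add: integrating_multipliers_def)
    show "b + c \<in> integrating_multipliers n I"
      if "b \<in> integrating_multipliers n I" "c \<in> integrating_multipliers n I" for b c
      using that IDer_log_add[OF I] by (auto simp: integrating_multipliers_def distrib_right)
    fix a c :: "'a mpoly" assume a: "a \<in> polys n" and c: "c \<in> integrating_multipliers n I"
    have "(\<lambda>x. a * c * d x) \<in> IDer_log coeff_ring (mpoly_ring n) mpoly_const I"
      if d: "d \<in> Der_log coeff_ring (mpoly_ring n) mpoly_const I" for d
    proof -
      have "(\<lambda>x. a * d x) \<in> Der_log coeff_ring (mpoly_ring n) mpoly_const I"
        using d a by (auto simp: Der_log_def Der_polys_iff alg_linear_polys_iff algebra_simps intro: I.ideal_mult)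
      then have "(\<lambda>x. c * (a * d x)) \<in> IDer_log coeff_ring (mpoly_ring n) mpoly_const I"
        using c by (simp add: integrating_multipliers_def)
      then show ?thesis by (simp add: mult_ac)
    qed
    then show "a * c \<in> integrating_multipliers n I"
      using a c by (auto simp: integrating_multipliers_def)
  qed
qed

section \<open>Derivations of the quotient\<close>

locale polys_quotient =
  fixes n :: nat and I :: "'a::comm_ring_1 mpoly set"
  assumes I: "ideal I (mpoly_ring n)"
begin

sublocale ideal_of "polys n" I
  by (rule ideal_ofI[OF subring_of_polys]) (use I in \<open>simp add: mpoly_ring_eq\<close>)

abbreviation (input) A where "A \<equiv> mpoly_ring n Quot I"

definition cls :: "'a mpoly \<Rightarrow> 'a mpoly set" where
  "cls x = I +>\<^bsub>mpoly_ring n\<^esub> x"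

lemma cls_hom: "ring_hom_ring (mpoly_ring n) A cls"
proof -
  have "cls = (+>\<^bsub>mpoly_ring n\<^esub>) I" by (rule ext) (simp add: cls_def)
  then show ?thesis using ideal.rcos_ring_hom_ring[OF I] by simp
qed

lemma carrier_quotient: "carrier A = cls ` polys n"
  by (auto simp: FactRing_def A_RCOSETS_def' cls_def mpoly_ring_eq)

lemma cls_closed [simp]: "x \<in> polys n \<Longrightarrow> cls x \<in> carrier A"
  using carrier_quotient by blast

lemma cls_add: "x \<in> polys n \<Longrightarrow> y \<in> polys n \<Longrightarrow> cls (x + y) = cls x \<oplus>\<^bsub>A\<^esub> cls y"
  and cls_mult: "x \<in> polys n \<Longrightarrow> y \<in> polys n \<Longrightarrow> cls (x * y) = cls x \<otimes>\<^bsub>A\<^esub> cls y"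
  and cls_zero: "cls 0 = \<zero>\<^bsub>A\<^esub>"
proof -
  interpret h: ring_hom_ring "mpoly_ring n" A cls by (rule cls_hom)
  show "x \<in> polys n \<Longrightarrow> y \<in> polys n \<Longrightarrow> cls (x + y) = cls x \<oplus>\<^bsub>A\<^esub> cls y"
    using h.hom_add[of x y] by (simp add: mpoly_ring_eq)
  show "x \<in> polys n \<Longrightarrow> y \<in> polys n \<Longrightarrow> cls (x * y) = cls x \<otimes>\<^bsub>A\<^esub> cls y"
    using h.hom_mult[of x y] by (simp add: mpoly_ring_eq)
  show "cls 0 = \<zero>\<^bsub>A\<^esub>" using h.hom_zero by (simp add: mpoly_ring_eq)
qed

lemma cls_eq_iff:
  assumes "x \<in> polys n" "y \<in> polys n"
  shows "cls x = cls y \<longleftrightarrow> x - y \<in> I"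
proof -
  interpret R: cring "mpoly_ring n :: 'a mpoly ring" using is_cring by (simp add: mpoly_ring_eq)
  have "\<ominus>\<^bsub>mpoly_ring n\<^esub> y = - y"
    using assms by (intro R.minus_equality) (auto simp: mpoly_ring_eq)
  then have "x \<ominus>\<^bsub>mpoly_ring n\<^esub> y = x - y"
    by (simp add: a_minus_def mpoly_ring_eq)
  then show ?thesis
    using R.quotient_eq_iff_same_a_r_cos[OF I, of x y] assms by (simp add: cls_def mpoly_ring_eq)
qed

lemma cls_sum:
  assumes "\<And>i. i \<le> \<alpha> \<Longrightarrow> f i \<in> polys n"
  shows "cls (\<Sum>i\<le>\<alpha>. f i) = (\<Oplus>\<^bsub>A\<^esub>i\<in>{..\<alpha>::nat}. cls (f i))"
proof -
  interpret h: ring_hom_ring "mpoly_ring n" A cls by (rule cls_hom)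
  have "cls (finsum (mpoly_ring n) f {..\<alpha>}) = finsum A (cls \<circ> f) {..\<alpha>}"
    using assms by (intro h.hom_finsum) (auto simp: mpoly_ring_eq)
  then show ?thesis
    using assms finsum_eq[of "{..\<alpha>}" f] by (simp add: mpoly_ring_eq o_def)
qed

lemma quot_const_eq: "quot_const n I c = cls (mpoly_const c)"
  by (simp add: quot_const_def cls_def)

lemma cls_rep: "\<exists>rep. \<forall>X\<in>carrier A. rep X \<in> polys n \<and> cls (rep X) = X"
  unfolding carrier_quotient by (intro bchoice) blast

text \<open>
  The lift is \<open>\<Sum> a\<^sub>j \<partial>\<^sub>j\<close> where \<open>a\<^sub>j\<close> represents \<open>\<delta>\<close> of the class of the \<open>j\<close>-th variable.
\<close>

lemma Der_quotient_lift:
  assumes \<delta>: "\<delta> \<in> Der coeff_ring A (quot_const n I)"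
  shows "\<exists>d\<in>Der_log coeff_ring (mpoly_ring n) mpoly_const I. \<forall>x\<in>polys n. \<delta> (cls x) = cls (d x)"
proof -
  obtain rep where rep: "\<And>X. X \<in> carrier A \<Longrightarrow> rep X \<in> polys n" "\<And>X. X \<in> carrier A \<Longrightarrow> cls (rep X) = X"
    using cls_rep by blast
  have \<delta>c: "\<delta> X \<in> carrier A" if "X \<in> carrier A" for X
    using \<delta> that unfolding Der_def alg_linear_def by blast
  define d0 where "d0 x = rep (\<delta> (cls x))" for x
  have d0: "d0 x \<in> polys n" "cls (d0 x) = \<delta> (cls x)" if "x \<in> polys n" for x
    using rep[OF \<delta>c[OF cls_closed[OF that]]] by (simp_all add: d0_def)
  have d0_add: "d0 (x + y) - (d0 x + d0 y) \<in> I" if "x \<in> polys n" "y \<in> polys n" for x y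
  proof -
    have "\<delta> (cls x \<oplus>\<^bsub>A\<^esub> cls y) = \<delta> (cls x) \<oplus>\<^bsub>A\<^esub> \<delta> (cls y)"
      using \<delta> that cls_closed unfolding Der_def alg_linear_def by blast
    then have "cls (d0 (x + y)) = cls (d0 x + d0 y)" using that d0 by (simp add: cls_add)
    then show ?thesis using cls_eq_iff that d0(1) by simp
  qed
  have d0_mult: "d0 (x * y) - (x * d0 y + y * d0 x) \<in> I" if "x \<in> polys n" "y \<in> polys n" for x y
  proof -
    have "\<delta> (cls x \<otimes>\<^bsub>A\<^esub> cls y) = (cls x \<otimes>\<^bsub>A\<^esub> \<delta> (cls y)) \<oplus>\<^bsub>A\<^esub> (cls y \<otimes>\<^bsub>A\<^esub> \<delta> (cls x))"
      using \<delta> that cls_closed unfolding Der_def by blast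
    then have "cls (d0 (x * y)) = cls (x * d0 y + y * d0 x)" using that d0 by (simp add: cls_add cls_mult)
    then show ?thesis using cls_eq_iff that d0(1) by simp
  qed
  have d0_scale: "d0 (mpoly_const c * x) - mpoly_const c * d0 x \<in> I" if "x \<in> polys n" for c x
  proof -
    have "\<delta> (cls (mpoly_const c) \<otimes>\<^bsub>A\<^esub> cls x) = cls (mpoly_const c) \<otimes>\<^bsub>A\<^esub> \<delta> (cls x)"
      using \<delta> that cls_closed unfolding Der_def alg_linear_def quot_const_eq coeff_ring_eq subring_record_simps
      by blast
    then have "cls (d0 (mpoly_const c * x)) = cls (mpoly_const c * d0 x)" using that d0 by (simp add: cls_mult)
    then show ?thesis using cls_eq_iff that d0(1) by simp
  qed
  \<comment> \<open>From \<open>1 * 1 = 1\<close>: the Leibniz rule leaves \<open>- d0 1\<close>.\<close>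
  have d0_1: "d0 1 \<in> I"
    using ideal_uminus[OF d0_mult[of 1 1]] by simp
  have d0_const: "d0 (mpoly_const c) \<in> I" for c
    using ideal_add[OF d0_scale[of 1 c] ideal_mult[OF mpoly_const_in_polys d0_1, of c]] by simp
  define d where "d x = (\<Sum>j<n. partial_deriv j x * d0 (mpoly_var j))" for x
  have dd0: "d0 x - d x \<in> I" if "x \<in> polys n" for x
    unfolding d_def using Der_polys_formula_mod[OF is_ideal_of d0(1) d0_const d0_add d0_mult that] .
  have dT: "d x \<in> polys n" if "x \<in> polys n" for x
    unfolding d_def using that d0 by (intro sum_closed mult_closed partial_deriv_closed) auto
  have "d \<in> Der coeff_ring (mpoly_ring n) mpoly_const"
    unfolding Der_polys_iff alg_linear_polys_iff
  proof (intro conjI ballI allI dT)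
    show "d (x + y) = d x + d y" for x y
      by (simp add: d_def partial_deriv_add distrib_right sum.distrib)
    show "d (mpoly_const c * x) = mpoly_const c * d x" for c x
      by (simp add: d_def partial_deriv_mult sum_distrib_left mult.assoc)
    show "d (x * y) = x * d y + y * d x" for x y
      by (simp add: d_def partial_deriv_mult distrib_right sum.distrib sum_distrib_left mult.assoc)
  qed
  moreover have "d x \<in> I" if x: "x \<in> I" for x
  proof -
    have xT: "x \<in> polys n" using x by (rule ideal_subset)
    have "cls x = cls 0" using cls_eq_iff[OF xT zero_closed] x by simp
    then have "d0 x = d0 0" by (simp add: d0_def)
    then have "d0 x \<in> I" using ideal_uminus[OF d0_add[of 0 0]] by simp
    then show ?thesis using ideal_diff[OF _ dd0[OF xT], of "d0 x"] by simp
  qed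
  moreover have "\<delta> (cls x) = cls (d x)" if "x \<in> polys n" for x
    using cls_eq_iff[OF d0(1)[OF that] dT[OF that]] dd0[OF that] d0(2)[OF that] by simp
  ultimately show ?thesis unfolding Der_log_def by blast
qed

lemma alg_linear_quotient:
  assumes d: "alg_linear coeff_ring (mpoly_ring n) mpoly_const d"
    and \<delta>: "\<And>x. x \<in> polys n \<Longrightarrow> \<delta> (cls x) = cls (d x)"
  shows "alg_linear coeff_ring A (quot_const n I) \<delta>"
  using d unfolding alg_linear_polys_iff
  unfolding alg_linear_def carrier_quotient quot_const_eq
  by (auto simp: \<delta> cls_add[symmetric] cls_mult[symmetric])

text \<open>
  Because the maps \<open>D \<alpha>\<close> preserve \<open>I\<close>, the classes of their values depend on the class of the
  argument only.
\<close>

lemma IDer_quotient: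
  assumes e: "e \<in> IDer_log coeff_ring (mpoly_ring n) mpoly_const I"
    and \<epsilon>: "\<And>x. x \<in> polys n \<Longrightarrow> \<epsilon> (cls x) = cls (e x)"
  shows "\<epsilon> \<in> IDer coeff_ring A (quot_const n I)"
proof -
  obtain D where D: "D \<in> HS coeff_ring (mpoly_ring n) mpoly_const"
    "\<And>x. x \<in> polys n \<Longrightarrow> D 1 x = e x" "\<And>\<alpha> x. x \<in> I \<Longrightarrow> D \<alpha> x \<in> I"
    and eD: "e \<in> Der coeff_ring (mpoly_ring n) mpoly_const"
    using e unfolding IDer_log_polys_iff by blast
  have lin: "alg_linear coeff_ring (mpoly_ring n) mpoly_const (D \<alpha>)" for \<alpha>
    using D(1) unfolding HS_polys_iff by blast
  have closed: "D \<alpha> x \<in> polys n" if "x \<in> polys n" for \<alpha> x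
    using lin that unfolding alg_linear_polys_iff by blast
  obtain rep where rep: "\<And>X. X \<in> carrier A \<Longrightarrow> rep X \<in> polys n" "\<And>X. X \<in> carrier A \<Longrightarrow> cls (rep X) = X"
    using cls_rep by blast
  define E where "E \<alpha> X = cls (D \<alpha> (rep X))" for \<alpha> X
  have E: "E \<alpha> (cls x) = cls (D \<alpha> x)" if x: "x \<in> polys n" for \<alpha> x
  proof -
    let ?y = "rep (cls x)"
    have y: "?y \<in> polys n" "cls ?y = cls x" using rep x by simp_all
    then have "?y - x \<in> I" using cls_eq_iff x by blast
    moreover have "D \<alpha> ?y = D \<alpha> (?y - x) + D \<alpha> x"
      using lin[of \<alpha>] y(1) x unfolding alg_linear_polys_iff by (metis diff_add_cancel diff_closed)
    ultimately have "D \<alpha> ?y - D \<alpha> x \<in> I" using D(3) by simp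
    then show ?thesis using cls_eq_iff closed y x by (simp add: E_def)
  qed
  have "E \<in> HS coeff_ring A (quot_const n I)"
    unfolding HS_def
  proof (intro CollectI conjI allI ballI)
    show "alg_linear coeff_ring A (quot_const n I) (E \<alpha>)" for \<alpha>
      by (rule alg_linear_quotient[OF lin E])
    show "E 0 X = X" if "X \<in> carrier A" for X
      using that D(1) E unfolding carrier_quotient HS_polys_iff by auto
    fix \<alpha> X Y assume XY: "X \<in> carrier A" "Y \<in> carrier A"
    then obtain x y where xy: "X = cls x" "Y = cls y" "x \<in> polys n" "y \<in> polys n"
      unfolding carrier_quotient by blast
    have "E \<alpha> (X \<otimes>\<^bsub>A\<^esub> Y) = cls (D \<alpha> (x * y))"
      using xy E by (simp add: cls_mult[symmetric])
    also have "D \<alpha> (x * y) = (\<Sum>i\<le>\<alpha>. D i x * D (\<alpha> - i) y)"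
      using D(1) xy unfolding HS_polys_iff by blast
    also have "cls \<dots> = (\<Oplus>\<^bsub>A\<^esub>i\<in>{..\<alpha>}. cls (D i x * D (\<alpha> - i) y))"
      using xy closed by (intro cls_sum) simp
    also have "\<dots> = (\<Oplus>\<^bsub>A\<^esub>i\<in>{..\<alpha>}. E i X \<otimes>\<^bsub>A\<^esub> E (\<alpha> - i) Y)"
      using xy closed E by (simp add: cls_mult)
    finally show "E \<alpha> (X \<otimes>\<^bsub>A\<^esub> Y) = (\<Oplus>\<^bsub>A\<^esub>i\<in>{..\<alpha>}. E i X \<otimes>\<^bsub>A\<^esub> E (\<alpha> - i) Y)" .
  qed
  moreover have "\<epsilon> \<in> Der coeff_ring A (quot_const n I)"
    unfolding Der_def
  proof (intro CollectI conjI ballI)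
    have el: "alg_linear coeff_ring (mpoly_ring n) mpoly_const e" using eD unfolding Der_polys_iff by blast
    then have ec: "e x \<in> polys n" if "x \<in> polys n" for x using that unfolding alg_linear_polys_iff by blast
    show "alg_linear coeff_ring A (quot_const n I) \<epsilon>" by (rule alg_linear_quotient[OF el \<epsilon>])
    fix X Y assume "X \<in> carrier A" "Y \<in> carrier A"
    then obtain x y where xy: "X = cls x" "Y = cls y" "x \<in> polys n" "y \<in> polys n"
      unfolding carrier_quotient by blast
    have "e (x * y) = x * e y + y * e x" using eD xy unfolding Der_polys_iff by blast
    then show "\<epsilon> (X \<otimes>\<^bsub>A\<^esub> Y) = (X \<otimes>\<^bsub>A\<^esub> \<epsilon> Y) \<oplus>\<^bsub>A\<^esub> (Y \<otimes>\<^bsub>A\<^esub> \<epsilon> X)"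
      using xy ec by (simp add: cls_mult[symmetric] cls_add[symmetric] \<epsilon>)
  qed
  moreover have "E 1 X = \<epsilon> X" if "X \<in> carrier A" for X
    using that E D(2) \<epsilon> unfolding carrier_quotient by auto
  ultimately show ?thesis unfolding IDer_def by blast
qed

lemma ideal_cls_image:
  assumes "ideal J (mpoly_ring n)"
  shows "ideal (cls ` J) A"
proof -
  have J: "ideal J (subring_record (polys n))" using assms by (simp add: mpoly_ring_eq)
  interpret J: ideal_of "polys n" J by (rule ideal_ofI[OF subring_of_polys J])
  have R: "cring (mpoly_ring n :: 'a mpoly ring)" using is_cring by (simp add: mpoly_ring_eq)
  show ?thesis
  proof (rule cring_idealI)
    show "cring A" by (rule ideal.quotient_is_cring[OF I R])
    show "cls ` J \<subseteq> carrier A" using J.ideal_subset by auto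
    show "\<zero>\<^bsub>A\<^esub> \<in> cls ` J" using J.ideal_zero cls_zero[symmetric] by blast
    show "x \<oplus>\<^bsub>A\<^esub> y \<in> cls ` J" if "x \<in> cls ` J" "y \<in> cls ` J" for x y
      using that J.ideal_add J.ideal_subset by (auto simp: cls_add[symmetric])
    show "a \<otimes>\<^bsub>A\<^esub> x \<in> cls ` J" if "a \<in> carrier A" "x \<in> cls ` J" for a x
      using that J.ideal_mult J.ideal_subset by (auto simp: carrier_quotient cls_mult[symmetric])
  qed
qed

end

theorem theorem5p3:
  fixes n r :: nat
    and I J0 :: "'a::comm_ring_1 mpoly set"
    and fs :: "'a mpoly list"
  assumes "regular_ring (coeff_ring :: 'a ring)"
    and "radical_ideal I (mpoly_ring n)"
    and "\<exists>P\<in>min_primes (mpoly_ring n) I. height (mpoly_ring n) P = enat r"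
    and "\<forall>P\<in>min_primes (mpoly_ring n) I. height (mpoly_ring n) P \<le> enat r"
    and "set fs \<subseteq> carrier (mpoly_ring n)"
    and "I = Idl\<^bsub>mpoly_ring n\<^esub> (set fs)"
    and "ideal J0 (mpoly_ring n)"
    and "(\<lambda>p. I +>\<^bsub>mpoly_ring n\<^esub> p) ` J0 = fitting_ideal n I fs r"
  shows "ideal_module_prod (mpoly_ring n) (J0 <+>\<^bsub>mpoly_ring n\<^esub> I)
           (Der_log coeff_ring (mpoly_ring n) mpoly_const I)
         \<subseteq> IDer_log coeff_ring (mpoly_ring n) mpoly_const I
       \<and> ideal_module_prod (quot_alg n I) (fitting_ideal n I fs r)
           (Der coeff_ring (quot_alg n I) (quot_const n I))
         \<subseteq> IDer coeff_ring (quot_alg n I) (quot_const n I)"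
proof -
  have I: "ideal I (mpoly_ring n)" using assms(2) by (simp add: radical_ideal_def)
  interpret polys_quotient n I by (rule polys_quotient.intro[OF I])
  have R: "cring (mpoly_ring n :: 'a mpoly ring)" using is_cring by (simp add: mpoly_ring_eq)
  interpret R: cring "mpoly_ring n :: 'a mpoly ring" by (rule R)
  interpret A: cring "quot_alg n I" by (rule ideal.quotient_is_cring[OF I R])
  let ?X = "integrating_multipliers n I"
  have X: "ideal ?X (mpoly_ring n)" by (rule ideal_integrating_multipliers[OF I])
  interpret X: ideal_of "polys n" ?X
    by (rule ideal_ofI[OF subring_of_polys]) (use X in \<open>simp add: mpoly_ring_eq\<close>)
  have XD: "(\<lambda>x. c * d x) \<in> IDer_log coeff_ring (mpoly_ring n) mpoly_const I"
    if "c \<in> ?X" "d \<in> Der_log coeff_ring (mpoly_ring n) mpoly_const I" for c d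
    using that by (simp add: integrating_multipliers_def)
  have IX: "I \<subseteq> ?X"
    using IDer_log_ideal_element[OF I] ideal_subset by (auto simp: integrating_multipliers_def)
  have fsI: "set fs \<subseteq> I" using R.genideal_self[OF assms(5)] assms(6) by simp
  have minors: "minors r (jacobian_mat n fs) \<subseteq> ?X"
  proof
    fix m assume "m \<in> minors r (jacobian_mat n fs)"
    from minors_jacobian_det[OF this] obtain f \<beta> where
      f: "\<And>i. i < r \<Longrightarrow> f i \<in> set fs" and \<beta>: "\<And>j. j < r \<Longrightarrow> \<beta> j < n"
      and m: "m = det (mat r r (\<lambda>(i, j). partial_deriv (\<beta> j) (f i)))"
      by blast
    have fI: "f i \<in> I" if "i < r" for i using f[OF that] fsI by blast
    have "m \<in> polys n" unfolding m using fI ideal_subset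
      by (intro det_closed[of _ r]) (auto intro!: partial_deriv_closed)
    moreover have "(\<lambda>x. m * d x) \<in> IDer_log coeff_ring (mpoly_ring n) mpoly_const I"
      if "d \<in> Der_log coeff_ring (mpoly_ring n) mpoly_const I" for d
      unfolding m by (rule IDer_log_jacobian_det[OF assms(1,2,4) fI \<beta> that])
    ultimately show "m \<in> ?X" unfolding integrating_multipliers_def by blast
  qed
  have fit: "fitting_ideal n I fs r \<subseteq> cls ` ?X"
    unfolding fitting_ideal_def cls_def[symmetric]
    by (intro A.genideal_minimal ideal_cls_image X image_mono minors)
  have J0X: "J0 \<subseteq> ?X"
  proof
    fix c assume c: "c \<in> J0"
    have cT: "c \<in> polys n"
      using ideal.Icarr[OF assms(7) c] by (simp add: mpoly_ring_eq)
    have "cls c \<in> cls ` ?X" using fit c assms(8) unfolding cls_def by blast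
    then obtain x where x: "x \<in> ?X" "cls c = cls x" by blast
    then have "c - x \<in> ?X" using cls_eq_iff[OF cT X.ideal_subset] IX by blast
    then show "c \<in> ?X" using X.ideal_add[OF _ x(1)] by fastforce
  qed
  have sumX: "J0 <+>\<^bsub>mpoly_ring n\<^esub> I \<subseteq> ?X"
    unfolding set_add_def' using J0X IX X.ideal_add by (auto simp: mpoly_ring_eq)
  have part1: "e \<in> IDer_log coeff_ring (mpoly_ring n) mpoly_const I"
    if "e \<in> ideal_module_prod (mpoly_ring n) (J0 <+>\<^bsub>mpoly_ring n\<^esub> I)
      (Der_log coeff_ring (mpoly_ring n) mpoly_const I)" for e
    using that
  proof (induction rule: ideal_module_prod.induct)
    case zero
    then show ?case using zero_in_IDer_log[OF I] by (simp add: mpoly_ring_eq)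
  next
    case (add a d e)
    then show ?case using IDer_log_add[OF I XD] sumX by (simp add: mpoly_ring_eq subset_iff)
  qed
  have part2: "\<exists>e\<in>IDer_log coeff_ring (mpoly_ring n) mpoly_const I. \<forall>x\<in>polys n. \<epsilon> (cls x) = cls (e x)"
    if "\<epsilon> \<in> ideal_module_prod (quot_alg n I) (fitting_ideal n I fs r)
      (Der coeff_ring (quot_alg n I) (quot_const n I))" for \<epsilon>
    using that
  proof (induction rule: ideal_module_prod.induct)
    case zero
    then show ?case using zero_in_IDer_log[OF I] by (intro bexI[of _ "\<lambda>x. 0"]) (auto simp: cls_zero)
  next
    case (add a \<delta> \<epsilon>)
    obtain e where e: "e \<in> IDer_log coeff_ring (mpoly_ring n) mpoly_const I"
      "\<And>x. x \<in> polys n \<Longrightarrow> \<epsilon> (cls x) = cls (e x)" using add.IH by blast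
    obtain c where c: "c \<in> ?X" "a = cls c" using add.hyps(1) fit by blast
    obtain d where d: "d \<in> Der_log coeff_ring (mpoly_ring n) mpoly_const I"
      "\<And>x. x \<in> polys n \<Longrightarrow> \<delta> (cls x) = cls (d x)" using Der_quotient_lift[OF add.hyps(2)] by blast
    have "d \<in> Der coeff_ring (mpoly_ring n) mpoly_const" "e \<in> Der coeff_ring (mpoly_ring n) mpoly_const"
      using d(1) e(1) by (simp_all add: Der_log_def IDer_log_def)
    then have closed: "d x \<in> polys n" "e x \<in> polys n" if "x \<in> polys n" for x
      using that by (simp_all add: Der_polys_iff alg_linear_polys_iff)
    have "(\<lambda>x. c * d x + e x) \<in> IDer_log coeff_ring (mpoly_ring n) mpoly_const I"
      by (rule IDer_log_add[OF I XD[OF c(1) d(1)] e(1)])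
    then show ?case
      using c X.ideal_subset[OF c(1)] closed d(2) e(2)
      by (intro bexI[of _ "\<lambda>x. c * d x + e x"]) (auto simp: cls_add cls_mult)
  qed
  show ?thesis
  proof (intro conjI subsetI)
    fix \<epsilon> assume "\<epsilon> \<in> ideal_module_prod (quot_alg n I) (fitting_ideal n I fs r)
      (Der coeff_ring (quot_alg n I) (quot_const n I))"
    from part2[OF this] obtain e where "e \<in> IDer_log coeff_ring (mpoly_ring n) mpoly_const I"
      "\<And>x. x \<in> polys n \<Longrightarrow> \<epsilon> (cls x) = cls (e x)" by blast
    then show "\<epsilon> \<in> IDer coeff_ring (quot_alg n I) (quot_const n I)" by (rule IDer_quotient)
  qed (rule part1)
qed

end
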